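(* For every sequence $(\alpha_n)$ of positive numbers converging to $0$, the forms $(E_{\alpha_n},H^1(\mu))$ on $L^2(\mu)$ Mosco-converge to the form $(\mathcal E,H^1(\Gamma))$ on $L^2(\Gamma)$.
   Context: Setting. Fix $\varepsilon>0$ and integers $m<n$. $^*$ denotes transposition; $\nabla^*$ is the divergence, $\nabla^*[w]=\sum_i\partial_iw_i$ for a vector field and $(\nabla^*M)_j=\sum_i\partial_iM_{ij}$ for a matrix field. Let $v,u$ be vector fields and $\sigma$ a matrix field on $\mathbb R^n$, bounded and Lipschitz, with $a=\sigma\sigma^*$ uniformly elliptic (they are the coefficients of the diffusion $dY_t=\frac1\alpha v(Y_t)dt+u(Y_t)dt+\sqrt{2\varepsilon}\sigma(Y_t)dB_t$). Let $G:\mathbb R^n\to\mathbb R^m$ have Jacobian matrix $DG=(\partial_jG_i)$ with $DG\,v=0$ and compact level sets. Let $h$ be a strictly positive $C^1$ function with $\nabla^*[vh]=0$ and $-\nabla^*[uh]+\varepsilon\sum_{i,j}\partial_{ij}(a_{ij}h)\le0$. Put $d\mu=h\,dx$, $\Phi=u-\frac\varepsilon h(\nabla^*(ah))^*$. $L^2(\mu)$, $H^1(\mu)$ are the weighted spaces with scalar products $\int fg\,d\mu$, $\int(fg+\nabla f\cdot\nabla g)\,d\mu$. The Dirichlet form of the diffusion is $E_\alpha=E^s_\alpha+E^a_\alpha$ on $H^1(\mu)$, with $E^s_\alpha(f,g)=\varepsilon\int(\sigma^*\nabla f)\cdot(\sigma^*\nabla g)\,d\mu+\frac12\int\frac1h\nabla^*(\Phi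 h)fg\,d\mu$ and $E^a_\alpha(f,g)=\frac12\int(\frac1\alpha v+\Phi)^*[f\nabla g-g\nabla f]\,d\mu$; $E^{s,1}_\alpha=E^s_\alpha+\langle\cdot,\cdot\rangle_{L^2(\mu)}$ and $E^{s,1}_\alpha(f)=E^{s,1}_\alpha(f,f)$ ($+\infty$ if $f\notin H^1(\mu)$). $\Gamma=\mathbb R^n/\!\sim$, where $x\sim y$ iff $x,y$ are in the same connected component of a level set of $G$; $\pi$ is the canonical projection; $\overline f=f\circ\pi$. $L^2(\Gamma)=\{f:\overline f\in L^2(\mu)\}$, $H^1(\Gamma)=\{f:\overline f\in H^1(\mu)\}$, with the induced scalar products. $\mathcal E(f_1,f_2)=E_\alpha(\overline{f_1},\overline{f_2})=\varepsilon\int(\nabla\overline{f_1})^*a\nabla\overline{f_2}\,d\mu+\frac12\int\Phi^*[\overline{f_1}\nabla\overline{f_2}-\overline{f_2}\nabla\overline{f_1}]\,d\mu+\frac12\int\frac1h\nabla^*(\Phi h)\overline{f_1}\,\overline{f_2}\,d\mu$ (independent of $\alpha$), with domain $H^1(\Gamma)$. Convergence. A sequence $(u_n)$ in $L^2(\mu)$ converges strongly to $u\in L^2(\Gamma)$ if $\|u_n-u\circ\pi\|_{L^2(\mu)}\to0$. It converges weakly to $u\in L^2(\Gamma)$ if $\sup_n\|u_n\|_{L^2(\mu)}<\infty$ and $\langle u_n,w\circ\pi\rangle_{L^2(\mu)}\to\langle u,w\rangle_{L^2(\Gamma)}$ for all $w\in L^2(\Gamma)$. Mosco-convergence (after Hino).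 $E_{\alpha_n}$ Mosco-converges to $\mathcal E$ if (1) and (2) hold: (1) for any sequence $(u_n)$ in $L^2(\mu)$ weakly converging to $u\in L^2(\Gamma)$ with $\sup_nE^{s,1}_{\alpha_n}(u_n)<\infty$, one has $u\in H^1(\Gamma)$; (2) for all $w\in H^1(\Gamma)$ and all sequences $(u_n)$ in $H^1(\mu)$ weakly converging in $L^2(\mu)$ to $u\in H^1(\Gamma)$ (i.e. to $u\circ\pi$), there is a sequence $(w_n)$ strongly converging to $w$ with $E_{\alpha_n}(u_n,w_n)\to\mathcal E(u,w)$. Condition (2) may be replaced by the weaker condition (2'): for all subsequences $(\alpha_{n_k})$, all sequences $(u_k)$ weakly converging in $L^2(\mu)$ to $u\in H^1(\Gamma)$ (i.e. to $u\circ\pi$) with $\sup_kE^{s,1}_{\alpha_{n_k}}(u_k)<\infty$, and all $w\in H^1(\Gamma)$, there is a sequence $(w_k)$ strongly converging to $w$ with $\liminf_kE_{\alpha_{n_k}}(u_k,w_k)\le\mathcal E(u,w)$. Thus Mosco-convergence is understood to hold as soon as (1) and either (2) or (2') hold.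
   Formalization: In condition (1), weak convergence to u is taken in L²(μ) to u∘π (tested against all of L²(μ), as in (2) and (2')), not only against w∘π with w in L²(Γ); with the latter notion the claim is false. *)

theory Defs
  imports "HOL-Analysis.Analysis"
begin

text \<open>Smooth test functions on \<open>\<real>\<^sup>n\<close>, where \<open>n = CARD('n)\<close>.\<close>

definition partial :: "'n::finite \<Rightarrow> (real^'n \<Rightarrow> real) \<Rightarrow> real^'n \<Rightarrow> real" where
  "partial i f x = frechet_derivative f (at x) (axis i 1)"

definition grad :: "(real^'n::finite \<Rightarrow> real) \<Rightarrow> real^'n \<Rightarrow> real^'n" where
  "grad f x = (\<chi> i. partial i f x)"

primrec C_k :: "nat \<Rightarrow> (real^'n::finite \<Rightarrow> real) \<Rightarrow> bool" where
  "C_k 0 f \<longleftrightarrow> continuous_on UNIV f"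
| "C_k (Suc k) f \<longleftrightarrow> (\<forall>x. f differentiable (at x)) \<and> (\<forall>i. C_k k (partial i f))"

definition test_functions :: "(real^'n::finite \<Rightarrow> real) set" where
  "test_functions = {\<phi>. (\<forall>k. C_k k \<phi>) \<and> compact (closure {x. \<phi> x \<noteq> 0})}"


text \<open>
  The coefficients are only Lipschitz, so divergences and second derivatives are taken in the
  sense of distributions. A vector field \<open>F\<close> has weak divergence \<open>D\<close> if
  \<open>\<integral> F \<cdot> \<nabla>\<phi> dx = - \<integral> D \<phi> dx\<close> for all test functions \<open>\<phi>\<close>; such a \<open>D\<close> is unique up to
  Lebesgue null sets.
\<close>

definition locally_integrable ::
    "(real^'n::finite \<Rightarrow> 'b::{banach, second_countable_topology}) \<Rightarrow> bool" where
  "locally_integrable f \<longleftrightarrow> (\<forall>K. compact K \<longrightarrow> set_integrable lborel K f)"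

definition has_weak_divergence ::
    "(real^'n::finite \<Rightarrow> real^'n) \<Rightarrow> (real^'n \<Rightarrow> real) \<Rightarrow> bool" where
  "has_weak_divergence F D \<longleftrightarrow> locally_integrable F \<and> locally_integrable D \<and>
     (\<forall>\<phi>\<in>test_functions. (LINT x|lborel. F x \<bullet> grad \<phi> x) = - (LINT x|lborel. D x * \<phi> x))"

text \<open>Divergence of a matrix field: \<open>(\<nabla>\<^sup>* M)\<^sub>j = \<Sum>\<^sub>i \<partial>\<^sub>i M\<^sub>i\<^sub>j\<close>.\<close>

definition has_weak_matrix_divergence ::
    "(real^'n::finite \<Rightarrow> real^'n^'n) \<Rightarrow> (real^'n \<Rightarrow> real^'n) \<Rightarrow> bool" where
  "has_weak_matrix_divergence M d \<longleftrightarrow>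
     (\<forall>j. has_weak_divergence (\<lambda>x. column j (M x)) (\<lambda>x. d x $ j))"

definition has_weak_gradient ::
    "(real^'n::finite \<Rightarrow> real) \<Rightarrow> (real^'n \<Rightarrow> real^'n) \<Rightarrow> bool" where
  "has_weak_gradient f F \<longleftrightarrow> locally_integrable f \<and> locally_integrable F \<and>
     (\<forall>\<phi>\<in>test_functions. \<forall>i.
        (LINT x|lborel. f x * partial i \<phi> x) = - (LINT x|lborel. F x $ i * \<phi> x))"

definition wgrad :: "(real^'n::finite \<Rightarrow> real) \<Rightarrow> real^'n \<Rightarrow> real^'n" where
  "wgrad f = (SOME F. has_weak_gradient f F)"

text \<open>
  \<open>- \<nabla>\<^sup>*[u h] + \<epsilon> \<Sum>\<^sub>i\<^sub>j \<partial>\<^sub>i\<^sub>j (a\<^sub>i\<^sub>j h) \<le> 0\<close> in the sense of distributions, that is, after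
  pairing with nonnegative test functions and integrating by parts.
\<close>

definition weak_subinvariant ::
    "real \<Rightarrow> (real^'n::finite \<Rightarrow> real^'n) \<Rightarrow> (real^'n \<Rightarrow> real^'n^'n) \<Rightarrow> (real^'n \<Rightarrow> real) \<Rightarrow> bool" where
  "weak_subinvariant \<epsilon> u a h \<longleftrightarrow>
     (\<forall>\<phi>\<in>test_functions. (\<forall>x. \<phi> x \<ge> 0) \<longrightarrow>
        (LINT x|lborel. h x * (u x \<bullet> grad \<phi> x)) +
        \<epsilon> * (\<Sum>i\<in>UNIV. \<Sum>j\<in>UNIV.
              LINT x|lborel. a x $ i $ j * h x * partial i (partial j \<phi>) x) \<le> 0)"

definition uniformly_elliptic :: "(real^'n::finite \<Rightarrow> real^'n^'n) \<Rightarrow> bool" where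
  "uniformly_elliptic a \<longleftrightarrow> (\<exists>c>0. \<forall>x \<xi>. \<xi> \<bullet> (a x *v \<xi>) \<ge> c * (norm \<xi>)\<^sup>2)"


text \<open>The spaces \<open>L\<^sup>2(\<mu>)\<close> and \<open>H\<^sup>1(\<mu>)\<close> for \<open>d\<mu> = h dx\<close>, as sets of (representing) functions.\<close>

definition wmeasure :: "(real^'n::finite \<Rightarrow> real) \<Rightarrow> (real^'n) measure" where
  "wmeasure h = density lborel (\<lambda>x. ennreal (h x))"

definition L2 :: "'a measure \<Rightarrow> ('a \<Rightarrow> 'b::{real_normed_vector, second_countable_topology}) set" where
  "L2 M = {f \<in> borel_measurable M. integrable M (\<lambda>x. (norm (f x))\<^sup>2)}"

definition L2_inner :: "'a measure \<Rightarrow> ('a \<Rightarrow> real) \<Rightarrow> ('a \<Rightarrow> real) \<Rightarrow> real" where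
  "L2_inner M f g = (LINT x|M. f x * g x)"

definition L2_norm :: "'a measure \<Rightarrow> ('a \<Rightarrow> real) \<Rightarrow> real" where
  "L2_norm M f = sqrt (L2_inner M f f)"

definition H1 :: "(real^'n::finite \<Rightarrow> real) \<Rightarrow> (real^'n \<Rightarrow> real) set" where
  "H1 h = {f \<in> L2 (wmeasure h). \<exists>F. has_weak_gradient f F \<and> F \<in> L2 (wmeasure h)}"


text \<open>
  \<open>\<Gamma>\<close> is the set of connected components of level sets of \<open>G\<close> and \<open>level_comp G\<close> is the canonical
  projection \<open>\<pi>\<close>. Functions on \<open>\<Gamma>\<close> are functions on sets, of which only the values on
  \<open>range (level_comp G)\<close> matter, because they only ever occur composed with \<open>\<pi>\<close>.
\<close>

definition level_comp :: "(real^'n::finite \<Rightarrow> real^'m::finite) \<Rightarrow> real^'n \<Rightarrow> (real^'n) set" where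
  "level_comp G x = connected_component_set {y. G y = G x} x"

definition L2_Gamma ::
    "(real^'n::finite \<Rightarrow> real) \<Rightarrow> (real^'n \<Rightarrow> real^'m::finite) \<Rightarrow> ((real^'n) set \<Rightarrow> real) set" where
  "L2_Gamma h G = {f. f \<circ> level_comp G \<in> L2 (wmeasure h)}"

definition H1_Gamma ::
    "(real^'n::finite \<Rightarrow> real) \<Rightarrow> (real^'n \<Rightarrow> real^'m::finite) \<Rightarrow> ((real^'n) set \<Rightarrow> real) set" where
  "H1_Gamma h G = {f. f \<circ> level_comp G \<in> H1 h}"


text \<open>
  The Dirichlet forms. In these definitions \<open>\<rho>\<close> stands for \<open>\<nabla>\<^sup>*(\<Phi> h)\<close>.
\<close>

definition E_sym :: "real \<Rightarrow> (real^'n::finite \<Rightarrow> real^'d::finite^'n) \<Rightarrow> (real^'n \<Rightarrow> real) \<Rightarrow>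
    (real^'n \<Rightarrow> real) \<Rightarrow> (real^'n \<Rightarrow> real) \<Rightarrow> (real^'n \<Rightarrow> real) \<Rightarrow> real" where
  "E_sym \<epsilon> \<sigma> h \<rho> f g =
     \<epsilon> * (LINT x|wmeasure h.
            (transpose (\<sigma> x) *v wgrad f x) \<bullet> (transpose (\<sigma> x) *v wgrad g x)) +
     1/2 * (LINT x|wmeasure h. 1 / h x * \<rho> x * f x * g x)"

definition E_anti :: "(real^'n::finite \<Rightarrow> real^'n) \<Rightarrow> (real^'n \<Rightarrow> real) \<Rightarrow> (real^'n \<Rightarrow> real^'n) \<Rightarrow>
    real \<Rightarrow> (real^'n \<Rightarrow> real) \<Rightarrow> (real^'n \<Rightarrow> real) \<Rightarrow> real" where
  "E_anti v h \<Phi> \<alpha> f g =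
     1/2 * (LINT x|wmeasure h.
              ((1/\<alpha>) *\<^sub>R v x + \<Phi> x) \<bullet> (f x *\<^sub>R wgrad g x - g x *\<^sub>R wgrad f x))"

definition E_form where
  "E_form \<epsilon> v \<sigma> h \<Phi> \<rho> \<alpha> f g = E_sym \<epsilon> \<sigma> h \<rho> f g + E_anti v h \<Phi> \<alpha> f g"

definition E_sym1 :: "real \<Rightarrow> (real^'n::finite \<Rightarrow> real^'d::finite^'n) \<Rightarrow> (real^'n \<Rightarrow> real) \<Rightarrow>
    (real^'n \<Rightarrow> real) \<Rightarrow> (real^'n \<Rightarrow> real) \<Rightarrow> ereal" where
  "E_sym1 \<epsilon> \<sigma> h \<rho> f =
     (if f \<in> H1 h then ereal (E_sym \<epsilon> \<sigma> h \<rho> f f + L2_inner (wmeasure h) f f) else \<infinity>)"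

definition E_limit :: "real \<Rightarrow> (real^'n::finite \<Rightarrow> real^'n^'n) \<Rightarrow> (real^'n \<Rightarrow> real) \<Rightarrow>
    (real^'n \<Rightarrow> real^'m::finite) \<Rightarrow> (real^'n \<Rightarrow> real^'n) \<Rightarrow> (real^'n \<Rightarrow> real) \<Rightarrow>
    ((real^'n) set \<Rightarrow> real) \<Rightarrow> ((real^'n) set \<Rightarrow> real) \<Rightarrow> real" where
  "E_limit \<epsilon> a h G \<Phi> \<rho> f1 f2 =
     (let p = f1 \<circ> level_comp G; q = f2 \<circ> level_comp G in
       \<epsilon> * (LINT x|wmeasure h. wgrad p x \<bullet> (a x *v wgrad q x)) +
       1/2 * (LINT x|wmeasure h. \<Phi> x \<bullet> (p x *\<^sub>R wgrad q x - q x *\<^sub>R wgrad p x)) +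
       1/2 * (LINT x|wmeasure h. 1 / h x * \<rho> x * p x * q x))"

text \<open>
  Convergence of a sequence in \<open>L\<^sup>2(\<mu>)\<close> to an element of \<open>L\<^sup>2(\<Gamma>)\<close>. Weak convergence is weak
  convergence in \<open>L\<^sup>2(\<mu>)\<close> to \<open>w \<circ> \<pi>\<close>: the test functions range over all of \<open>L\<^sup>2(\<mu>)\<close>, not only over
  those of the form \<open>\<psi> \<circ> \<pi>\<close>. With the latter, applying condition (1) below to constant
  sequences would force the conditional expectation given \<open>\<pi>\<close> to map \<open>H\<^sup>1(\<mu>)\<close> into itself. That
  fails, for example, for \<open>G(x) = (max (|x|\<^sup>2 - 1) 0)\<^sup>2\<close> on the plane, with \<open>h = 1\<close>, \<open>a = I\<close>, \<open>u = v = 0\<close>: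
  the unit disc is one point of \<open>\<Gamma>\<close>, and the conditional expectation of a radial bump jumps
  across the unit circle.
\<close>

definition strongly_converges :: "(real^'n::finite \<Rightarrow> real) \<Rightarrow> (real^'n \<Rightarrow> real^'m::finite) \<Rightarrow>
    (nat \<Rightarrow> real^'n \<Rightarrow> real) \<Rightarrow> ((real^'n) set \<Rightarrow> real) \<Rightarrow> bool" where
  "strongly_converges h G ws w \<longleftrightarrow>
     (\<lambda>n. L2_norm (wmeasure h) (\<lambda>x. ws n x - (w \<circ> level_comp G) x)) \<longlonglongrightarrow> 0"

definition weakly_converges :: "(real^'n::finite \<Rightarrow> real) \<Rightarrow> (real^'n \<Rightarrow> real^'m::finite) \<Rightarrow>
    (nat \<Rightarrow> real^'n \<Rightarrow> real) \<Rightarrow> ((real^'n) set \<Rightarrow> real) \<Rightarrow> bool" where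
  "weakly_converges h G us w \<longleftrightarrow>
     bdd_above (range (\<lambda>n. L2_norm (wmeasure h) (us n))) \<and>
     (\<forall>g\<in>L2 (wmeasure h). (\<lambda>n. L2_inner (wmeasure h) (us n) g)
        \<longlonglongrightarrow> L2_inner (wmeasure h) (w \<circ> level_comp G) g)"


text \<open>
  Mosco convergence of forms \<open>E n\<close> on \<open>H\<^sup>1(\<mu>)\<close> to a form \<open>Elim\<close> on \<open>H\<^sup>1(\<Gamma>)\<close>; \<open>Es n f\<close> is the
  value at \<open>f\<close> of the symmetric part of \<open>E n\<close> plus the squared \<open>L\<^sup>2(\<mu>)\<close> norm (infinite off
  \<open>H\<^sup>1(\<mu>)\<close>). The approximating \<open>w\<^sub>n\<close> are required to lie in \<open>H\<^sup>1(\<mu>)\<close>, the domain of \<open>E n\<close>.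
\<close>

definition mosco_1 where
  "mosco_1 h G Es \<longleftrightarrow>
     (\<forall>us. \<forall>u\<in>L2_Gamma h G.
        (\<forall>n::nat. us n \<in> L2 (wmeasure h)) \<and> weakly_converges h G us u \<and>
        (SUP n. Es n (us n) :: ereal) < \<infinity> \<longrightarrow> u \<in> H1_Gamma h G)"

definition mosco_2 where
  "mosco_2 h G E Elim \<longleftrightarrow>
     (\<forall>w\<in>H1_Gamma h G. \<forall>us. \<forall>u\<in>H1_Gamma h G.
        (\<forall>n::nat. us n \<in> H1 h) \<and> weakly_converges h G us u \<longrightarrow>
        (\<exists>ws. (\<forall>n. ws n \<in> H1 h) \<and> strongly_converges h G ws w \<and>
              (\<lambda>n. E n (us n) (ws n) :: real) \<longlonglongrightarrow> Elim u w))"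

definition mosco_2' where
  "mosco_2' h G Es E Elim \<longleftrightarrow>
     (\<forall>r. strict_mono r \<longrightarrow>
       (\<forall>us. \<forall>u\<in>H1_Gamma h G.
          (\<forall>k::nat. us k \<in> L2 (wmeasure h)) \<and> weakly_converges h G us u \<and>
          (SUP k. Es (r k :: nat) (us k) :: ereal) < \<infinity> \<longrightarrow>
          (\<forall>w\<in>H1_Gamma h G.
            \<exists>ws. (\<forall>k. ws k \<in> H1 h) \<and> strongly_converges h G ws w \<and>
              liminf (\<lambda>k. ereal (E (r k) (us k) (ws k))) \<le> ereal (Elim u w))))"

definition mosco_converges where
  "mosco_converges h G Es E Elim \<longleftrightarrow>
     mosco_1 h G Es \<and> (mosco_2 h G E Elim \<or> mosco_2' h G Es E Elim)"

end

theory Submission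
  imports Defs
begin

text \<open>
  Since \<open>DG v = 0\<close>, the flow of \<open>v\<close> preserves the components of the level sets of \<open>G\<close>. Hence a function
  \<open>p = w \<circ> \<pi>\<close> in \<open>H\<^sup>1(\<mu>)\<close> is invariant under this flow, so \<open>v \<cdot> \<nabla>p = 0\<close>, and as \<open>v h\<close> is divergence free,
  \<open>\<integral> v \<cdot> (f \<nabla>p - p \<nabla>f) d\<mu> = 0\<close> for all \<open>f\<close> in \<open>H\<^sup>1(\<mu>)\<close>: the singular term disappears from
  \<open>E\<^sub>\<alpha>(f, p)\<close>, and condition (2') holds with the constant sequence \<open>w\<^sub>k = p\<close> as soon as
  \<open>f \<mapsto> E\<^sub>\<alpha>(f, p)\<close> is continuous on \<open>H\<^sup>1(\<mu>)\<close>. The field \<open>\<Phi>\<close> need not be bounded; continuity comes from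
  the uniform boundedness principle, because the integrals defining the form converge on all of
  \<open>H\<^sup>1(\<mu>)\<close>. Subinvariance of \<open>\<mu>\<close> says that \<open>\<nabla>\<^sup>*(\<Phi> h) \<ge> 0\<close>, so together with ellipticity a bound on the
  symmetric forms is a bound in \<open>H\<^sup>1(\<mu>)\<close>, and Mazur's lemma turns weak convergence in \<open>L\<^sup>2(\<mu>)\<close> into
  strong convergence of convex combinations in \<open>H\<^sup>1(\<mu>)\<close>. This yields (1) and, with the
  continuity above, (2').
\<close>

section \<open>Smooth functions and bumps\<close>

text \<open>Condition (2) would allow \<open>us n\<close> with unbounded gradients, for which weak
  convergence in L2 need not control the form; the energy bound in (2') keeps them in a ball of H^1.
  The symmetric part does not contain \<alpha>, so one bound serves every subsequence.

  The obstacle is the identity v . grad p = 0. The function p is exactly constant along the flow,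
  but it need not be continuous and its gradient is only weak, so no chain rule applies. Test
  functions close to p in H^1 replace it, and their closeness has to survive composition with the
  flow. As v is merely Lipschitz, the flow need not be differentiable in the starting point, and a
  crude bound on the measure of preimages stands in for its Jacobian; a constant far from 1 is
  harmless because it only multiplies errors that tend to 0. Only the derivative at time 0 matters,
  so a time span \<tau> suffices on which the flow is close to the identity.

  The weight \<open>h\<close> is controlled from both sides on balls only, so the flow estimates use
  Lebesgue integrals over balls. Limits are produced by convex combinations and identified by
  pairing with test functions.\<close>

lemma partial_eqI: "(f has_derivative f') (at x) \<Longrightarrow> partial i f x = f' (axis i 1)"
  by (simp add: partial_def frechet_derivative_at[symmetric])

lemma has_derivative_grad:
  fixes f :: "real^'n::finite \<Rightarrow> real"
  assumes "f differentiable (at x)"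
  shows "(f has_derivative (\<lambda>z. grad f x \<bullet> z)) (at x)"
proof -
  obtain f' where f': "(f has_derivative f') (at x)"
    using assms by (auto simp: differentiable_def)
  then have lin: "linear f'"
    by (rule has_derivative_linear)
  have "f' z = grad f x \<bullet> z" for z
  proof -
    have "f' z = f' (\<Sum>i\<in>UNIV. z $ i *\<^sub>R axis i 1)"
      by (metis basis_expansion scalar_mult_eq_scaleR)
    also have "\<dots> = (\<Sum>i\<in>UNIV. z $ i * f' (axis i 1))"
      using lin by (simp add: linear_sum linear_cmul)
    also have "\<dots> = grad f x \<bullet> z"
      using f' by (simp add: grad_def inner_vec_def partial_eqI mult.commute)
    finally show ?thesis .
  qed
  then have "f' = (\<lambda>z. grad f x \<bullet> z)" by blast
  with f' show ?thesis by simp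
qed

lemma has_derivative_compose_grad:
  fixes f :: "real^'n::finite \<Rightarrow> real"
  assumes "(k has_derivative k') (at x within S)" "f differentiable (at (k x))"
  shows "((\<lambda>x. f (k x)) has_derivative (\<lambda>z. grad f (k x) \<bullet> k' z)) (at x within S)"
  using has_derivative_compose[where g = f, OF assms(1) has_derivative_grad[OF assms(2)]] .

lemma C_k_mono: "C_k (Suc k) f \<Longrightarrow> C_k k f"
proof (induction k arbitrary: f)
  case 0
  then show ?case
    by (auto simp: continuous_on_eq_continuous_within differentiable_imp_continuous_within)
next
  case (Suc k)
  then show ?case by (metis C_k.simps(2))
qed

lemma C_k_const [simp]: "C_k k (\<lambda>x::real^'n::finite. c)"
proof (induction k arbitrary: c)
  case (Suc k)
  have "partial i (\<lambda>x::real^'n. c) = (\<lambda>x. 0)" for i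
    by (rule ext) (simp add: partial_def)
  with Suc show ?case by simp
qed simp

lemma partial_add:
  fixes f g :: "real^'n::finite \<Rightarrow> real"
  assumes "f differentiable (at x)" "g differentiable (at x)"
  shows "partial i (\<lambda>x. f x + g x) x = partial i f x + partial i g x"
  by (rule partial_eqI[THEN trans])
     (rule has_derivative_add[OF has_derivative_grad has_derivative_grad],
       use assms in \<open>auto simp: grad_def inner_axis\<close>)

lemma partial_mult:
  fixes f g :: "real^'n::finite \<Rightarrow> real"
  assumes "f differentiable (at x)" "g differentiable (at x)"
  shows "partial i (\<lambda>x. f x * g x) x = f x * partial i g x + partial i f x * g x"
  by (rule partial_eqI[THEN trans])
     (rule has_derivative_mult[OF has_derivative_grad has_derivative_grad],
       use assms in \<open>auto simp: grad_def inner_axis\<close>)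

lemma C_k_add: "C_k k f \<Longrightarrow> C_k k g \<Longrightarrow> C_k k (\<lambda>x. f x + g x)"
proof (induction k arbitrary: f g)
  case (Suc k)
  then have "partial i (\<lambda>x. f x + g x) = (\<lambda>x. partial i f x + partial i g x)" for i
    by (intro ext partial_add) auto
  with Suc show ?case by auto
qed (auto intro: continuous_intros)

lemma C_k_mult: "C_k k f \<Longrightarrow> C_k k g \<Longrightarrow> C_k k (\<lambda>x. f x * g x)"
proof (induction k arbitrary: f g)
  case (Suc k)
  then have *: "partial i (\<lambda>x. f x * g x) = (\<lambda>x. f x * partial i g x + partial i f x * g x)" for i
    by (intro ext partial_mult) auto
  have "C_k k f" "C_k k g"
    using Suc.prems C_k_mono by blast+
  with Suc show ?case
    by (auto simp: * intro!: C_k_add)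
qed (auto intro: continuous_intros)

lemma has_derivative_affine:
  fixes f :: "real^'n::finite \<Rightarrow> real"
  assumes "f differentiable (at (s *\<^sub>R x + c))"
  shows "((\<lambda>x. f (s *\<^sub>R x + c)) has_derivative (\<lambda>z. grad f (s *\<^sub>R x + c) \<bullet> (s *\<^sub>R z))) (at x)"
  by (rule has_derivative_compose_grad) (use assms in \<open>auto intro!: derivative_eq_intros\<close>)

lemma partial_affine:
  fixes f :: "real^'n::finite \<Rightarrow> real"
  assumes "f differentiable (at (s *\<^sub>R x + c))"
  shows "partial i (\<lambda>x. f (s *\<^sub>R x + c)) x = s * partial i f (s *\<^sub>R x + c)"
  using partial_eqI[OF has_derivative_affine[OF assms]] by (simp add: grad_def inner_axis)

lemma C_k_affine:
  fixes f :: "real^'n::finite \<Rightarrow> real"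
  shows "C_k k f \<Longrightarrow> C_k k (\<lambda>x. f (s *\<^sub>R x + c))"
proof (induction k arbitrary: f)
  case 0
  then show ?case
    by (auto intro!: continuous_on_compose2[of UNIV f] continuous_intros)
next
  case (Suc k)
  then have *: "partial i (\<lambda>x. f (s *\<^sub>R x + c)) = (\<lambda>x. s * partial i f (s *\<^sub>R x + c))" for i
    by (intro ext partial_affine) auto
  have "(\<lambda>x. f (s *\<^sub>R x + c)) differentiable (at x)" for x
    unfolding differentiable_def using Suc.prems has_derivative_affine by fastforce
  moreover have "C_k k (\<lambda>x. s * partial i f (s *\<^sub>R x + c))" for i
    using Suc.prems by (intro C_k_mult C_k_const Suc.IH) simp
  ultimately show ?case
    unfolding C_k.simps * by blast
qed

definition smooth :: "(real^'n::finite \<Rightarrow> real) \<Rightarrow> bool" where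
  "smooth f \<longleftrightarrow> (\<forall>k. C_k k f)"

lemma smooth_const [simp]: "smooth (\<lambda>x::real^'n::finite. c)"
  and smooth_add: "smooth (f :: real^'n \<Rightarrow> real) \<Longrightarrow> smooth g \<Longrightarrow> smooth (\<lambda>x. f x + g x)"
  and smooth_mult: "smooth (f :: real^'n \<Rightarrow> real) \<Longrightarrow> smooth g \<Longrightarrow> smooth (\<lambda>x. f x * g x)"
  and smooth_affine: "smooth g \<Longrightarrow> smooth (\<lambda>x::real^'n. g (s *\<^sub>R x + y))"
  by (auto simp: smooth_def C_k_add C_k_mult C_k_affine)

lemma smooth_diff: "smooth f \<Longrightarrow> smooth g \<Longrightarrow> smooth (\<lambda>x. f x - g x)"
  using smooth_add[OF _ smooth_mult[OF smooth_const[of "-1"]], of f g] by simp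

lemma smooth_prod:
  "finite I \<Longrightarrow> (\<And>i. i \<in> I \<Longrightarrow> smooth (f i)) \<Longrightarrow> smooth (\<lambda>x. \<Prod>i\<in>I. f i x)"
  by (induction I rule: finite_induct) (auto intro: smooth_mult)

lemma smooth_power: "smooth f \<Longrightarrow> smooth (\<lambda>x. f x ^ k)"
  by (induction k) (auto intro: smooth_mult)

lemma smooth_partial: "smooth f \<Longrightarrow> smooth (partial i f)"
  by (metis C_k.simps(2) smooth_def)

lemma smooth_differentiable: "smooth f \<Longrightarrow> f differentiable (at x)"
  by (metis C_k.simps(2) smooth_def)

lemma smooth_continuous: "smooth f \<Longrightarrow> continuous_on S f"
  by (metis C_k.simps(1) smooth_def continuous_on_subset subset_UNIV)


section \<open>Test functions: closure properties and uniform bounds\<close>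

lemma test_functions_iff:
  "\<phi> \<in> test_functions \<longleftrightarrow> smooth \<phi> \<and> compact (closure {x. \<phi> x \<noteq> 0})"
  by (simp add: test_functions_def smooth_def)

lemma test_functionsI:
  assumes "smooth \<phi>" "compact K" "\<And>x. x \<notin> K \<Longrightarrow> \<phi> x = 0"
  shows "\<phi> \<in> test_functions"
proof -
  have "closure {x. \<phi> x \<noteq> 0} \<subseteq> K"
    using assms by (intro closure_minimal) (auto intro: compact_imp_closed)
  then show ?thesis
    using assms(1,2) bounded_subset by (auto simp: test_functions_iff compact_eq_bounded_closed)
qed

lemma test_functionsE:
  assumes "\<phi> \<in> test_functions"
  obtains r where "smooth \<phi>" "r > 0" "\<And>x. norm x > r \<Longrightarrow> \<phi> x = 0" "\<And>x i. norm x > r \<Longrightarrow> partial i \<phi> x = 0"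
proof -
  have "bounded (closure {x. \<phi> x \<noteq> 0})"
    using assms by (auto simp: test_functions_iff compact_imp_bounded)
  then obtain r where r: "r > 0" "\<And>x. x \<in> closure {x. \<phi> x \<noteq> 0} \<Longrightarrow> norm x \<le> r"
    by (auto simp: bounded_pos)
  have 1: "\<phi> x = 0" if "norm x > r" for x
    using r(2)[of x] that closure_subset[of "{x. \<phi> x \<noteq> 0}"] by fastforce
  have 2: "partial i \<phi> x = 0" if "norm x > r" for x i
  proof -
    have "open {x::real^'n. norm x > r}"
      by (intro open_Collect_less continuous_intros)
    then have "(\<phi> has_derivative (\<lambda>_. 0)) (at x)"
      using that by (intro has_derivative_transform_within_open[of "\<lambda>_. 0" "\<lambda>_. 0" x UNIV "{x. norm x > r}" \<phi>])
        (auto simp: 1)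
    from partial_eqI[OF this] show ?thesis by simp
  qed
  show thesis
  proof (rule that)
    show "smooth \<phi>" using assms by (simp add: test_functions_iff)
  qed (fact r(1) 1 2)+
qed

lemma test_partial: "\<phi> \<in> test_functions \<Longrightarrow> partial i \<phi> \<in> test_functions"
proof (erule test_functionsE)
  fix r assume "smooth \<phi>" "\<And>x i. norm x > r \<Longrightarrow> partial i \<phi> x = 0"
  then show ?thesis
    by (intro test_functionsI[of _ "cball 0 r"] smooth_partial) auto
qed

lemma test_smooth_mult: "\<phi> \<in> test_functions \<Longrightarrow> smooth f \<Longrightarrow> (\<lambda>x. \<phi> x * f x) \<in> test_functions"
proof (erule test_functionsE)
  fix r assume "smooth f" "smooth \<phi>" "\<And>x. norm x > r \<Longrightarrow> \<phi> x = 0"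
  then show ?thesis
    by (intro test_functionsI[of _ "cball 0 r"] smooth_mult) auto
qed

lemma test_add:
  assumes "\<phi> \<in> test_functions" "\<psi> \<in> test_functions"
  shows "(\<lambda>x. \<phi> x + \<psi> x) \<in> test_functions"
proof -
  obtain r where r: "smooth \<phi>" "\<And>x. norm x > r \<Longrightarrow> \<phi> x = 0"
    using assms(1) by (rule test_functionsE) blast
  obtain s where s: "smooth \<psi>" "\<And>x. norm x > s \<Longrightarrow> \<psi> x = 0"
    using assms(2) by (rule test_functionsE) blast
  show ?thesis
    by (rule test_functionsI[of _ "cball 0 (max r s)"]) (use r s in \<open>auto intro: smooth_add\<close>)
qed

lemma test_affine:
  assumes "\<phi> \<in> test_functions" "s \<noteq> 0"
  shows "(\<lambda>x. \<phi> (s *\<^sub>R x + c)) \<in> test_functions"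
  using assms(1)
proof (rule test_functionsE)
  fix r assume r: "smooth \<phi>" "\<And>x. norm x > r \<Longrightarrow> \<phi> x = 0"
  have *: "\<phi> (s *\<^sub>R x + c) = 0" if "norm x > (r + norm c) / \<bar>s\<bar>" for x
  proof (rule r)
    have "r + norm c < norm (s *\<^sub>R x)"
      using that assms(2) by (simp add: field_simps)
    also have "\<dots> \<le> norm (s *\<^sub>R x + c) + norm c"
      by (metis add_diff_cancel_right' norm_triangle_ineq4)
    finally show "r < norm (s *\<^sub>R x + c)" by simp
  qed
  show ?thesis
    by (rule test_functionsI[of _ "cball 0 ((r + norm c) / \<bar>s\<bar>)"])
       (use * r in \<open>auto intro: smooth_affine\<close>)
qed

lemma test_bounded:
  assumes "\<phi> \<in> test_functions"
  obtains B where "B > 0" "\<And>x. \<bar>\<phi> x\<bar> \<le> B"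
proof -
  obtain r where r: "smooth \<phi>" "r > 0" "\<And>x. norm x > r \<Longrightarrow> \<phi> x = 0"
    using assms by (rule test_functionsE) blast
  have "bounded (\<phi> ` cball 0 r)"
    by (intro compact_imp_bounded compact_continuous_image smooth_continuous r) simp
  then obtain B where B: "B > 0" "\<And>x. x \<in> cball 0 r \<Longrightarrow> \<bar>\<phi> x\<bar> \<le> B"
    by (auto simp: bounded_pos)
  have "\<bar>\<phi> x\<bar> \<le> B" for x
    using B r(3)[of x] by (cases "norm x \<le> r") auto
  with B(1) that show thesis by blast
qed

lemma test_grad_bounded:
  assumes "\<phi> \<in> test_functions"
  obtains B where "B > 0" "\<And>x. norm (grad \<phi> x) \<le> B"
proof -
  have "\<forall>i. \<exists>B. \<forall>x. \<bar>partial i \<phi> x\<bar> \<le> B"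
    by (meson test_bounded[OF test_partial[OF assms]])
  then obtain B where B: "\<And>i x. \<bar>partial i \<phi> x\<bar> \<le> B i"
    by metis
  have *: "norm (grad \<phi> x) \<le> (\<Sum>i\<in>UNIV. B i)" for x
  proof -
    have "norm (grad \<phi> x) \<le> (\<Sum>i\<in>UNIV. \<bar>grad \<phi> x $ i\<bar>)"
      by (rule norm_le_l1_cart)
    also have "\<dots> \<le> (\<Sum>i\<in>UNIV. B i)"
      by (intro sum_mono) (simp add: grad_def B)
    finally show ?thesis .
  qed
  show thesis
    by (rule that[of "max 1 (\<Sum>i\<in>UNIV. B i)"]) (use * in \<open>auto intro: le_max_iff_disj[THEN iffD2]\<close>)
qed

lemma test_measurable [measurable]: "\<phi> \<in> test_functions \<Longrightarrow> \<phi> \<in> borel_measurable borel"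
  by (auto simp: test_functions_iff intro!: borel_measurable_continuous_onI smooth_continuous)

lemma test_partial_measurable [measurable]:
  "\<phi> \<in> test_functions \<Longrightarrow> partial i \<phi> \<in> borel_measurable borel"
  by (intro test_measurable test_partial)

lemma continuous_on_grad: "smooth f \<Longrightarrow> continuous_on S (grad f)"
  unfolding grad_def by (intro continuous_on_vec_lambda smooth_continuous smooth_partial)

lemma test_grad_measurable [measurable]:
  "\<phi> \<in> test_functions \<Longrightarrow> grad \<phi> \<in> borel_measurable borel"
  by (auto simp: test_functions_iff intro!: borel_measurable_continuous_onI continuous_on_grad)

text \<open>The margin 1 separates two cases: points closer than 1 either both lie in the compact
  ball of radius \<open>r + 1\<close>, where uniform continuity is available, or both lie outside
  the support.\<close>

lemma compact_support_uniformly_continuous: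
  fixes f :: "'a::{heine_borel, real_normed_vector} \<Rightarrow> 'b::real_normed_vector"
  assumes "continuous_on UNIV f" "\<And>x. norm x > r \<Longrightarrow> f x = 0" "e > 0"
  obtains d where "d > 0" "\<And>x y. dist x y < d \<Longrightarrow> dist (f x) (f y) < e"
proof -
  have "uniformly_continuous_on (cball 0 (r + 1)) f"
    by (intro compact_uniformly_continuous) (auto intro: continuous_on_subset[OF assms(1)])
  then obtain d where d: "d > 0"
    "\<And>x y. norm x \<le> r + 1 \<Longrightarrow> norm y \<le> r + 1 \<Longrightarrow> dist x y < d \<Longrightarrow> dist (f x) (f y) < e"
    using assms(3) unfolding uniformly_continuous_on_def by (metis dist_commute mem_cball_0)
  have "dist (f x) (f y) < e" if xy: "dist x y < min d 1" for x y
  proof (cases "norm x \<le> r + 1 \<and> norm y \<le> r + 1")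
    case True
    then show ?thesis using d xy by auto
  next
    case False
    have "norm x \<le> norm y + dist x y" "norm y \<le> norm x + dist x y"
      by (metis add.commute dist_norm norm_minus_commute norm_triangle_sub)+
    with False xy have "norm x > r" "norm y > r"
      by auto
    then show ?thesis using assms(2,3) by simp
  qed
  with d(1) show thesis by (intro that[of "min d 1"]) auto
qed

text \<open>Compact support makes the gradient uniformly continuous, so the remainder is small
  uniformly in the base point. This uniformity permits differentiation under the integral of a
  convolution and expansion along all flow curves at once.\<close>

lemma test_uniformly_differentiable:
  assumes "\<phi> \<in> test_functions" "e > 0"
  obtains d where "d > 0"
    "\<And>x z. norm z < d \<Longrightarrow> \<bar>\<phi> (x + z) - \<phi> x - grad \<phi> x \<bullet> z\<bar> \<le> e * norm z"
proof -
  obtain r where r: "smooth \<phi>" "\<And>x i. norm x > r \<Longrightarrow> partial i \<phi> x = 0"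
    using assms(1) by (rule test_functionsE) blast
  have "grad \<phi> x = 0" if "norm x > r" for x
    using r(2)[OF that] by (simp add: grad_def vec_eq_iff)
  then obtain d where d: "d > 0" "\<And>x y. dist x y < d \<Longrightarrow> dist (grad \<phi> x) (grad \<phi> y) < e"
    using compact_support_uniformly_continuous[OF continuous_on_grad[OF r(1)] _ assms(2)] by blast
  have "\<bar>\<phi> (x + z) - \<phi> x - grad \<phi> x \<bullet> z\<bar> \<le> e * norm z" if z: "norm z < d" for x z
  proof -
    \<comment> \<open>The mean value inequality is applied along the segment to the function minus
      its linear part at \<open>x\<close>, so that the derivative to be bounded is a difference of
      two gradients.\<close>
    have "norm ((\<lambda>t. \<phi> (x + t *\<^sub>R z) - t * (grad \<phi> x \<bullet> z)) 1 -
        (\<lambda>t. \<phi> (x + t *\<^sub>R z) - t * (grad \<phi> x \<bullet> z)) 0) \<le> e * norm z * norm (1 - 0 :: real)"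
    proof (rule differentiable_bound[of "{0..1}" _ "\<lambda>t s. grad \<phi> (x + t *\<^sub>R z) \<bullet> (s *\<^sub>R z) - s * (grad \<phi> x \<bullet> z)"])
      fix t :: real assume t: "t \<in> {0..1}"
      show "((\<lambda>t. \<phi> (x + t *\<^sub>R z) - t * (grad \<phi> x \<bullet> z)) has_derivative
          (\<lambda>s. grad \<phi> (x + t *\<^sub>R z) \<bullet> (s *\<^sub>R z) - s * (grad \<phi> x \<bullet> z))) (at t within {0..1})"
        by (intro has_derivative_diff has_derivative_compose_grad smooth_differentiable r(1))
           (auto intro!: derivative_eq_intros)
      have "\<bar>grad \<phi> (x + t *\<^sub>R z) \<bullet> (s *\<^sub>R z) - s * (grad \<phi> x \<bullet> z)\<bar> \<le> e * norm z * norm s" for s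
      proof -
        have "norm (t *\<^sub>R z) < d"
          using t z by (auto intro: le_less_trans[OF mult_left_le_one_le])
        then have "norm (grad \<phi> (x + t *\<^sub>R z) - grad \<phi> x) \<le> e"
          using d(2)[of "x + t *\<^sub>R z" x] by (simp add: dist_norm)
        then have "\<bar>(grad \<phi> (x + t *\<^sub>R z) - grad \<phi> x) \<bullet> (s *\<^sub>R z)\<bar> \<le> e * norm (s *\<^sub>R z)"
          using Cauchy_Schwarz_ineq2[of "grad \<phi> (x + t *\<^sub>R z) - grad \<phi> x" "s *\<^sub>R z"]
          by (meson mult_right_mono norm_ge_zero order_trans)
        then show ?thesis
          by (simp add: inner_diff_left right_diff_distrib mult_ac)
      qed
      then show "onorm (\<lambda>s. grad \<phi> (x + t *\<^sub>R z) \<bullet> (s *\<^sub>R z) - s * (grad \<phi> x \<bullet> z)) \<le> e * norm z"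
        by (intro onorm_bound) (use assms(2) in auto)
    qed auto
    then show ?thesis by simp
  qed
  with d(1) that show thesis by blast
qed

section \<open>Explicit bump functions built from exp(-1/t)\<close>

definition flat :: "nat \<Rightarrow> real \<Rightarrow> real" where
  "flat m t = (if t \<le> 0 then 0 else exp (- (1 / t)) / t ^ m)"

lemma flat_tendsto_0: "(flat m \<longlongrightarrow> 0) (at 0)"
proof -
  have "((\<lambda>t::real. inverse t ^ m / exp (inverse t)) \<longlongrightarrow> 0) (at_right 0)"
    using tendsto_power_div_exp_0 filterlim_inverse_at_top_right by (rule filterlim_compose)
  moreover have "\<forall>\<^sub>F t in at_right 0. inverse t ^ m / exp (inverse t) = flat m t"
    by (auto simp: eventually_at_right_field flat_def exp_minus field_simps intro!: exI[of _ 1])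
  ultimately have r: "(flat m \<longlongrightarrow> 0) (at_right 0)"
    by (rule Lim_transform_eventually)
  have "\<forall>\<^sub>F t in at_left 0. 0 = flat m t"
    by (auto simp: eventually_at_left_field flat_def intro!: exI[of _ "-1"])
  then have "(flat m \<longlongrightarrow> 0) (at_left 0)"
    by (rule Lim_transform_eventually[OF tendsto_const])
  with r show ?thesis
    by (simp add: filterlim_at_split)
qed

text \<open>Up to linear combinations the family \<open>flat m\<close> is closed under
  differentiation, which is the reason for carrying the power of t: smoothness then follows by one
  induction over all \<open>m\<close> simultaneously.\<close>

lemma flat_has_derivative:
  "(flat m has_real_derivative (flat (m + 2) t - real m * flat (m + 1) t)) (at t)"
proof -
  consider "t < 0" | "t = 0" | "t > 0" by linarith
  then show ?thesis
  proof cases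
    case 1
    have "(flat m has_real_derivative 0) (at t)"
      by (rule has_field_derivative_transform_within_open[of "\<lambda>_. 0" _ _ "{..<0}"])
         (use 1 in \<open>auto simp: flat_def\<close>)
    with 1 show ?thesis by (simp add: flat_def)
  next
    case 2
    \<comment> \<open>The difference quotient of \<open>flat m\<close> at 0 is
      \<open>flat (Suc m)\<close>, so its limit is an instance of
      \<open>flat_tendsto_0\<close>.\<close>
    have "((\<lambda>y. flat m y / y) \<longlongrightarrow> 0) (at 0)"
      by (rule Lim_transform_eventually[OF flat_tendsto_0[of "Suc m"]])
         (auto simp: flat_def eventually_at_topological)
    then show ?thesis
      using 2 by (simp add: has_field_derivative_iff flat_def)
  next
    case 3
    have "((\<lambda>t. exp (- (1 / t)) / t ^ m) has_real_derivative
        (exp (- (1 / t)) * (1 / t\<^sup>2) * t ^ m - exp (- (1 / t)) * (real m * t ^ (m - 1))) / (t ^ m * t ^ m)) (at t)"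
      using 3 DERIV_pow[of m t] by (intro DERIV_divide) (auto intro!: derivative_eq_intros simp: power2_eq_square)
    also have "(exp (- (1 / t)) * (1 / t\<^sup>2) * t ^ m - exp (- (1 / t)) * (real m * t ^ (m - 1))) / (t ^ m * t ^ m) =
        flat (m + 2) t - real m * flat (m + 1) t"
      using 3 by (cases m) (simp_all add: flat_def field_simps power2_eq_square)
    finally have "((\<lambda>t. exp (- (1 / t)) / t ^ m) has_real_derivative (flat (m + 2) t - real m * flat (m + 1) t)) (at t)" .
    then show ?thesis
      by (rule has_field_derivative_transform_within_open[of _ _ _ "{0<..}"])
         (use 3 in \<open>auto simp: flat_def\<close>)
  qed
qed

lemma smooth_flat: "smooth (\<lambda>x::real^'n::finite. flat m (s * x $ j + c))"
proof -
  have "C_k k (\<lambda>x::real^'n. flat m (s * x $ j + c))" for k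
  proof (induction k arbitrary: m)
    case 0
    have "continuous_on UNIV (flat m)"
      using DERIV_isCont[OF flat_has_derivative] by (simp add: continuous_on_eq_continuous_at)
    then show ?case
      by (auto intro!: continuous_on_compose2[of UNIV "flat m"] continuous_intros)
  next
    case (Suc k)
    have d: "((\<lambda>x::real^'n. flat m (s * x $ j + c)) has_derivative
        (\<lambda>z. (flat (m + 2) (s * x $ j + c) - real m * flat (m + 1) (s * x $ j + c)) * (s * z $ j))) (at x)" for x
      by (rule has_derivative_compose[where g = "flat m", OF _ flat_has_derivative[unfolded has_field_derivative_def]])
         (auto intro!: derivative_eq_intros bounded_linear_imp_has_derivative bounded_linear_vec_nth)
    have *: "partial i (\<lambda>x::real^'n. flat m (s * x $ j + c)) = (\<lambda>x. (s * axis i 1 $ j) *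
        (flat (m + 2) (s * x $ j + c) + (- real m) * flat (m + 1) (s * x $ j + c)))" for i
      by (rule ext) (simp add: partial_eqI[OF d])
    have "C_k k (partial i (\<lambda>x::real^'n. flat m (s * x $ j + c)))" for i
      unfolding * by (intro C_k_mult C_k_add C_k_const Suc.IH)
    then show ?case
      using d by (auto simp: differentiable_def)
  qed
  then show ?thesis by (simp add: smooth_def)
qed

text \<open>A product of one-dimensional cut-offs, so that the set of positivity is a box; open sets
  are assembled from boxes below.\<close>

definition bump :: "real^'n::finite \<Rightarrow> real^'n \<Rightarrow> real^'n \<Rightarrow> real" where
  "bump a b x = (\<Prod>j\<in>UNIV. flat 0 (x $ j - a $ j) * flat 0 (b $ j - x $ j))"

lemma bump_pos_iff: "bump a b x > 0 \<longleftrightarrow> x \<in> box a b"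
  and bump_nonneg: "bump a b x \<ge> 0"
  and bump_le_1: "bump a b x \<le> 1"
proof -
  have f: "flat 0 t \<ge> 0" "flat 0 t \<le> 1" "flat 0 t = 0 \<longleftrightarrow> \<not> t > 0" for t
    by (auto simp: flat_def)
  show nn: "bump a b x \<ge> 0"
    unfolding bump_def by (intro prod_nonneg ballI mult_nonneg_nonneg f)
  show "bump a b x \<le> 1"
    unfolding bump_def by (intro prod_le_1) (auto intro!: mult_nonneg_nonneg mult_le_one f)
  have "bump a b x > 0 \<longleftrightarrow> bump a b x \<noteq> 0"
    using nn by linarith
  also have "\<dots> \<longleftrightarrow> x \<in> box a b"
    unfolding bump_def by (simp add: f(3) mem_box_cart)
  finally show "bump a b x > 0 \<longleftrightarrow> x \<in> box a b" .
qed

lemma bump_test: "bump a b \<in> test_functions"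
proof (rule test_functionsI[of _ "cbox a b"])
  have "smooth (\<lambda>x. flat 0 (x $ j - a $ j))" "smooth (\<lambda>x. flat 0 (b $ j - x $ j))" for j
    using smooth_flat[of 0 1 j "- a $ j"] smooth_flat[of 0 "-1" j "b $ j"]
    by (simp_all add: algebra_simps)
  then show "smooth (bump a b)"
    unfolding bump_def by (intro smooth_prod smooth_mult) auto
  show "bump a b x = 0" if "x \<notin> cbox a b" for x
    using that bump_pos_iff[of a b x] bump_nonneg[of a b x] box_subset_cbox[of a b] by force
qed auto

section \<open>The fundamental lemma of the calculus of variations\<close>

lemma locally_integrable_scaleR:
  fixes f :: "real^'n::finite \<Rightarrow> 'b::{banach, second_countable_topology}"
  assumes f: "locally_integrable f" and [measurable]: "g \<in> borel_measurable borel"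
    and bd: "\<And>x. \<bar>g x\<bar> \<le> B" and sp: "\<And>x. norm x > r \<Longrightarrow> g x = 0"
  shows "integrable lborel (\<lambda>x. g x *\<^sub>R f x)"
proof -
  have i: "integrable lborel (\<lambda>x. indicator (cball 0 r) x *\<^sub>R f x)"
    using f by (auto simp: locally_integrable_def set_integrable_def)
  have eq: "g x *\<^sub>R f x = g x *\<^sub>R (indicator (cball 0 r) x *\<^sub>R f x)" for x
    using sp by (cases "norm x > r") (auto simp: indicator_def)
  have "integrable lborel (\<lambda>x. g x *\<^sub>R (indicator (cball 0 r) x *\<^sub>R f x))"
  proof (rule Bochner_Integration.integrable_bound)
    show "integrable lborel (\<lambda>x. B *\<^sub>R (indicator (cball 0 r) x *\<^sub>R f x))"
      using i by (rule integrable_scaleR_right)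
    show "(\<lambda>x. g x *\<^sub>R (indicator (cball 0 r) x *\<^sub>R f x)) \<in> borel_measurable lborel"
      using i by measurable
    have "\<bar>g x\<bar> \<le> \<bar>B\<bar>" for x
      using bd[of x] by linarith
    then show "AE x in lborel. norm (g x *\<^sub>R (indicator (cball 0 r) x *\<^sub>R f x)) \<le>
        norm (B *\<^sub>R (indicator (cball 0 r) x *\<^sub>R f x))"
      by (intro AE_I2) (simp add: abs_mult mult_right_mono)
  qed
  then show ?thesis unfolding eq[symmetric] .
qed

text \<open>Set integrability speaks about truncations only; those to growing balls are measurable
  and converge pointwise.\<close>

lemma locally_integrable_measurable:
  fixes f :: "real^'n::finite \<Rightarrow> 'b::{banach, second_countable_topology}"
  assumes "locally_integrable f"
  shows "f \<in> borel_measurable borel"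
proof (rule borel_measurable_LIMSEQ_metric)
  have "set_integrable lborel (cball 0 (real k)) f" for k
    using assms by (auto simp: locally_integrable_def)
  then show "(\<lambda>x. indicator (cball 0 (real k)) x *\<^sub>R f x) \<in> borel_measurable borel" for k
    by (auto simp: set_integrable_def dest!: borel_measurable_integrable)
  show "(\<lambda>k. indicator (cball 0 (real k)) x *\<^sub>R f x) \<longlonglongrightarrow> f x" for x
  proof (rule tendsto_eventually)
    have "\<forall>\<^sub>F k in sequentially. norm x \<le> real k"
      using eventually_ge_at_top[of "nat \<lceil>norm x\<rceil>"] by eventually_elim linarith
    then show "\<forall>\<^sub>F k in sequentially. indicator (cball 0 (real k)) x *\<^sub>R f x = f x"
      by eventually_elim simp
  qed
qed

lemma locally_integrable_mult_test:
  fixes f :: "real^'n::finite \<Rightarrow> real"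
  assumes "locally_integrable f" "\<phi> \<in> test_functions"
  shows "integrable lborel (\<lambda>x. f x * \<phi> x)"
proof -
  obtain r where r: "\<And>x. norm x > r \<Longrightarrow> \<phi> x = 0"
    using assms(2) by (rule test_functionsE) blast
  obtain B where B: "\<And>x. \<bar>\<phi> x\<bar> \<le> B"
    using assms(2) by (rule test_bounded) blast
  show ?thesis
    using locally_integrable_scaleR[OF assms(1) test_measurable[OF assms(2)] B r]
    by (simp add: mult.commute)
qed

lemma locally_integrable_inner_grad:
  fixes F :: "real^'n::finite \<Rightarrow> real^'n"
  assumes "locally_integrable F" "\<phi> \<in> test_functions"
  shows "integrable lborel (\<lambda>x. F x \<bullet> grad \<phi> x)"
proof -
  obtain r where r: "\<And>x i. norm x > r \<Longrightarrow> partial i \<phi> x = 0"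
    using assms(2) by (rule test_functionsE) blast
  have "integrable lborel (\<lambda>x. partial i \<phi> x *\<^sub>R F x)" for i
  proof -
    obtain B where B: "\<And>x. \<bar>partial i \<phi> x\<bar> \<le> B"
      using test_partial[OF assms(2)] by (rule test_bounded) blast
    show ?thesis
      by (rule locally_integrable_scaleR[OF assms(1) test_partial_measurable[OF assms(2)] B r])
  qed
  then have "integrable lborel (\<lambda>x. \<Sum>i\<in>UNIV. (partial i \<phi> x *\<^sub>R F x) \<bullet> axis i 1)"
    by (intro Bochner_Integration.integrable_sum integrable_inner_left)
  moreover have "F x \<bullet> grad \<phi> x = (\<Sum>i\<in>UNIV. (partial i \<phi> x *\<^sub>R F x) \<bullet> axis i 1)" for x
    unfolding inner_axis by (simp add: inner_vec_def grad_def mult.commute)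
  ultimately show ?thesis by simp
qed

lemma locally_integrable_continuous:
  fixes f :: "real^'n::finite \<Rightarrow> 'b::euclidean_space"
  assumes "continuous_on UNIV f"
  shows "locally_integrable f"
  unfolding locally_integrable_def set_integrable_def
  using borel_integrable_compact[of _ f] continuous_on_subset[OF assms] by blast

lemma locally_integrable_vec_nth:
  fixes F :: "real^'n::finite \<Rightarrow> real^'m::finite"
  assumes "locally_integrable F"
  shows "locally_integrable (\<lambda>x. F x $ i)"
  unfolding locally_integrable_def set_integrable_def
proof (intro allI impI)
  fix K :: "(real^'n) set" assume "compact K"
  then have "integrable lborel (\<lambda>x. (indicator K x *\<^sub>R F x) \<bullet> axis i 1)"
    using assms by (intro integrable_inner_left) (auto simp: locally_integrable_def set_integrable_def)
  then show "integrable lborel (\<lambda>x. indicator K x *\<^sub>R F x $ i)"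
    by (simp add: inner_axis)
qed

lemma locally_integrable_add:
  "locally_integrable f \<Longrightarrow> locally_integrable g \<Longrightarrow> locally_integrable (\<lambda>x. f x + g x)"
  by (simp add: locally_integrable_def set_integral_add)

lemma locally_integrable_scaleR_right:
  "locally_integrable f \<Longrightarrow> locally_integrable (\<lambda>x. c *\<^sub>R f x)"
  unfolding locally_integrable_def set_integrable_def
  using integrable_scaleR_right[of c lborel "\<lambda>x. indicator K x *\<^sub>R f x" for K]
  by (simp add: mult.commute)


text \<open>The countably many rational boxes are listed by natural numbers, so that finite initial
  unions increase to \<open>U\<close>.\<close>

lemma open_eq_UNION_boxes:
  fixes U :: "'a::euclidean_space set"
  assumes "open U"
  obtains A B :: "nat \<Rightarrow> 'a" where "U = (\<Union>n. box (A n) (B n))"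
proof (cases "U = {}")
  case True
  then show thesis by (intro that[of "\<lambda>_. 0" "\<lambda>_. 0"]) simp
next
  case False
  let ?a = "\<lambda>f :: 'a \<Rightarrow> real \<times> real. (\<Sum>(i::'a)\<in>Basis. fst (f i) *\<^sub>R i)"
  let ?b = "\<lambda>f :: 'a \<Rightarrow> real \<times> real. (\<Sum>(i::'a)\<in>Basis. snd (f i) *\<^sub>R i)"
  define I where "I = {f\<in>Basis \<rightarrow>\<^sub>E \<rat> \<times> \<rat>. box (?a f) (?b f) \<subseteq> U}"
  have U: "U = (\<Union>f\<in>I. box (?a f) (?b f))"
    using open_UNION_box[OF assms] by (simp add: I_def)
  have "countable I"
    unfolding I_def by (rule countable_subset[of _ "Basis \<rightarrow>\<^sub>E \<rat> \<times> \<rat>"])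
       (auto intro!: countable_PiE countable_SIGMA countable_rat)
  moreover have "I \<noteq> {}"
    using U False by auto
  ultimately have r: "range (from_nat_into I) = I"
    by (rule range_from_nat_into[rotated])
  have "U = (\<Union>f\<in>range (from_nat_into I). box (?a f) (?b f))"
    unfolding r by (rule U)
  then have "U = (\<Union>n. box (?a (from_nat_into I n)) (?b (from_nat_into I n)))"
    by (simp only: image_image)
  then show thesis by (rule that)
qed

text \<open>Dominated convergence: the common support ball supplies the integrable majorant, as
  \<open>\<rho>\<close> is only locally integrable. Every passage from one class of sets to the next
  goes through this lemma.\<close>

lemma integral_mult_limit_nonneg:
  fixes \<rho> :: "real^'n::finite \<Rightarrow> real"
  assumes \<rho>: "locally_integrable \<rho>"
    and [measurable]: "\<And>k. f k \<in> borel_measurable borel" "g \<in> borel_measurable borel"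
    and bd: "\<And>k x. \<bar>f k x\<bar> \<le> 1" and sp: "\<And>k x. norm x > r \<Longrightarrow> f k x = 0"
    and lim: "AE x in lborel. (\<lambda>k. f k x) \<longlonglongrightarrow> g x"
    and nn: "\<And>k::nat. (LINT x|lborel. \<rho> x * f k x) \<ge> 0"
  shows "(LINT x|lborel. \<rho> x * g x) \<ge> 0"
proof -
  note [measurable] = locally_integrable_measurable[OF \<rho>]
  have "(\<lambda>k. LINT x|lborel. \<rho> x * f k x) \<longlonglongrightarrow> (LINT x|lborel. \<rho> x * g x)"
  proof (rule integral_dominated_convergence)
    show "integrable lborel (\<lambda>x. \<bar>indicator (cball 0 r) x *\<^sub>R \<rho> x\<bar>)"
      using \<rho> by (auto simp: locally_integrable_def set_integrable_def)
    show "AE x in lborel. (\<lambda>k. \<rho> x * f k x) \<longlonglongrightarrow> \<rho> x * g x"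
      using lim by eventually_elim (intro tendsto_intros)
    show "AE x in lborel. norm (\<rho> x * f k x) \<le> \<bar>indicator (cball 0 r) x *\<^sub>R \<rho> x\<bar>" for k
      using bd[of k] sp[of _ k] by (intro AE_I2) (auto simp: indicator_def abs_mult mult_left_le)
  qed measurable
  then show ?thesis
    by (rule LIMSEQ_le_const) (use nn in auto)
qed

text \<open>Bundles what \<open>integral_mult_limit_nonneg\<close> asks of approximating test
  functions, in a form that survives finite unions.\<close>

definition test_limit :: "real \<Rightarrow> (real^'n::finite) set \<Rightarrow> bool" where
  "test_limit r A \<longleftrightarrow> (\<exists>\<phi>. (\<forall>k::nat. \<phi> k \<in> test_functions) \<and>
     (\<forall>k x. 0 \<le> \<phi> k x \<and> \<phi> k x \<le> 1 \<and> (norm x > r \<longrightarrow> \<phi> k x = 0)) \<and>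
     (\<forall>x. (\<lambda>k. \<phi> k x) \<longlonglongrightarrow> indicator A x))"

text \<open>Where the bump is positive the powers of 1 minus the bump tend to 0, elsewhere they all
  equal 1; the complement of these powers keeps the compact support.\<close>

lemma test_limit_box:
  assumes "box a b \<subseteq> cball 0 r"
  shows "test_limit r (box a b :: (real^'n::finite) set)"
  unfolding test_limit_def
proof (intro exI[of _ "\<lambda>k x. 1 - (1 - bump a b x) ^ k"] conjI allI impI)
  fix k :: nat and x :: "real^'n"
  have b: "0 \<le> 1 - bump a b x" "1 - bump a b x \<le> 1"
    using bump_nonneg[of a b x] bump_le_1[of a b x] by auto
  have z: "bump a b x = 0" if "norm x > r" for x
    using that bump_pos_iff[of a b x] bump_nonneg[of a b x] assms by force
  show "(\<lambda>x. 1 - (1 - bump a b x) ^ k) \<in> test_functions"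
    using bump_test[of a b] z
    by (intro test_functionsI[of _ "cball 0 r"] smooth_diff smooth_power) (auto simp: test_functions_iff)
  show "0 \<le> 1 - (1 - bump a b x) ^ k" "1 - (1 - bump a b x) ^ k \<le> 1"
    using b by (auto simp: power_le_one)
  show "1 - (1 - bump a b x) ^ k = 0" if "norm x > r"
    using z[OF that] by simp
next
  fix x :: "real^'n"
  show "(\<lambda>k. 1 - (1 - bump a b x) ^ k) \<longlonglongrightarrow> indicator (box a b) x"
  proof (cases "x \<in> box a b")
    case True
    then have "(\<lambda>k. (1 - bump a b x) ^ k) \<longlonglongrightarrow> 0"
      using bump_pos_iff[of a b x] bump_le_1[of a b x] by (intro LIMSEQ_realpow_zero) auto
    from tendsto_diff[OF tendsto_const[of 1] this] True show ?thesis by simp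
  next
    case False
    then have "bump a b x = 0"
      using bump_pos_iff[of a b x] bump_nonneg[of a b x] by force
    with False show ?thesis by simp
  qed
qed

text \<open>The pointwise maximum need not be smooth. The expression
  \<open>1 - (1 - \<phi> k x) * (1 - \<psi> k x)\<close> is, and for indicators it gives the
  indicator of the union.\<close>

lemma test_limit_Un:
  fixes A B :: "(real^'n::finite) set"
  assumes "test_limit r A" "test_limit r B"
  shows "test_limit r (A \<union> B)"
proof -
  obtain \<phi> where \<phi>: "\<And>k::nat. \<phi> k \<in> test_functions" "\<And>k x. 0 \<le> \<phi> k x" "\<And>k x. \<phi> k x \<le> 1"
    "\<And>k x. norm x > r \<Longrightarrow> \<phi> k x = 0" "\<And>x. (\<lambda>k. \<phi> k x) \<longlonglongrightarrow> indicator A x"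
    using assms(1) unfolding test_limit_def by blast
  obtain \<psi> where \<psi>: "\<And>k::nat. \<psi> k \<in> test_functions" "\<And>k x. 0 \<le> \<psi> k x" "\<And>k x. \<psi> k x \<le> 1"
    "\<And>k x. norm x > r \<Longrightarrow> \<psi> k x = 0" "\<And>x. (\<lambda>k. \<psi> k x) \<longlonglongrightarrow> indicator B x"
    using assms(2) unfolding test_limit_def by blast
  show ?thesis
    unfolding test_limit_def
  proof (intro exI[of _ "\<lambda>k x. 1 - (1 - \<phi> k x) * (1 - \<psi> k x)"] conjI allI impI)
    fix k :: nat and x :: "real^'n"
    show "(\<lambda>x. 1 - (1 - \<phi> k x) * (1 - \<psi> k x)) \<in> test_functions"
      using \<phi>(1)[of k] \<psi>(1)[of k] \<phi>(4) \<psi>(4)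
      by (intro test_functionsI[of _ "cball 0 r"] smooth_diff smooth_mult) (simp_all add: test_functions_iff)
    show "0 \<le> 1 - (1 - \<phi> k x) * (1 - \<psi> k x)" "1 - (1 - \<phi> k x) * (1 - \<psi> k x) \<le> 1"
      using \<phi>(2,3)[of k x] \<psi>(2,3)[of k x] by (auto intro: mult_le_one)
    show "1 - (1 - \<phi> k x) * (1 - \<psi> k x) = 0" if "norm x > r"
      using \<phi>(4) \<psi>(4) that by simp
  next
    fix x
    have "(\<lambda>k. 1 - (1 - \<phi> k x) * (1 - \<psi> k x)) \<longlonglongrightarrow> 1 - (1 - indicator A x) * (1 - indicator B x)"
      by (intro tendsto_intros \<phi> \<psi>)
    also have "1 - (1 - indicator A x) * (1 - indicator B x) = (indicator (A \<union> B) x :: real)"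
      by (auto simp: indicator_def)
    finally show "(\<lambda>k. 1 - (1 - \<phi> k x) * (1 - \<psi> k x)) \<longlonglongrightarrow> indicator (A \<union> B) x" .
  qed
qed

text \<open>Nonnegativity passes from test functions to finite unions of boxes, from these to open
  sets, and by outer regularity to Borel sets. Boundedness of \<open>N\<close> keeps all supports in
  one ball.\<close>

lemma weak_nonneg_integral:
  fixes \<rho> :: "real^'n::finite \<Rightarrow> real"
  assumes \<rho>: "locally_integrable \<rho>"
    and nn: "\<And>\<phi>. \<phi> \<in> test_functions \<Longrightarrow> (\<And>x. \<phi> x \<ge> 0) \<Longrightarrow> (LINT x|lborel. \<rho> x * \<phi> x) \<ge> 0"
    and N: "N \<in> sets borel" "N \<subseteq> ball 0 r"
  shows "(LINT x|lborel. \<rho> x * indicator N x) \<ge> 0"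
proof -
  have open_nonneg: "(LINT x|lborel. \<rho> x * indicator U x) \<ge> 0" if U: "open U" "U \<subseteq> ball 0 r" for U
  proof -
    obtain A B :: "nat \<Rightarrow> real^'n" where AB: "U = (\<Union>n. box (A n) (B n))"
      using open_eq_UNION_boxes[OF U(1)] by blast
    have tl: "test_limit r (\<Union>n\<le>k. box (A n) (B n))" for k :: nat
    proof (induction k)
      case 0
      have "box (A 0) (B 0) \<subseteq> ball 0 r"
        using U(2) unfolding AB by blast
      then show ?case
        using ball_subset_cball by (auto intro!: test_limit_box)
    next
      case (Suc k)
      have "test_limit r (box (A (Suc k)) (B (Suc k)))"
        using U(2) ball_subset_cball[of "0::real^'n" r] unfolding AB by (intro test_limit_box) blast
      from test_limit_Un[OF this Suc] show ?case
        by (simp add: atMost_Suc)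
    qed
    have 1: "(LINT x|lborel. \<rho> x * indicator (\<Union>n\<le>k. box (A n) (B n)) x) \<ge> 0" for k :: nat
    proof -
      obtain \<phi> where \<phi>: "\<And>k::nat. \<phi> k \<in> test_functions" "\<And>k x. 0 \<le> \<phi> k x" "\<And>k x. \<phi> k x \<le> 1"
        "\<And>k x. norm x > r \<Longrightarrow> \<phi> k x = 0" "\<And>x. (\<lambda>k. \<phi> k x) \<longlonglongrightarrow> indicator (\<Union>n\<le>k. box (A n) (B n)) x"
        using tl[of k] unfolding test_limit_def by blast
      show ?thesis
      proof (rule integral_mult_limit_nonneg[OF \<rho>, of \<phi> _ r])
        show "\<phi> k \<in> borel_measurable borel" for k
          by (rule test_measurable[OF \<phi>(1)])
        show "\<bar>\<phi> k x\<bar> \<le> 1" for k x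
          using \<phi>(2,3)[of k x] by simp
        show "AE x in lborel. (\<lambda>k. \<phi> k x) \<longlonglongrightarrow> indicator (\<Union>n\<le>k. box (A n) (B n)) x"
          using \<phi>(5) by simp
      qed (use \<phi>(1,2,4) nn in \<open>simp_all\<close>)
    qed
    show ?thesis
    proof (rule integral_mult_limit_nonneg[OF \<rho>, of "\<lambda>k. indicator (\<Union>n\<le>k. box (A n) (B n))" _ r])
      show "indicator (\<Union>n\<le>k. box (A n) (B n)) x = (0::real)" if "norm x > r" for k x
        using that U(2) unfolding AB by (force simp: indicator_def)
      have "(\<lambda>k. indicator (\<Union>n\<le>k. box (A n) (B n)) x :: real) \<longlonglongrightarrow> indicator U x" for x
      proof (cases "x \<in> U")
        case True
        then obtain n where n: "x \<in> box (A n) (B n)" using AB by blast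
        have "\<forall>\<^sub>F k in sequentially. (indicator (\<Union>n\<le>k. box (A n) (B n)) x :: real) = indicator U x"
          using eventually_ge_at_top[of n] by eventually_elim (use n True in \<open>auto simp: indicator_def\<close>)
        then show ?thesis by (rule tendsto_eventually)
      next
        case False
        then have "indicator (\<Union>n\<le>k. box (A n) (B n)) x = (indicator U x :: real)" for k
          using AB by (auto simp: indicator_def)
        then show ?thesis by simp
      qed
      then show "AE x in lborel. (\<lambda>k. indicator (\<Union>n\<le>k. box (A n) (B n)) x :: real) \<longlonglongrightarrow> indicator U x"
        by simp
      show "\<bar>indicator (\<Union>n\<le>k. box (A n) (B n)) x\<bar> \<le> (1::real)" for k x
        by (simp add: indicator_def)
      show "indicator U \<in> borel_measurable borel"
        using U(1) by (intro borel_measurable_indicator) auto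
      show "0 \<le> (LINT x|lborel. \<rho> x * indicator (\<Union>n\<le>k. box (A n) (B n)) x)" for k
        by (rule 1)
    qed measurable
  qed
  \<comment> \<open>The excess measures (1/2)^k are summable, so by Borel-Cantelli almost every
    point eventually leaves \<open>U k - N\<close>; this gives convergence of the indicators almost
    everywhere.\<close>
  have "\<exists>U. open U \<and> N \<subseteq> U \<and> emeasure lborel (U - N) < ennreal ((1/2) ^ k)" for k :: nat
  proof -
    have "(0::real) < (1/2) ^ k" by simp
    from outer_regular_lborel[OF N(1) this]
    obtain U where "open U" "N \<subseteq> U" "emeasure lborel (U - N) < ennreal ((1/2) ^ k)" .
    then show ?thesis by blast
  qed
  then have "\<exists>U. \<forall>k::nat. open (U k) \<and> N \<subseteq> U k \<and> emeasure lborel (U k - N) < ennreal ((1/2) ^ k)"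
    by (intro choice allI)
  then obtain U where U: "\<And>k::nat. open (U k)" "\<And>k. N \<subseteq> U k"
      "\<And>k. emeasure lborel (U k - N) < ennreal ((1/2) ^ k)"
    by blast
  have em: "emeasure lborel (U k - N) < \<infinity>" for k
    using order_less_trans[OF U(3) ennreal_less_top] by simp
  have "AE x in lborel. eventually (\<lambda>k. x \<in> space lborel - (U k - N)) sequentially"
  proof (rule borel_cantelli_AE1)
    show "U k - N \<in> sets lborel" for k
      using U(1) N(1) by auto
    show "summable (\<lambda>k. measure lborel (U k - N))"
    proof (rule summable_comparison_test'[OF summable_geometric, of "1/2" 0])
      show "norm (measure lborel (U k - N)) \<le> (1/2) ^ k" for k
        using U(3)[of k] by (simp add: measure_def enn2real_leI)
    qed simp
  qed (use em in auto)
  then have lim: "AE x in lborel. (\<lambda>k. indicator (U k \<inter> ball 0 r) x :: real) \<longlonglongrightarrow> indicator N x"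
  proof eventually_elim
    fix x assume "eventually (\<lambda>k. x \<in> space lborel - (U k - N)) sequentially"
    then have "\<forall>\<^sub>F k in sequentially. (indicator (U k \<inter> ball 0 r) x :: real) = indicator N x"
      by eventually_elim (use U(2) N(2) in \<open>auto simp: indicator_def\<close>)
    then show "(\<lambda>k. indicator (U k \<inter> ball 0 r) x :: real) \<longlonglongrightarrow> indicator N x"
      by (rule tendsto_eventually)
  qed
  show ?thesis
  proof (rule integral_mult_limit_nonneg[OF \<rho>, of "\<lambda>k. indicator (U k \<inter> ball 0 r)" _ r])
    show "(indicator (U k \<inter> ball 0 r) :: _ \<Rightarrow> real) \<in> borel_measurable borel" for k
      using U(1) by (intro borel_measurable_indicator) auto
    show "0 \<le> (LINT x|lborel. \<rho> x * indicator (U k \<inter> ball 0 r) x)" for k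
      using U(1) by (intro open_nonneg) auto
  qed (use N lim in \<open>simp_all add: indicator_def\<close>)
qed

text \<open>Applied to the part of \<open>{x. \<rho> x < 0}\<close> inside a ball, the previous
  lemma gives a nonnegative integral of a nonpositive function, so this part is null.\<close>

lemma weak_nonneg_AE:
  fixes \<rho> :: "real^'n::finite \<Rightarrow> real"
  assumes \<rho>: "locally_integrable \<rho>"
    and nn: "\<And>\<phi>. \<phi> \<in> test_functions \<Longrightarrow> (\<And>x. \<phi> x \<ge> 0) \<Longrightarrow> (LINT x|lborel. \<rho> x * \<phi> x) \<ge> 0"
  shows "AE x in lborel. \<rho> x \<ge> 0"
proof -
  note [measurable] = locally_integrable_measurable[OF \<rho>]
  have "AE x in lborel. norm x < real r \<longrightarrow> \<rho> x \<ge> 0" for r :: nat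
  proof -
    let ?N = "{x. \<rho> x < 0} \<inter> ball 0 (real r)"
    have N: "?N \<in> sets borel" by measurable
    have i: "integrable lborel (\<lambda>x. - (\<rho> x * indicator ?N x))"
      using locally_integrable_scaleR[OF \<rho>, of "indicator ?N" 1 "real r"] N
      by (auto simp: indicator_def mult.commute)
    have "(LINT x|lborel. - (\<rho> x * indicator ?N x)) \<ge> 0"
      by (intro integral_nonneg_AE AE_I2) (auto simp: indicator_def)
    moreover have "(LINT x|lborel. \<rho> x * indicator ?N x) \<ge> 0"
      by (rule weak_nonneg_integral[OF \<rho> nn N]) auto
    ultimately have "(LINT x|lborel. - (\<rho> x * indicator ?N x)) = 0"
      using i by simp
    then have "AE x in lborel. - (\<rho> x * indicator ?N x) = 0"
      by (subst (asm) integral_nonneg_eq_0_iff_AE[OF i]) (auto simp: indicator_def)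
    then show ?thesis
      by eventually_elim (auto simp: indicator_def split: if_splits)
  qed
  then have "AE x in lborel. \<forall>r::nat. norm x < real r \<longrightarrow> \<rho> x \<ge> 0"
    by (intro AE_all_countable[THEN iffD2] allI)
  then show ?thesis
    by eventually_elim (meson reals_Archimedean2)
qed

lemma weak_zero_AE:
  fixes \<rho> :: "real^'n::finite \<Rightarrow> real"
  assumes \<rho>: "locally_integrable \<rho>"
    and z: "\<And>\<phi>. \<phi> \<in> test_functions \<Longrightarrow> (LINT x|lborel. \<rho> x * \<phi> x) = 0"
  shows "AE x in lborel. \<rho> x = 0"
proof -
  have "AE x in lborel. - \<rho> x \<ge> 0"
    using locally_integrable_scaleR_right[OF \<rho>, of "-1"] z by (intro weak_nonneg_AE) auto
  moreover have "AE x in lborel. \<rho> x \<ge> 0"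
    using z by (intro weak_nonneg_AE[OF \<rho>]) auto
  ultimately show ?thesis by eventually_elim simp
qed

text \<open>Makes the choice operator in \<open>wgrad\<close> harmless: all candidates agree almost
  everywhere.\<close>

lemma has_weak_gradient_unique:
  assumes "has_weak_gradient f F" "has_weak_gradient f F'"
  shows "AE x in lborel. F x = F' x"
proof -
  have "AE x in lborel. F x $ i - F' x $ i = 0" for i
  proof -
    have l: "locally_integrable (\<lambda>x. F x $ i)" "locally_integrable (\<lambda>x. F' x $ i)"
      using assms by (auto simp: has_weak_gradient_def intro: locally_integrable_vec_nth)
    show ?thesis
    proof (rule weak_zero_AE)
      show "locally_integrable (\<lambda>x. F x $ i - F' x $ i)"
        using locally_integrable_add[OF l(1) locally_integrable_scaleR_right[OF l(2), of "-1"]] by simp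
      show "(LINT x|lborel. (F x $ i - F' x $ i) * \<phi> x) = 0" if "\<phi> \<in> test_functions" for \<phi>
        using assms that locally_integrable_mult_test[OF l(1) that] locally_integrable_mult_test[OF l(2) that]
        by (simp add: left_diff_distrib has_weak_gradient_def)
    qed
  qed
  then have "AE x in lborel. \<forall>i. F x $ i - F' x $ i = 0"
    by (simp add: AE_all_countable)
  then show ?thesis
    by eventually_elim (simp add: vec_eq_iff)
qed

section \<open>Hilbert space arguments in \<open>L\<^sup>2\<close>\<close>

text \<open>Vector-valued counterpart of \<open>L2_norm\<close>, since a function and its gradient
  will be treated as one map into a product space.\<close>

definition l2norm :: "'a measure \<Rightarrow> ('a \<Rightarrow> 'e::euclidean_space) \<Rightarrow> real" where
  "l2norm M f = sqrt (LINT x|M. (norm (f x))\<^sup>2)"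

lemma l2norm_nonneg [simp]: "0 \<le> l2norm M f"
  by (simp add: l2norm_def)

lemma l2norm_sq: "(l2norm M f)\<^sup>2 = (LINT x|M. (norm (f x))\<^sup>2)"
  by (simp add: l2norm_def)

lemma L2_measurable [dest]: "f \<in> L2 M \<Longrightarrow> f \<in> borel_measurable M"
  and L2_integrable: "f \<in> L2 M \<Longrightarrow> integrable M (\<lambda>x. (norm (f x))\<^sup>2)"
  by (auto simp: L2_def)

lemma L2_dominated:
  fixes f :: "'a \<Rightarrow> 'e::euclidean_space" and g :: "'a \<Rightarrow> 'f::euclidean_space"
  assumes g: "g \<in> L2 M" and f: "f \<in> borel_measurable M"
    and le: "AE x in M. norm (f x) \<le> B * norm (g x)"
  shows "f \<in> L2 M"
proof -
  note [measurable] = f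
  have "integrable M (\<lambda>x. (norm (f x))\<^sup>2)"
  proof (rule Bochner_Integration.integrable_bound)
    show "integrable M (\<lambda>x. B\<^sup>2 * (norm (g x))\<^sup>2)"
      using L2_integrable[OF g] by simp
    show "AE x in M. norm ((norm (f x))\<^sup>2) \<le> norm (B\<^sup>2 * (norm (g x))\<^sup>2)"
      using le
    proof eventually_elim
      fix x assume "norm (f x) \<le> B * norm (g x)"
      then have "(norm (f x))\<^sup>2 \<le> (B * norm (g x))\<^sup>2"
        by (rule power_mono) simp
      then show "norm ((norm (f x))\<^sup>2) \<le> norm (B\<^sup>2 * (norm (g x))\<^sup>2)"
        by (simp add: power_mult_distrib)
    qed
  qed measurable
  with f show ?thesis by (simp add: L2_def)
qed

lemma L2_scaleR:
  fixes f :: "'a \<Rightarrow> 'e::euclidean_space"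
  shows "f \<in> L2 M \<Longrightarrow> (\<lambda>x. c *\<^sub>R f x) \<in> L2 M"
  by (rule L2_dominated[of f M _ "\<bar>c\<bar>"]) auto

lemma L2_add:
  fixes f :: "'a \<Rightarrow> 'e::euclidean_space"
  assumes "f \<in> L2 M" "g \<in> L2 M"
  shows "(\<lambda>x. f x + g x) \<in> L2 M"
proof -
  note [measurable] = L2_measurable[OF assms(1)] L2_measurable[OF assms(2)]
  have "integrable M (\<lambda>x. (norm (f x + g x))\<^sup>2)"
  proof (rule Bochner_Integration.integrable_bound)
    show "integrable M (\<lambda>x. 2 * (norm (f x))\<^sup>2 + 2 * (norm (g x))\<^sup>2)"
      using assms by (intro Bochner_Integration.integrable_add integrable_mult_right L2_integrable)
    have "(norm (f x + g x))\<^sup>2 \<le> 2 * (norm (f x))\<^sup>2 + 2 * (norm (g x))\<^sup>2" for x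
    proof -
      have "(norm (f x + g x))\<^sup>2 \<le> (norm (f x) + norm (g x))\<^sup>2"
        by (intro power_mono norm_triangle_ineq) simp
      also have "\<dots> \<le> 2 * (norm (f x))\<^sup>2 + 2 * (norm (g x))\<^sup>2"
        using sum_squares_bound[of "norm (f x)" "norm (g x)"] by (simp add: power2_sum)
      finally show ?thesis .
    qed
    then show "AE x in M. norm ((norm (f x + g x))\<^sup>2) \<le> norm (2 * (norm (f x))\<^sup>2 + 2 * (norm (g x))\<^sup>2)"
      by (intro AE_I2) simp
  qed measurable
  then show ?thesis by (simp add: L2_def)
qed

lemma L2_diff:
  fixes f :: "'a \<Rightarrow> 'e::euclidean_space"
  assumes "f \<in> L2 M" "g \<in> L2 M"
  shows "(\<lambda>x. f x - g x) \<in> L2 M"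
  using L2_add[OF assms(1) L2_scaleR[OF assms(2), of "-1"]] by simp

lemma L2_inner_integrable:
  fixes f :: "'a \<Rightarrow> 'e::euclidean_space"
  assumes "f \<in> L2 M" "g \<in> L2 M"
  shows "integrable M (\<lambda>x. f x \<bullet> g x)"
proof (rule Bochner_Integration.integrable_bound)
  show "(\<lambda>x. f x \<bullet> g x) \<in> borel_measurable M"
    using assms by (intro borel_measurable_inner) auto
  show "integrable M (\<lambda>x. (norm (f x))\<^sup>2 + (norm (g x))\<^sup>2)"
    using assms by (intro Bochner_Integration.integrable_add L2_integrable)
  have "\<bar>f x \<bullet> g x\<bar> \<le> (norm (f x))\<^sup>2 + (norm (g x))\<^sup>2" for x
  proof -
    have "2 * \<bar>f x \<bullet> g x\<bar> \<le> 2 * (norm (f x) * norm (g x))"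
      using Cauchy_Schwarz_ineq2[of "f x" "g x"] by simp
    also have "\<dots> \<le> (norm (f x))\<^sup>2 + (norm (g x))\<^sup>2"
      using sum_squares_bound[of "norm (f x)" "norm (g x)"] by simp
    finally show ?thesis by (smt (verit) zero_le_power2)
  qed
  then show "AE x in M. norm (f x \<bullet> g x) \<le> norm ((norm (f x))\<^sup>2 + (norm (g x))\<^sup>2)"
    by (intro AE_I2) simp
qed

text \<open>The one computation behind Cauchy-Schwarz, the triangle inequality and the parallelogram
  law, obtained by different choices of \<open>s\<close> and \<open>t\<close>.\<close>

lemma l2norm_expand:
  fixes f :: "'a \<Rightarrow> 'e::euclidean_space"
  assumes "f \<in> L2 M" "g \<in> L2 M"
  shows "(l2norm M (\<lambda>x. s *\<^sub>R f x + t *\<^sub>R g x))\<^sup>2 =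
    s\<^sup>2 * (l2norm M f)\<^sup>2 + 2 * s * t * (LINT x|M. f x \<bullet> g x) + t\<^sup>2 * (l2norm M g)\<^sup>2"
proof -
  have "(norm (s *\<^sub>R f x + t *\<^sub>R g x))\<^sup>2 =
      s\<^sup>2 * (norm (f x))\<^sup>2 + 2 * s * t * (f x \<bullet> g x) + t\<^sup>2 * (norm (g x))\<^sup>2" for x
    unfolding power2_norm_eq_inner by (simp add: algebra_simps inner_commute power2_eq_square)
  then have "(l2norm M (\<lambda>x. s *\<^sub>R f x + t *\<^sub>R g x))\<^sup>2 =
    (LINT x|M. s\<^sup>2 * (norm (f x))\<^sup>2 + 2 * s * t * (f x \<bullet> g x) + t\<^sup>2 * (norm (g x))\<^sup>2)"
    by (simp add: l2norm_sq)
  also have "\<dots> = s\<^sup>2 * (l2norm M f)\<^sup>2 + 2 * s * t * (LINT x|M. f x \<bullet> g x) + t\<^sup>2 * (l2norm M g)\<^sup>2"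
    using L2_integrable[OF assms(1)] L2_integrable[OF assms(2)] L2_inner_integrable[OF assms]
    by (simp add: l2norm_sq)
  finally show ?thesis .
qed

lemma l2norm_eq_0_AE:
  fixes f :: "'a \<Rightarrow> 'e::euclidean_space"
  assumes "f \<in> L2 M" "l2norm M f = 0"
  shows "AE x in M. f x = 0"
proof -
  have "(LINT x|M. (norm (f x))\<^sup>2) = 0"
    using assms(2) by (simp add: l2norm_def)
  then have "AE x in M. (norm (f x))\<^sup>2 = 0"
    using integral_nonneg_eq_0_iff_AE[OF L2_integrable[OF assms(1)]] by simp
  then show ?thesis by eventually_elim simp
qed

lemma l2_Cauchy_Schwarz:
  fixes f :: "'a \<Rightarrow> 'e::euclidean_space"
  assumes f: "f \<in> L2 M" and g: "g \<in> L2 M"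
  shows "\<bar>LINT x|M. f x \<bullet> g x\<bar> \<le> l2norm M f * l2norm M g"
proof (cases "l2norm M f = 0 \<or> l2norm M g = 0")
  case True
  then have "AE x in M. f x \<bullet> g x = 0"
    using l2norm_eq_0_AE[OF f] l2norm_eq_0_AE[OF g] by (auto elim: eventually_mono)
  then have "(LINT x|M. f x \<bullet> g x) = 0"
    by (rule integral_eq_zero_AE)
  then show ?thesis by simp
next
  case False
  define a b c where "a = l2norm M f" and "b = l2norm M g" and "c = (LINT x|M. f x \<bullet> g x)"
  have ab: "a > 0" "b > 0"
    using False l2norm_nonneg[of M f] l2norm_nonneg[of M g] unfolding a_def b_def by linarith+
  \<comment> \<open>For \<open>t = a\<close> and \<open>t = - a\<close> both squares in the
    expansion become a^2 b^2, and a common factor 2 a b can be cancelled.\<close>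
  have "0 \<le> b\<^sup>2 * a\<^sup>2 + 2 * b * t * c + t\<^sup>2 * b\<^sup>2" for t
    using l2norm_expand[OF f g, of b t] unfolding a_def b_def c_def by (metis zero_le_power2)
  from this[of a] this[of "- a"] have "0 \<le> (2 * a * b) * (a * b + c)" "0 \<le> (2 * a * b) * (a * b - c)"
    by (simp_all add: algebra_simps power2_eq_square)
  then have "0 \<le> a * b + c" "0 \<le> a * b - c"
    using mult_pos_neg[of "2 * a * b"] ab by (smt (verit) mult_pos_pos)+
  then show ?thesis unfolding a_def b_def c_def by linarith
qed

lemma l2norm_scaleR: "l2norm M (\<lambda>x. c *\<^sub>R f x) = \<bar>c\<bar> * l2norm M f"
  by (simp add: l2norm_def power_mult_distrib real_sqrt_mult)

lemma l2norm_minus_commute: "l2norm M (\<lambda>x. f x - g x) = l2norm M (\<lambda>x. g x - f x)"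
  by (simp add: l2norm_def norm_minus_commute)

lemma l2norm_triangle:
  fixes f :: "'a \<Rightarrow> 'e::euclidean_space"
  assumes "f \<in> L2 M" "g \<in> L2 M"
  shows "l2norm M (\<lambda>x. f x + g x) \<le> l2norm M f + l2norm M g"
proof (rule power2_le_imp_le)
  show "(l2norm M (\<lambda>x. f x + g x))\<^sup>2 \<le> (l2norm M f + l2norm M g)\<^sup>2"
    using l2norm_expand[OF assms, of 1 1] l2_Cauchy_Schwarz[OF assms]
    by (simp add: power2_sum abs_le_iff)
qed simp

lemma l2norm_triangle_diff:
  fixes f :: "'a \<Rightarrow> 'e::euclidean_space"
  assumes "f \<in> L2 M" "g \<in> L2 M" "k \<in> L2 M"
  shows "l2norm M (\<lambda>x. f x - k x) \<le> l2norm M (\<lambda>x. f x - g x) + l2norm M (\<lambda>x. g x - k x)"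
  using l2norm_triangle[OF L2_diff[OF assms(1,2)] L2_diff[OF assms(2,3)]] by simp

lemma l2norm_mono_AE:
  fixes f :: "'a \<Rightarrow> 'e::euclidean_space" and g :: "'a \<Rightarrow> 'f::euclidean_space"
  assumes "f \<in> L2 M" "g \<in> L2 M" "AE x in M. norm (f x) \<le> B * norm (g x)" "B \<ge> 0"
  shows "l2norm M f \<le> B * l2norm M g"
proof (rule power2_le_imp_le)
  have "(l2norm M f)\<^sup>2 \<le> (LINT x|M. B\<^sup>2 * (norm (g x))\<^sup>2)"
    unfolding l2norm_sq
  proof (rule integral_mono_AE)
    show "AE x in M. (norm (f x))\<^sup>2 \<le> B\<^sup>2 * (norm (g x))\<^sup>2"
      using assms(3) by eventually_elim (metis norm_ge_zero power_mono power_mult_distrib)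
  qed (use assms L2_integrable in auto)
  then show "(l2norm M f)\<^sup>2 \<le> (B * l2norm M g)\<^sup>2"
    by (simp add: l2norm_sq power_mult_distrib)
qed (use assms in simp)

lemma l2_inner_tendsto_0:
  fixes f :: "nat \<Rightarrow> 'a \<Rightarrow> 'e::euclidean_space"
  assumes f: "\<And>n. f n \<in> L2 M" and g: "\<And>n. g n \<in> L2 M"
    and lim: "(\<lambda>n. l2norm M (f n)) \<longlonglongrightarrow> 0" and bd: "\<And>n. l2norm M (g n) \<le> K"
  shows "(\<lambda>n. LINT x|M. f n x \<bullet> g n x) \<longlonglongrightarrow> 0"
proof (rule Lim_null_comparison)
  show "\<forall>\<^sub>F n in sequentially. norm (LINT x|M. f n x \<bullet> g n x) \<le> l2norm M (f n) * K"
    using l2_Cauchy_Schwarz[OF f g] bd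
    by (intro always_eventually allI) (metis l2norm_nonneg mult_left_mono order_trans real_norm_def)
  show "(\<lambda>n. l2norm M (f n) * K) \<longlonglongrightarrow> 0"
    using tendsto_mult[OF lim tendsto_const[of K]] by simp
qed

lemma l2norm_tendsto_bounded:
  fixes f :: "nat \<Rightarrow> 'a \<Rightarrow> 'e::euclidean_space"
  assumes f: "\<And>n. f n \<in> L2 M" and g: "g \<in> L2 M"
    and lim: "(\<lambda>n. l2norm M (\<lambda>x. f n x - g x)) \<longlonglongrightarrow> 0"
  obtains K where "\<And>n. l2norm M (f n) \<le> K"
proof -
  obtain K where K: "\<And>n. \<bar>l2norm M (\<lambda>x. f n x - g x)\<bar> \<le> K"
    using convergent_imp_Bseq[OF convergentI[OF lim]] by (auto simp: Bseq_def)
  have "l2norm M (f n) \<le> K + l2norm M g" for n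
    using l2norm_triangle[OF L2_diff[OF f[of n] g] g] K[of n] by simp
  then show thesis by (rule that)
qed

lemma l2_inner_tendsto:
  fixes f :: "nat \<Rightarrow> 'a \<Rightarrow> 'e::euclidean_space"
  assumes f: "\<And>n. f n \<in> L2 M" and g: "\<And>n. g n \<in> L2 M" and f': "f' \<in> L2 M" and g': "g' \<in> L2 M"
    and lf: "(\<lambda>n. l2norm M (\<lambda>x. f n x - f' x)) \<longlonglongrightarrow> 0"
    and lg: "(\<lambda>n. l2norm M (\<lambda>x. g n x - g' x)) \<longlonglongrightarrow> 0"
  shows "(\<lambda>n. LINT x|M. f n x \<bullet> g n x) \<longlonglongrightarrow> (LINT x|M. f' x \<bullet> g' x)"
proof -
  obtain K where K: "\<And>n. l2norm M (g n) \<le> K"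
    using g g' lg by (rule l2norm_tendsto_bounded) blast
  have "(\<lambda>n. LINT x|M. (f n x - f' x) \<bullet> g n x) \<longlonglongrightarrow> 0"
    using f g f' lf K by (intro l2_inner_tendsto_0 L2_diff)
  moreover have "(\<lambda>n. LINT x|M. (g n x - g' x) \<bullet> f' x) \<longlonglongrightarrow> 0"
    using f' g g' lg by (intro l2_inner_tendsto_0[of _ _ _ "l2norm M f'"] L2_diff) auto
  ultimately have "(\<lambda>n. (LINT x|M. (f n x - f' x) \<bullet> g n x) + (LINT x|M. (g n x - g' x) \<bullet> f' x)
      + (LINT x|M. f' x \<bullet> g' x)) \<longlonglongrightarrow> 0 + 0 + (LINT x|M. f' x \<bullet> g' x)"
    by (intro tendsto_intros)
  moreover have "(LINT x|M. (f n x - f' x) \<bullet> g n x) + (LINT x|M. (g n x - g' x) \<bullet> f' x)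
      + (LINT x|M. f' x \<bullet> g' x) = (LINT x|M. f n x \<bullet> g n x)" for n
    using L2_inner_integrable[OF f g] L2_inner_integrable[OF f' g] L2_inner_integrable[OF g f']
      L2_inner_integrable[OF g' f'] L2_inner_integrable[OF f' g']
    by (simp add: inner_diff_left) (simp add: inner_commute)
  ultimately show ?thesis by simp
qed

section \<open>Completeness of L2 and Mazur's lemma\<close>

lemma fast_Cauchy_subseq:
  fixes d :: "nat \<Rightarrow> nat \<Rightarrow> real"
  assumes "\<And>e. e > 0 \<Longrightarrow> \<exists>N. \<forall>m\<ge>N. \<forall>n\<ge>N. d m n < e"
  obtains r where "strict_mono r" "\<And>k n. n \<ge> r k \<Longrightarrow> d (r k) n < (1/4) ^ k"
proof -
  have "\<forall>k. \<exists>N. \<forall>m\<ge>N. \<forall>n\<ge>N. d m n < (1/4) ^ k"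
    by (intro allI assms) simp
  from choice[OF this] obtain N where N: "\<And>k m n. m \<ge> N k \<Longrightarrow> n \<ge> N k \<Longrightarrow> d m n < (1/4) ^ k"
    by blast
  \<comment> \<open>The sum dominates \<open>N k\<close>, and the summand \<open>k\<close> makes the
    indices strictly increasing.\<close>
  define r where "r k = k + (\<Sum>i\<le>k. N i)" for k
  have "strict_mono r"
    by (rule strict_mono_Suc_iff[THEN iffD2]) (simp add: r_def)
  moreover have "N k \<le> r k" for k
  proof -
    have "N k \<le> (\<Sum>i\<le>k. N i)" by (rule member_le_sum) auto
    then show ?thesis unfolding r_def by simp
  qed
  then have "d (r k) n < (1/4) ^ k" if "n \<ge> r k" for k n
    using that by (intro N) (auto intro: order_trans)
  ultimately show thesis by (rule that)
qed

text \<open>Riesz-Fischer: a rapidly Cauchy subsequence converges almost everywhere, and Fatou's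
  lemma turns pointwise into norm convergence. As the measure may be infinite, the increments need
  not be integrable, so their squares are summed instead, with weights \<open>2 ^ k\<close>.\<close>

theorem L2_complete:
  fixes U :: "nat \<Rightarrow> 'a \<Rightarrow> 'e::euclidean_space"
  assumes U: "\<And>k. U k \<in> L2 M"
    and Cauchy: "\<And>e. e > 0 \<Longrightarrow> \<exists>N. \<forall>m\<ge>N. \<forall>n\<ge>N. l2norm M (\<lambda>x. U m x - U n x) < e"
  obtains V where "V \<in> L2 M" "(\<lambda>k. l2norm M (\<lambda>x. U k x - V x)) \<longlonglongrightarrow> 0"
proof -
  note [measurable] = L2_measurable[OF U]
  obtain r where r: "strict_mono r"
    "\<And>k n. n \<ge> r k \<Longrightarrow> l2norm M (\<lambda>x. U (r k) x - U n x) < (1/4) ^ k"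
    using fast_Cauchy_subseq[OF Cauchy] by blast
  define D where "D k x = norm (U (r k) x - U (r (Suc k)) x)" for k x
  \<comment> \<open>The rate (1/4)^k leaves room for the weight: 2^k times the square of (1/4)^k is
    (1/8)^k, which is still summable.\<close>
  have D_int: "(\<integral>\<^sup>+x. ennreal (2 ^ k * (D k x)\<^sup>2) \<partial>M) \<le> ennreal ((1/8) ^ k)" for k
  proof -
    have "integrable M (\<lambda>x. (D k x)\<^sup>2)"
      unfolding D_def by (intro L2_integrable L2_diff U)
    then have "(\<integral>\<^sup>+x. ennreal (2 ^ k * (D k x)\<^sup>2) \<partial>M) = ennreal (2 ^ k * (l2norm M (\<lambda>x. U (r k) x - U (r (Suc k)) x))\<^sup>2)"
      by (subst nn_integral_eq_integral) (auto simp: l2norm_sq D_def)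
    also have "\<dots> \<le> ennreal (2 ^ k * ((1/4) ^ k)\<^sup>2)"
      using r(2)[of k "r (Suc k)"] strict_mono_less_eq[OF r(1)]
      by (intro ennreal_leI mult_left_mono power_mono) (auto intro: less_imp_le)
    also have "2 ^ k * ((1/4) ^ k)\<^sup>2 = (1/8::real) ^ k"
      by (simp add: power2_eq_square power_mult_distrib[symmetric] flip: power_mult_distrib)
    finally show ?thesis .
  qed
  have "(\<integral>\<^sup>+x. (\<Sum>k. ennreal (2 ^ k * (D k x)\<^sup>2)) \<partial>M) = (\<Sum>k. \<integral>\<^sup>+x. ennreal (2 ^ k * (D k x)\<^sup>2) \<partial>M)"
    unfolding D_def by (rule nn_integral_suminf) measurable
  also have "\<dots> \<le> (\<Sum>k. ennreal ((1/8) ^ k))"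
    by (intro suminf_le D_int) auto
  also have "\<dots> = ennreal (\<Sum>k. (1/8) ^ k)"
    by (intro suminf_ennreal2 summable_geometric) auto
  also have "\<dots> < \<infinity>" by simp
  finally have "AE x in M. (\<Sum>k. ennreal (2 ^ k * (D k x)\<^sup>2)) \<noteq> \<infinity>"
    unfolding D_def by (intro nn_integral_noteq_infinite) auto
  then have conv: "AE x in M. (\<lambda>k. U (r k) x) \<longlonglongrightarrow> lim (\<lambda>k. U (r k) x)"
  proof eventually_elim
    fix x assume "(\<Sum>k. ennreal (2 ^ k * (D k x)\<^sup>2)) \<noteq> \<infinity>"
    then have s: "summable (\<lambda>k. 2 ^ k * (D k x)\<^sup>2)"
      by (intro summable_suminf_not_top) auto
    have "summable (\<lambda>k. norm (U (r (Suc k)) x - U (r k) x))"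
    proof (rule summable_comparison_test'[of "\<lambda>k. 2 ^ k * (D k x)\<^sup>2 + (1/2) ^ k" 0])
      show "summable (\<lambda>k. 2 ^ k * (D k x)\<^sup>2 + (1/2) ^ k)"
        by (intro summable_add s summable_geometric) simp
      fix k
      \<comment> \<open>Completing the square bounds an increment by its weighted square plus a
        geometric term, and thereby gives absolute convergence at the point
        \<open>x\<close>.\<close>
      have "0 \<le> (1/2) ^ k * (2 ^ k * D k x - 1)\<^sup>2" by simp
      also have "\<dots> = 2 ^ k * (D k x)\<^sup>2 + (1/2) ^ k - 2 * D k x"
        by (simp add: power2_eq_square algebra_simps power_one_over)
      finally have "2 * D k x \<le> 2 ^ k * (D k x)\<^sup>2 + (1/2) ^ k" by simp
      moreover have "0 \<le> D k x" by (simp add: D_def)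
      ultimately have "D k x \<le> 2 ^ k * (D k x)\<^sup>2 + (1/2) ^ k" by linarith
      then show "norm (norm (U (r (Suc k)) x - U (r k) x)) \<le> 2 ^ k * (D k x)\<^sup>2 + (1/2) ^ k"
        by (simp add: D_def norm_minus_commute)
    qed
    then have "summable (\<lambda>k. U (r (Suc k)) x - U (r k) x)"
      by (rule summable_norm_cancel)
    then have "(\<lambda>n. \<Sum>k<n. U (r (Suc k)) x - U (r k) x) \<longlonglongrightarrow> (\<Sum>k. U (r (Suc k)) x - U (r k) x)"
      by (rule summable_LIMSEQ)
    then have "(\<lambda>n. (U (r n) x - U (r 0) x) + U (r 0) x) \<longlonglongrightarrow> (\<Sum>k. U (r (Suc k)) x - U (r k) x) + U (r 0) x"
      unfolding sum_lessThan_telescope[of "\<lambda>k. U (r k) x"] by (intro tendsto_add tendsto_const)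
    then have "convergent (\<lambda>k. U (r k) x)"
      by (auto simp: convergent_def)
    then show "(\<lambda>k. U (r k) x) \<longlonglongrightarrow> lim (\<lambda>k. U (r k) x)"
      by (simp add: convergent_LIMSEQ_iff)
  qed
  \<comment> \<open>On the null set where the subsequence diverges \<open>V\<close> takes whatever
    value \<open>lim\<close> returns; measurability holds all the same.\<close>
  define V where "V x = lim (\<lambda>k. U (r k) x)" for x
  have [measurable]: "V \<in> borel_measurable M"
    unfolding V_def by measurable
  have bound: "(\<integral>\<^sup>+x. ennreal ((norm (U n x - V x))\<^sup>2) \<partial>M) \<le> ennreal (e\<^sup>2)"
    if e: "e > 0" and N: "\<And>m. m \<ge> N \<Longrightarrow> l2norm M (\<lambda>x. U n x - U m x) < e" for n e N
  proof -
    have "(\<integral>\<^sup>+x. ennreal ((norm (U n x - V x))\<^sup>2) \<partial>M) =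
        (\<integral>\<^sup>+x. liminf (\<lambda>k. ennreal ((norm (U n x - U (r k) x))\<^sup>2)) \<partial>M)"
    proof (rule nn_integral_cong_AE)
      show "AE x in M. ennreal ((norm (U n x - V x))\<^sup>2) = liminf (\<lambda>k. ennreal ((norm (U n x - U (r k) x))\<^sup>2))"
        using conv
      proof eventually_elim
        fix x assume "(\<lambda>k. U (r k) x) \<longlonglongrightarrow> lim (\<lambda>k. U (r k) x)"
        then have "(\<lambda>k. ennreal ((norm (U n x - U (r k) x))\<^sup>2)) \<longlonglongrightarrow> ennreal ((norm (U n x - V x))\<^sup>2)"
          unfolding V_def by (intro tendsto_intros tendsto_ennrealI)
        then show "ennreal ((norm (U n x - V x))\<^sup>2) = liminf (\<lambda>k. ennreal ((norm (U n x - U (r k) x))\<^sup>2))"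
          by (rule lim_imp_Liminf[OF trivial_limit_sequentially, symmetric])
      qed
    qed
    also have "\<dots> \<le> liminf (\<lambda>k. \<integral>\<^sup>+x. ennreal ((norm (U n x - U (r k) x))\<^sup>2) \<partial>M)"
      by (rule nn_integral_liminf) measurable
    also have "\<dots> \<le> liminf (\<lambda>k. ennreal (e\<^sup>2))"
    proof (rule Liminf_mono)
      have "(\<integral>\<^sup>+x. ennreal ((norm (U n x - U (r k) x))\<^sup>2) \<partial>M) \<le> ennreal (e\<^sup>2)" if "k \<ge> N" for k
      proof -
        have "r k \<ge> N" using that strict_mono_imp_increasing[OF r(1), of k] by simp
        have "(\<integral>\<^sup>+x. ennreal ((norm (U n x - U (r k) x))\<^sup>2) \<partial>M) = ennreal ((l2norm M (\<lambda>x. U n x - U (r k) x))\<^sup>2)"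
          unfolding l2norm_sq by (intro nn_integral_eq_integral L2_integrable L2_diff U) auto
        also have "\<dots> \<le> ennreal (e\<^sup>2)"
          using N[OF \<open>r k \<ge> N\<close>] by (intro ennreal_leI power_mono) auto
        finally show ?thesis .
      qed
      then show "\<forall>\<^sub>F k in sequentially. (\<integral>\<^sup>+x. ennreal ((norm (U n x - U (r k) x))\<^sup>2) \<partial>M) \<le> ennreal (e\<^sup>2)"
        by (rule eventually_sequentiallyI)
    qed
    also have "\<dots> = ennreal (e\<^sup>2)" by (simp add: Liminf_const)
    finally show ?thesis .
  qed
  have diff_L2: "(\<lambda>x. U n x - V x) \<in> L2 M \<and> l2norm M (\<lambda>x. U n x - V x) \<le> e"
    if e: "e > 0" and N: "\<And>m. m \<ge> N \<Longrightarrow> l2norm M (\<lambda>x. U n x - U m x) < e" for n e N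
  proof
    have "integrable M (\<lambda>x. (norm (U n x - V x))\<^sup>2)"
      using le_less_trans[OF bound[OF e N] ennreal_less_top] by (intro integrableI_bounded) auto
    then show L: "(\<lambda>x. U n x - V x) \<in> L2 M" by (simp add: L2_def)
    have "ennreal ((l2norm M (\<lambda>x. U n x - V x))\<^sup>2) \<le> ennreal (e\<^sup>2)"
      unfolding l2norm_sq using bound[OF e N] L2_integrable[OF L]
      by (subst nn_integral_eq_integral[symmetric]) auto
    then have "(l2norm M (\<lambda>x. U n x - V x))\<^sup>2 \<le> e\<^sup>2"
      by simp
    then show "l2norm M (\<lambda>x. U n x - V x) \<le> e"
      by (rule power2_le_imp_le) (use e in simp)
  qed
  obtain N where N: "\<And>m n. m \<ge> N \<Longrightarrow> n \<ge> N \<Longrightarrow> l2norm M (\<lambda>x. U m x - U n x) < 1"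
    using Cauchy[of 1] by auto
  have "(\<lambda>x. U N x - (U N x - V x)) \<in> L2 M"
    by (rule L2_diff[OF U]) (use diff_L2[of 1 N N] N in auto)
  then have "V \<in> L2 M" by simp
  moreover have "(\<lambda>k. l2norm M (\<lambda>x. U k x - V x)) \<longlonglongrightarrow> 0"
  proof (rule LIMSEQ_I)
    fix e :: real assume "e > 0"
    then obtain N where N: "\<And>m n. m \<ge> N \<Longrightarrow> n \<ge> N \<Longrightarrow> l2norm M (\<lambda>x. U m x - U n x) < e / 2"
      using Cauchy[of "e / 2"] by auto
    have "l2norm M (\<lambda>x. U n x - V x) < e" if "n \<ge> N" for n
      using diff_L2[of "e / 2" N n] N[OF that] \<open>e > 0\<close> by auto
    then show "\<exists>N. \<forall>n\<ge>N. norm (l2norm M (\<lambda>x. U n x - V x) - 0) < e"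
      by auto
  qed
  ultimately show thesis by (rule that)
qed

text \<open>Iterated midpoints are the convex combinations with dyadic weights. They are what the
  parallelogram law asks for, and they give an induction rule with a single closure case.\<close>

inductive_set midpoint_hull :: "('a \<Rightarrow> 'e::real_vector) set \<Rightarrow> ('a \<Rightarrow> 'e) set" for A where
  base: "f \<in> A \<Longrightarrow> f \<in> midpoint_hull A"
| mid: "f \<in> midpoint_hull A \<Longrightarrow> g \<in> midpoint_hull A \<Longrightarrow> (\<lambda>x. (1/2) *\<^sub>R f x + (1/2) *\<^sub>R g x) \<in> midpoint_hull A"

lemma midpoint_hull_mono:
  assumes "A \<subseteq> B" "f \<in> midpoint_hull A"
  shows "f \<in> midpoint_hull B"
  using assms(2) by induction (use assms(1) in \<open>auto intro: midpoint_hull.intros\<close>)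

text \<open>Near-minimisers of the norm over the hulls of the tails form a Cauchy sequence by the
  parallelogram law.\<close>

theorem L2_Mazur:
  fixes U :: "nat \<Rightarrow> 'a \<Rightarrow> 'e::euclidean_space"
  assumes U: "\<And>k. U k \<in> L2 M" and bd: "\<And>k. l2norm M (U k) \<le> K"
  obtains W V where "\<And>N. W N \<in> midpoint_hull (U ` {N..})" "\<And>N. W N \<in> L2 M" "V \<in> L2 M"
    "(\<lambda>N. l2norm M (\<lambda>x. W N x - V x)) \<longlonglongrightarrow> 0"
proof -
  define H where "H N = midpoint_hull (U ` {N..})" for N
  have H_L2: "f \<in> L2 M" if "f \<in> H N" for f N
    using that unfolding H_def by induction (use U in \<open>auto intro!: L2_add L2_scaleR\<close>)
  have H_anti: "H N \<subseteq> H N'" if "N' \<le> N" for N N'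
    unfolding H_def using that by (intro subsetI, elim midpoint_hull_mono[rotated]) auto
  define S where "S N = (\<lambda>f. (l2norm M f)\<^sup>2) ` H N" for N
  define d where "d N = Inf (S N)" for N
  have U_H: "U N \<in> H N" for N
    unfolding H_def by (intro midpoint_hull.base) auto
  have S_ne: "S N \<noteq> {}" for N
    using U_H by (auto simp: S_def)
  have S_bdd: "bdd_below (S N)" for N
    by (auto simp: S_def intro!: bdd_belowI[of _ 0])
  have d_le: "d N \<le> (l2norm M f)\<^sup>2" if "f \<in> H N" for f N
    unfolding d_def using that by (intro cInf_lower S_bdd) (auto simp: S_def)
  have d_mono: "d N' \<le> d N" if "N' \<le> N" for N N'
    unfolding d_def using H_anti[OF that] by (intro cInf_superset_mono S_ne S_bdd) (auto simp: S_def)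
  have "d N \<le> K\<^sup>2" for N
    using d_le[OF U_H] bd[of N] by (meson l2norm_nonneg order_trans power_mono)
  moreover have "incseq d"
    using d_mono by (simp add: incseq_def)
  ultimately obtain D where D: "d \<longlonglongrightarrow> D" "\<And>N. d N \<le> D"
    using incseq_convergent[of d "K\<^sup>2"] by blast
  have "\<exists>f\<in>H N. (l2norm M f)\<^sup>2 < d N + 1 / real (Suc N)" for N
    using cInf_lessD[OF S_ne, of N "d N + 1 / real (Suc N)"] by (auto simp: S_def d_def)
  then have "\<forall>N. \<exists>f. f \<in> H N \<and> (l2norm M f)\<^sup>2 < d N + 1 / real (Suc N)"
    by blast
  from choice[OF this] obtain W where W: "\<And>N. W N \<in> H N" "\<And>N. (l2norm M (W N))\<^sup>2 < d N + 1 / real (Suc N)"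
    by blast
  have est: "(l2norm M (\<lambda>x. W m x - W n x))\<^sup>2 \<le> 4 * (D - d N) + 4 / real (Suc N)" if mn: "m \<ge> N" "n \<ge> N" for m n N
  proof -
    have mH: "W m \<in> H N" and nH: "W n \<in> H N"
      using W(1) H_anti mn by blast+
    have "(\<lambda>x. (1/2) *\<^sub>R W m x + (1/2) *\<^sub>R W n x) \<in> H N"
      using mH nH unfolding H_def by (rule midpoint_hull.mid)
    then have 1: "d N \<le> (l2norm M (\<lambda>x. (1/2) *\<^sub>R W m x + (1/2) *\<^sub>R W n x))\<^sup>2"
      by (rule d_le)
    have 2: "(l2norm M (\<lambda>x. W m x - W n x))\<^sup>2 = 2 * (l2norm M (W m))\<^sup>2 + 2 * (l2norm M (W n))\<^sup>2
        - 4 * (l2norm M (\<lambda>x. (1/2) *\<^sub>R W m x + (1/2) *\<^sub>R W n x))\<^sup>2"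
      using l2norm_expand[OF H_L2[OF mH] H_L2[OF nH], of 1 "-1"]
        l2norm_expand[OF H_L2[OF mH] H_L2[OF nH], of "1/2" "1/2"]
      by (simp add: power2_eq_square)
    have 3: "(l2norm M (W k))\<^sup>2 \<le> D + 1 / real (Suc N)" if "k \<ge> N" for k
    proof -
      have "1 / real (Suc k) \<le> 1 / real (Suc N)"
        using that by (intro divide_left_mono) auto
      then show ?thesis using W(2)[of k] D(2)[of k] by linarith
    qed
    show ?thesis
      using 1 2 3[OF mn(1)] 3[OF mn(2)] by argo
  qed
  have lim: "(\<lambda>N. 4 * (D - d N) + 4 / real (Suc N)) \<longlonglongrightarrow> 4 * (D - D) + 0"
    by (intro tendsto_intros D LIMSEQ_Suc lim_const_over_n)
  have "\<exists>N. \<forall>m\<ge>N. \<forall>n\<ge>N. l2norm M (\<lambda>x. W m x - W n x) < e" if "e > 0" for e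
  proof -
    have "\<forall>\<^sub>F N in sequentially. 4 * (D - d N) + 4 / real (Suc N) < e\<^sup>2"
      using lim that by (intro order_tendstoD) auto
    then obtain N where N: "4 * (D - d N) + 4 / real (Suc N) < e\<^sup>2"
      by (auto simp: eventually_sequentially)
    have "l2norm M (\<lambda>x. W m x - W n x) < e" if "m \<ge> N" "n \<ge> N" for m n
      using est[OF that] N \<open>e > 0\<close> by (intro power2_less_imp_less[of _ e]) auto
    then show ?thesis by blast
  qed
  then obtain V where V: "V \<in> L2 M" "(\<lambda>N. l2norm M (\<lambda>x. W N x - V x)) \<longlonglongrightarrow> 0"
    using L2_complete[of W M, OF H_L2[OF W(1)]] by blast
  show thesis
    by (rule that[OF _ H_L2[OF W(1)] V]) (use W(1) in \<open>simp add: H_def\<close>)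
qed

text \<open>Lying within \<open>e\<close> of \<open>L\<close> is a convex condition on the value of
  \<open>l\<close>: it holds on a tail of \<open>U\<close> and is inherited by midpoints, hence by
  the whole hull of that tail.\<close>

lemma midpoint_hull_tail_tendsto:
  fixes U :: "nat \<Rightarrow> 'a \<Rightarrow> 'e::real_vector" and l :: "('a \<Rightarrow> 'e) \<Rightarrow> real"
  assumes W: "\<And>N. W N \<in> midpoint_hull (U ` {N..})"
    and U: "\<And>k. U k \<in> S"
    and mid: "\<And>f g. f \<in> S \<Longrightarrow> g \<in> S \<Longrightarrow> (\<lambda>x. (1/2) *\<^sub>R f x + (1/2) *\<^sub>R g x) \<in> S"
    and l: "\<And>f g. f \<in> S \<Longrightarrow> g \<in> S \<Longrightarrow> l (\<lambda>x. (1/2) *\<^sub>R f x + (1/2) *\<^sub>R g x) = (l f + l g) / 2"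
    and lim: "(\<lambda>k. l (U k)) \<longlonglongrightarrow> L"
  shows "(\<lambda>N. l (W N)) \<longlonglongrightarrow> L"
proof (rule LIMSEQ_I)
  fix e :: real assume "e > 0"
  then obtain N where N: "\<And>k. k \<ge> N \<Longrightarrow> \<bar>l (U k) - L\<bar> < e"
    using LIMSEQ_D[OF lim, of e] by auto
  have *: "f \<in> S \<and> \<bar>l f - L\<bar> < e" if "f \<in> midpoint_hull (U ` {n..})" "n \<ge> N" for f n
    using that(1)
  proof induction
    case (base f)
    then show ?case using N U that(2) by auto
  next
    case (mid f g)
    then have fg: "f \<in> S" "g \<in> S" "\<bar>l f - L\<bar> < e" "\<bar>l g - L\<bar> < e"
      by auto
    then have "\<bar>(l f + l g) / 2 - L\<bar> < e" by (auto simp: abs_less_iff field_simps)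
    with assms(3)[OF fg(1,2)] show ?case unfolding l[OF fg(1,2)] by blast
  qed
  show "\<exists>N. \<forall>n\<ge>N. norm (l (W n) - L) < e"
    by (intro exI[of _ N] allI impI) (use *[OF W] in simp)
qed

text \<open>A functional that is the pointwise limit of the bounded functionals obtained by restricting the
  integral to the sets \<open>A R\<close> is continuous (Banach-Steinhaus); the proof is a gliding hump.\<close>

theorem L2_functional_continuous:
  fixes C :: "'a \<Rightarrow> 'e::euclidean_space"
  assumes A: "\<And>R::nat. A R \<in> sets M" "incseq A" "(\<Union>R. A R) = space M"
    and C [measurable]: "C \<in> borel_measurable M"
    and CA: "\<And>R. (\<lambda>x. indicator (A R) x *\<^sub>R C x) \<in> L2 M"
    and H_L2: "\<And>U. U \<in> H \<Longrightarrow> U \<in> L2 M"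
    and H_add: "\<And>U V. U \<in> H \<Longrightarrow> V \<in> H \<Longrightarrow> (\<lambda>x. U x + V x) \<in> H"
    and H_closed: "\<And>U V. (\<And>k::nat. U k \<in> H) \<Longrightarrow> V \<in> L2 M \<Longrightarrow>
        (\<lambda>k. l2norm M (\<lambda>x. U k x - V x)) \<longlonglongrightarrow> 0 \<Longrightarrow> V \<in> H"
    and H_int: "\<And>U. U \<in> H \<Longrightarrow> integrable M (\<lambda>x. C x \<bullet> U x)"
    and D: "\<And>k::nat. D k \<in> H" "(\<lambda>k. l2norm M (D k)) \<longlonglongrightarrow> 0"
    and \<delta>: "\<delta> > 0" "\<And>k. (LINT x|M. C x \<bullet> D k x) \<ge> \<delta>"
  shows False
proof -
  define L where "L U = (LINT x|M. C x \<bullet> U x)" for U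
  define LR where "LR R U = (LINT x|M. (indicator (A R) x *\<^sub>R C x) \<bullet> U x)" for R U
  define n where "n U = l2norm M U" for U :: "'a \<Rightarrow> 'e"
  define \<kappa> where "\<kappa> R = n (\<lambda>x. indicator (A R) x *\<^sub>R C x)" for R
  have n_nonneg [simp]: "n U \<ge> 0" for U by (simp add: n_def)
  have \<kappa>_nonneg [simp]: "\<kappa> R \<ge> 0" for R by (simp add: \<kappa>_def)
  have L_add: "L (\<lambda>x. U x + V x) = L U + L V" if "U \<in> H" "V \<in> H" for U V
    using H_int[OF that(1)] H_int[OF that(2)] by (simp add: L_def inner_add_right)
  have LR_bound: "\<bar>LR R U\<bar> \<le> \<kappa> R * n U" if "U \<in> L2 M" for R U
    unfolding LR_def \<kappa>_def n_def by (rule l2_Cauchy_Schwarz[OF CA that])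
  have LR_diff: "LR R (\<lambda>x. U x - V x) = LR R U - LR R V" if "U \<in> L2 M" "V \<in> L2 M" for R U V
    using L2_inner_integrable[OF CA that(1)] L2_inner_integrable[OF CA that(2)]
    unfolding LR_def inner_diff_right by (rule Bochner_Integration.integral_diff)
  have LR_tendsto: "(\<lambda>R. LR R U) \<longlonglongrightarrow> L U" if "U \<in> H" for U
    unfolding LR_def L_def
  proof (rule integral_dominated_convergence)
    show "(\<lambda>x. C x \<bullet> U x) \<in> borel_measurable M"
      using H_int[OF that] by auto
    show "(\<lambda>x. (indicator (A R) x *\<^sub>R C x) \<bullet> U x) \<in> borel_measurable M" for R
      using L2_inner_integrable[OF CA H_L2[OF that]] by auto
    show "integrable M (\<lambda>x. \<bar>C x \<bullet> U x\<bar>)"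
      using H_int[OF that] by auto
    show "AE x in M. norm ((indicator (A R) x *\<^sub>R C x) \<bullet> U x) \<le> \<bar>C x \<bullet> U x\<bar>" for R
      by (intro AE_I2) (simp add: indicator_def)
    show "AE x in M. (\<lambda>R. (indicator (A R) x *\<^sub>R C x) \<bullet> U x) \<longlonglongrightarrow> C x \<bullet> U x"
    proof (rule AE_I2)
      fix x assume "x \<in> space M"
      then obtain R where R: "x \<in> A R" using A(3) by blast
      have "\<forall>\<^sub>F k in sequentially. (indicator (A k) x *\<^sub>R C x) \<bullet> U x = C x \<bullet> U x"
        using eventually_ge_at_top[of R]
        by eventually_elim (use R A(2) in \<open>auto simp: incseq_def indicator_def\<close>)
      then show "(\<lambda>R. (indicator (A R) x *\<^sub>R C x) \<bullet> U x) \<longlonglongrightarrow> C x \<bullet> U x"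
        by (rule tendsto_eventually)
    qed
  qed
  \<comment> \<open>State of the hump construction: \<open>S\<close> is a partial sum of elements of
    small norm on which \<open>L\<close> has reached (j + 1) times \<open>\<delta>\<close>,
    \<open>R\<close> is a truncation level that sees this value up to \<open>\<delta>\<close>, and
    \<open>K\<close> dominates the norm of the functional truncated there.\<close>
  define P where "P j = (\<lambda>(S, K, R). S \<in> H \<and> L S \<ge> real (Suc j) * \<delta> \<and> \<bar>LR R S - L S\<bar> \<le> \<delta> \<and>
      K \<ge> \<kappa> R)" for j
  \<comment> \<open>The next hump is small relative to \<open>K + 1\<close>. Because of
    \<open>min 1 \<delta>\<close> the humps are summable and, in addition, all later humps together
    change an earlier truncated functional by at most \<open>\<delta>\<close>.\<close>
  define Q where "Q j = (\<lambda>(S, K, R :: nat) (S', K', R' :: nat). K \<le> K' \<and>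
      n (\<lambda>x. S' x - S x) * (K + 1) \<le> (1/2) ^ Suc j * min 1 \<delta>)" for j
  have pick: "\<exists>R. \<bar>LR R S - L S\<bar> \<le> \<delta>" if "S \<in> H" for S
  proof -
    have "\<forall>\<^sub>F R in sequentially. \<bar>LR R S - L S\<bar> < \<delta>"
      using tendstoD[OF LR_tendsto[OF that] \<delta>(1)] by (simp add: dist_real_def)
    then have "\<exists>R. \<bar>LR R S - L S\<bar> < \<delta>" by (rule eventually_happens'[OF sequentially_bot])
    then show ?thesis using less_imp_le by blast
  qed
  have "\<exists>f. \<forall>j. P j (f j) \<and> Q j (f j) (f (Suc j))"
  proof (rule dependent_nat_choice)
    obtain R where "\<bar>LR R (D 0) - L (D 0)\<bar> \<le> \<delta>"
      using pick[OF D(1)] by blast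
    then have "P 0 (D 0, \<kappa> R, R)"
      using D(1)[of 0] \<delta>(2)[of 0] by (simp add: P_def L_def)
    then show "\<exists>s. P 0 s" by blast
  next
    fix s j assume "P j s"
    then obtain S K R where s: "s = (S, K, R)" "S \<in> H" "L S \<ge> real (Suc j) * \<delta>" "K \<ge> \<kappa> R"
      by (auto simp: P_def)
    have K: "K \<ge> 0" using s(4) \<kappa>_nonneg[of R] by linarith
    define e where "e = (1/2) ^ Suc j * min 1 \<delta> / (K + 1)"
    have "e > 0" using K \<delta>(1) by (simp add: e_def)
    then have "\<forall>\<^sub>F k in sequentially. n (D k) < e"
      unfolding n_def using D(2) by (intro order_tendstoD)
    then obtain k where k: "n (D k) < e"
      by (auto simp: eventually_sequentially)
    define S' where "S' = (\<lambda>x. S x + D k x)"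
    have S': "S' \<in> H" unfolding S'_def by (intro H_add s D)
    obtain R' where R': "\<bar>LR R' S' - L S'\<bar> \<le> \<delta>"
      using pick[OF S'] by blast
    have "L S' \<ge> real (Suc (Suc j)) * \<delta>"
      using s(3) \<delta>(2)[of k] L_add[OF s(2) D(1)[of k]] by (simp add: S'_def L_def algebra_simps)
    then have "P (Suc j) (S', max K (\<kappa> R'), R')"
      using S' R' by (simp add: P_def)
    moreover have "n (D k) * (K + 1) \<le> (1/2) ^ Suc j * min 1 \<delta>"
      using k K by (simp add: e_def pos_less_divide_eq) (simp add: algebra_simps)
    then have "Q j s (S', max K (\<kappa> R'), R')"
      by (simp add: Q_def s(1) S'_def)
    ultimately show "\<exists>s'. P (Suc j) s' \<and> Q j s s'" by blast
  qed
  then obtain f where f: "\<And>j. P j (f j)" "\<And>j. Q j (f j) (f (Suc j))" by blast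
  define S where "S j = fst (f j)" for j
  define K where "K j = fst (snd (f j))" for j
  define R where "R j = snd (snd (f j))" for j
  have f_eq: "f j = (S j, K j, R j)" for j by (simp add: S_def K_def R_def)
  have S: "S j \<in> H" and LS: "L (S j) \<ge> real (Suc j) * \<delta>" and LRS: "\<bar>LR (R j) (S j) - L (S j)\<bar> \<le> \<delta>"
    and Kj: "K j \<ge> \<kappa> (R j)" for j
    using f(1)[of j] by (auto simp: P_def f_eq)
  have K_Suc: "K j \<le> K (Suc j)"
    and step: "n (\<lambda>x. S (Suc j) x - S j x) * (K j + 1) \<le> (1/2) ^ Suc j * min 1 \<delta>" for j
    using f(2)[of j] by (auto simp: Q_def f_eq)
  have K_mono: "K i \<le> K j" if "i \<le> j" for i j
    using lift_Suc_mono_le[of K, OF K_Suc that] .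
  have K_nonneg: "K j \<ge> 0" for j using Kj[of j] \<kappa>_nonneg[of "R j"] by linarith
  have S_L2: "S j \<in> L2 M" for j by (rule H_L2[OF S])
  have tail: "n (\<lambda>x. S (j + i) x - S j x) * (K j + 1) \<le> ((1/2) ^ j - (1/2) ^ (j + i)) * min 1 \<delta>" for i j
  proof (induction i)
    case 0
    then show ?case by (simp add: n_def l2norm_def)
  next
    case (Suc i)
    have "n (\<lambda>x. S (j + Suc i) x - S j x) \<le> n (\<lambda>x. S (Suc (j + i)) x - S (j + i) x) + n (\<lambda>x. S (j + i) x - S j x)"
      unfolding n_def using l2norm_triangle_diff[of "S (Suc (j + i))" M "S (j + i)" "S j", OF S_L2 S_L2 S_L2] by simp
    then have "n (\<lambda>x. S (j + Suc i) x - S j x) * (K j + 1) \<le>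
        n (\<lambda>x. S (Suc (j + i)) x - S (j + i) x) * (K j + 1) + n (\<lambda>x. S (j + i) x - S j x) * (K j + 1)"
      using K_nonneg[of j] by (simp add: mult_right_mono flip: distrib_right)
    moreover have "n (\<lambda>x. S (Suc (j + i)) x - S (j + i) x) * (K j + 1) \<le>
        n (\<lambda>x. S (Suc (j + i)) x - S (j + i) x) * (K (j + i) + 1)"
      using K_mono[of j "j + i"] by (intro mult_left_mono) auto
    ultimately have "n (\<lambda>x. S (j + Suc i) x - S j x) * (K j + 1) \<le>
        (1/2) ^ Suc (j + i) * min 1 \<delta> + ((1/2) ^ j - (1/2) ^ (j + i)) * min 1 \<delta>"
      using step[of "j + i"] Suc by linarith
    then show ?case by (simp add: algebra_simps)
  qed
  have tail': "n (\<lambda>x. S m x - S j x) * (K j + 1) \<le> (1/2) ^ j * min 1 \<delta>" if "j \<le> m" for j m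
  proof -
    have "((1/2) ^ j - (1/2) ^ m) * min 1 \<delta> \<le> (1/2) ^ j * min 1 \<delta>"
      using \<delta>(1) by (intro mult_right_mono) auto
    then show ?thesis using tail[of j "m - j"] that by simp
  qed
  have tail1: "n (\<lambda>x. S m x - S j x) \<le> (1/2) ^ j" if "j \<le> m" for j m
  proof -
    have "n (\<lambda>x. S m x - S j x) \<le> n (\<lambda>x. S m x - S j x) * (K j + 1)"
      using mult_left_mono[of 1 "K j + 1" "n (\<lambda>x. S m x - S j x)"] K_nonneg[of j] by simp
    also have "\<dots> \<le> (1/2) ^ j * min 1 \<delta>" by (rule tail'[OF that])
    also have "\<dots> \<le> (1/2) ^ j" by (intro mult_left_le) auto
    finally show ?thesis .
  qed
  have "\<exists>N. \<forall>m\<ge>N. \<forall>k\<ge>N. l2norm M (\<lambda>x. S m x - S k x) < e" if "e > 0" for e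
  proof -
    have "\<forall>\<^sub>F N in sequentially. (1/2) ^ N < e / 2"
      using that by (intro order_tendstoD[OF LIMSEQ_realpow_zero]) auto
    then obtain N where N: "(1/2) ^ N < e / 2"
      by (auto simp: eventually_sequentially)
    have "l2norm M (\<lambda>x. S m x - S k x) < e" if "m \<ge> N" "k \<ge> N" for m k
      using l2norm_triangle_diff[of "S m" M "S N" "S k", OF S_L2 S_L2 S_L2] tail1[OF that(1)] tail1[OF that(2)] N
      by (simp add: n_def l2norm_minus_commute[of M "S N"])
    then show ?thesis by blast
  qed
  from L2_complete[of S M, OF S_L2 this] obtain V where V: "V \<in> L2 M" "(\<lambda>k. l2norm M (\<lambda>x. S k x - V x)) \<longlonglongrightarrow> 0"
    by blast
  have V_H: "V \<in> H" by (rule H_closed[OF S V])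
  have V_tail: "n (\<lambda>x. V x - S j x) * (K j + 1) \<le> \<delta>" for j
  proof (rule tendsto_lowerbound)
    show "(\<lambda>m. \<delta> + l2norm M (\<lambda>x. S m x - V x) * (K j + 1)) \<longlonglongrightarrow> \<delta>"
      using tendsto_add[OF tendsto_const[of \<delta>] tendsto_mult[OF V(2) tendsto_const[of "K j + 1"]]] by simp
    have "n (\<lambda>x. V x - S j x) * (K j + 1) \<le> \<delta> + l2norm M (\<lambda>x. S m x - V x) * (K j + 1)" if "m \<ge> j" for m
    proof -
      have "n (\<lambda>x. V x - S j x) \<le> l2norm M (\<lambda>x. S m x - V x) + n (\<lambda>x. S m x - S j x)"
        using l2norm_triangle_diff[of V M "S m" "S j", OF V(1) S_L2 S_L2] by (simp add: n_def l2norm_minus_commute[of M V])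
      then have "n (\<lambda>x. V x - S j x) * (K j + 1) \<le> l2norm M (\<lambda>x. S m x - V x) * (K j + 1) + n (\<lambda>x. S m x - S j x) * (K j + 1)"
        using K_nonneg[of j] by (simp add: mult_right_mono flip: distrib_right)
      moreover have "(1/2) ^ j * min 1 \<delta> \<le> 1 * \<delta>"
        using \<delta>(1) by (intro mult_mono power_le_one) auto
      ultimately show ?thesis using tail'[OF that] by simp
    qed
    then show "\<forall>\<^sub>F m in sequentially. n (\<lambda>x. V x - S j x) * (K j + 1) \<le> \<delta> + l2norm M (\<lambda>x. S m x - V x) * (K j + 1)"
      by (rule eventually_sequentiallyI)
  qed simp
  \<comment> \<open>One \<open>\<delta>\<close> is lost to the truncation at \<open>S j\<close>, the
    other to the later humps. The truncated values at the single element \<open>V\<close> are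
    therefore unbounded, although they converge.\<close>
  have big: "LR (R j) V \<ge> real (Suc j) * \<delta> - 2 * \<delta>" for j
  proof -
    have "\<bar>LR (R j) (\<lambda>x. V x - S j x)\<bar> \<le> \<kappa> (R j) * n (\<lambda>x. V x - S j x)"
      by (rule LR_bound[OF L2_diff[OF V(1) S_L2]])
    also have "\<dots> \<le> (K j + 1) * n (\<lambda>x. V x - S j x)"
      using Kj[of j] by (intro mult_right_mono) auto
    also have "\<dots> \<le> \<delta>" using V_tail[of j] by (simp add: mult.commute)
    finally show ?thesis
      using LR_diff[OF V(1) S_L2, of "R j" j] LS[of j] LRS[of j] by linarith
  qed
  obtain B where B: "\<And>r. \<bar>LR r V\<bar> \<le> B"
    using convergent_imp_Bseq[OF convergentI[OF LR_tendsto[OF V_H]]] by (auto simp: Bseq_def)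
  obtain j :: nat where j: "real j > (B + 2 * \<delta>) / \<delta>"
    using reals_Archimedean2 by blast
  then have "real j * \<delta> > B + 2 * \<delta>"
    using \<delta>(1) by (simp add: field_simps)
  with big[of j] B[of "R j"] \<delta>(1) show False
    by (simp add: algebra_simps abs_le_iff) 
qed

section \<open>Weak gradients in weighted spaces\<close>

text \<open>Positivity and continuity bound \<open>h\<close> away from 0 and from infinity on every
  ball, which makes L2(\<mu>) and Lebesgue L2 locally equivalent; globally the two norms need not be
  comparable.\<close>

locale continuous_weight =
  fixes h :: "real^'n::finite \<Rightarrow> real"
  assumes h_pos: "h x > 0" and h_cont: "continuous_on UNIV h"
begin

lemma h_measurable [measurable]: "h \<in> borel_measurable borel"
  by (rule borel_measurable_continuous_onI[OF h_cont])

lemma h_bounds: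
  obtains c C where "c > 0" "C > 0" "\<And>x. norm x \<le> r \<Longrightarrow> c \<le> h x" "\<And>x. norm x \<le> r \<Longrightarrow> h x \<le> C"
proof (cases "r \<ge> 0")
  case True
  then have ne: "cball 0 r \<noteq> ({} :: (real^'n) set)" by simp
  have c: "continuous_on (cball 0 r) h" using h_cont continuous_on_subset by blast
  obtain x where x: "\<forall>y\<in>cball 0 r. h x \<le> h y"
    using continuous_attains_inf[OF compact_cball ne c] by blast
  obtain z where z: "\<forall>y\<in>cball 0 r. h y \<le> h z"
    using continuous_attains_sup[OF compact_cball ne c] by blast
  show thesis using that[of "h x" "h z"] h_pos x z by simp
next
  case False
  show thesis
  proof (rule that[of 1 1])
    show "1 \<le> h x" "h x \<le> 1" if "norm x \<le> r" for x
      using False that norm_ge_zero[of x] by linarith+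
  qed auto
qed

abbreviation \<mu> :: "(real^'n) measure" where "\<mu> \<equiv> wmeasure h"

lemma sets_\<mu> [measurable_cong, simp]: "sets \<mu> = sets borel"
  and space_\<mu> [simp]: "space \<mu> = UNIV"
  by (simp_all add: wmeasure_def)

lemma borel_measurable_\<mu> [simp]: "borel_measurable \<mu> = borel_measurable borel"
  by (rule measurable_cong_sets) auto

lemma integrable_\<mu>:
  fixes f :: "real^'n \<Rightarrow> 'b::{banach, second_countable_topology}"
  shows "f \<in> borel_measurable borel \<Longrightarrow> integrable \<mu> f \<longleftrightarrow> integrable lborel (\<lambda>x. h x *\<^sub>R f x)"
  unfolding wmeasure_def using h_pos by (intro integrable_density) (auto intro: less_imp_le)

lemma integral_\<mu>:
  fixes f :: "real^'n \<Rightarrow> 'b::{banach, second_countable_topology}"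
  shows "f \<in> borel_measurable borel \<Longrightarrow> (LINT x|\<mu>. f x) = (LINT x|lborel. h x *\<^sub>R f x)"
  unfolding wmeasure_def using h_pos by (intro integral_density) (auto intro: less_imp_le)

lemma AE_\<mu>: "(AE x in \<mu>. P x) \<longleftrightarrow> (AE x in lborel. P x)"
  unfolding wmeasure_def using h_pos by (subst AE_density) auto

lemma L2_borel: "f \<in> L2 \<mu> \<Longrightarrow> f \<in> borel_measurable borel"
  by (auto simp: L2_def)

lemma integrable_lborel_local:
  fixes g :: "real^'n \<Rightarrow> real"
  assumes g: "integrable \<mu> g" and sp: "\<And>x. norm x > r \<Longrightarrow> g x = 0"
  shows "integrable lborel g"
proof -
  obtain c C where c: "c > 0" "\<And>x. norm x \<le> r \<Longrightarrow> c \<le> h x"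
    by (rule h_bounds[of r]) blast
  have [measurable]: "g \<in> borel_measurable borel"
    using g by (metis borel_measurable_integrable borel_measurable_\<mu>)
  show ?thesis
  proof (rule Bochner_Integration.integrable_bound)
    show "integrable lborel (\<lambda>x. (1 / c) * (h x *\<^sub>R g x))"
      using g by (intro integrable_mult_right) (simp add: integrable_\<mu>)
    have "norm (g x) \<le> norm ((1 / c) * (h x *\<^sub>R g x))" for x
    proof (cases "norm x \<le> r")
      case True
      have "1 \<le> h x / c" using c(2)[OF True] c(1) by simp
      from mult_right_mono[OF this, of "\<bar>g x\<bar>"] show ?thesis
        using c(1) h_pos[of x] by (simp add: abs_mult)
    qed (use sp in simp)
    then show "AE x in lborel. norm (g x) \<le> norm ((1 / c) * (h x *\<^sub>R g x))" by simp
  qed measurable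
qed

lemma bounded_support_L2:
  fixes f :: "real^'n \<Rightarrow> 'e::euclidean_space"
  assumes [measurable]: "f \<in> borel_measurable borel"
    and bd: "\<And>x. norm x \<le> r \<Longrightarrow> norm (f x) \<le> B" and sp: "\<And>x. norm x > r \<Longrightarrow> f x = 0"
  shows "f \<in> L2 \<mu>"
proof -
  have "integrable lborel (\<lambda>x. h x *\<^sub>R (norm (f x))\<^sup>2)"
  proof (rule Bochner_Integration.integrable_bound)
    have "locally_integrable h"
      by (rule locally_integrable_continuous[OF h_cont])
    then show "integrable lborel (\<lambda>x. (if norm x \<le> r then B\<^sup>2 else 0) *\<^sub>R h x)"
      by (rule locally_integrable_scaleR[of _ _ "B\<^sup>2" r]) auto
    have "norm (h x *\<^sub>R (norm (f x))\<^sup>2) \<le> norm ((if norm x \<le> r then B\<^sup>2 else 0) *\<^sub>R h x)" for x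
    proof (cases "norm x \<le> r")
      case True
      have "(norm (f x))\<^sup>2 \<le> B\<^sup>2" using bd[OF True] by (intro power_mono) auto
      with True show ?thesis by (simp add: abs_mult mult_left_mono mult.commute)
    qed (use sp in simp)
    then show "AE x in lborel. norm (h x *\<^sub>R (norm (f x))\<^sup>2) \<le> norm ((if norm x \<le> r then B\<^sup>2 else 0) *\<^sub>R h x)"
      by simp
  qed measurable
  then show ?thesis by (simp add: L2_def integrable_\<mu>)
qed

text \<open>Dividing by \<open>h\<close> converts a Lebesgue pairing with \<open>\<psi>\<close> into
  an inner product of L2(\<mu>), so that distributional pairings become continuous functionals
  there.\<close>

lemma test_over_h_L2:
  assumes [measurable]: "\<psi> \<in> borel_measurable borel"
    and bd: "\<And>x. \<bar>\<psi> x\<bar> \<le> B" and sp: "\<And>x. norm x > r \<Longrightarrow> \<psi> x = 0"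
  shows "(\<lambda>x. (\<psi> x / h x) *\<^sub>R (b :: 'e::euclidean_space)) \<in> L2 \<mu>"
proof -
  obtain c C where c: "c > 0" "\<And>x. norm x \<le> r \<Longrightarrow> c \<le> h x"
    by (rule h_bounds[of r]) blast
  show ?thesis
  proof (rule bounded_support_L2[of _ r "B / c * norm b"])
    show "norm ((\<psi> x / h x) *\<^sub>R b) \<le> B / c * norm b" if "norm x \<le> r" for x
    proof -
      have "\<bar>\<psi> x\<bar> / h x \<le> B / c"
        using c(2)[OF that] c(1) bd[of x] by (intro frac_le) auto
      then have "\<bar>\<psi> x\<bar> / h x * norm b \<le> B / c * norm b"
        by (rule mult_right_mono) simp
      then show ?thesis using h_pos[of x] by simp
    qed
  qed (use sp in auto)
qed

lemma L2_times_bounded_integrable: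
  fixes U :: "real^'n \<Rightarrow> 'e::euclidean_space"
  assumes U: "U \<in> L2 \<mu>" and [measurable]: "\<psi> \<in> borel_measurable borel"
    and bd: "\<And>x. \<bar>\<psi> x\<bar> \<le> B" and sp: "\<And>x. norm x > r \<Longrightarrow> \<psi> x = 0"
  shows "integrable lborel (\<lambda>x. \<psi> x * (U x \<bullet> b))"
    and "(LINT x|lborel. \<psi> x * (U x \<bullet> b)) = (LINT x|\<mu>. U x \<bullet> ((\<psi> x / h x) *\<^sub>R b))"
proof -
  note [measurable] = L2_borel[OF U]
  have i: "integrable \<mu> (\<lambda>x. U x \<bullet> ((\<psi> x / h x) *\<^sub>R b))"
    by (rule L2_inner_integrable[OF U test_over_h_L2[OF _ bd sp]]) simp
  have eq: "h x *\<^sub>R (U x \<bullet> ((\<psi> x / h x) *\<^sub>R b)) = \<psi> x * (U x \<bullet> b)" for x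
    using h_pos[of x] by simp
  show "integrable lborel (\<lambda>x. \<psi> x * (U x \<bullet> b))"
    using i by (subst (asm) integrable_\<mu>) (measurable, simp only: eq)
  show "(LINT x|lborel. \<psi> x * (U x \<bullet> b)) = (LINT x|\<mu>. U x \<bullet> ((\<psi> x / h x) *\<^sub>R b))"
    by (subst integral_\<mu>) (measurable, simp only: eq)
qed

lemma L2_locally_integrable:
  fixes U :: "real^'n \<Rightarrow> 'e::euclidean_space"
  assumes U: "U \<in> L2 \<mu>"
  shows "locally_integrable U"
  unfolding locally_integrable_def set_integrable_def
proof (intro allI impI)
  fix K :: "(real^'n) set" assume K: "compact K"
  then obtain r where r: "\<And>x. x \<in> K \<Longrightarrow> norm x \<le> r"
    by (meson compact_imp_bounded bounded_iff)
  have [measurable]: "K \<in> sets borel" using K by (simp add: borel_compact)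
  have "integrable lborel (\<lambda>x. indicator K x * (U x \<bullet> b))" for b
  proof (rule L2_times_bounded_integrable(1)[OF U, of _ 1 r])
    show "indicator K x = (0::real)" if "norm x > r" for x
      using r[of x] that by (auto simp: indicator_def)
  qed (auto simp: indicator_def)
  then have "integrable lborel (\<lambda>x. \<Sum>b\<in>Basis. (indicator K x * (U x \<bullet> b)) *\<^sub>R b)"
    by (intro Bochner_Integration.integrable_sum integrable_scaleR_left)
  also have "(\<lambda>x. \<Sum>b\<in>Basis. (indicator K x * (U x \<bullet> b)) *\<^sub>R b) = (\<lambda>x. indicator K x *\<^sub>R U x)"
    by (simp flip: scaleR_scaleR scaleR_sum_right add: euclidean_representation)
  finally show "integrable lborel (\<lambda>x. indicator K x *\<^sub>R U x)" .
qed

lemma test_pairing: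
  fixes U :: "real^'n \<Rightarrow> 'e::euclidean_space"
  assumes U: "U \<in> L2 \<mu>" and \<psi>: "\<psi> \<in> test_functions"
  shows "(\<lambda>x. (\<psi> x / h x) *\<^sub>R (b :: 'e)) \<in> L2 \<mu>"
    and "integrable lborel (\<lambda>x. \<psi> x * (U x \<bullet> b))"
    and "(LINT x|lborel. \<psi> x * (U x \<bullet> b)) = (LINT x|\<mu>. U x \<bullet> ((\<psi> x / h x) *\<^sub>R b))"
proof -
  obtain r where r: "\<And>x. norm x > r \<Longrightarrow> \<psi> x = 0"
    using \<psi> by (rule test_functionsE) blast
  obtain B where B: "\<And>x. \<bar>\<psi> x\<bar> \<le> B"
    using \<psi> by (rule test_bounded) blast
  note m = test_measurable[OF \<psi>]
  show "(\<lambda>x. (\<psi> x / h x) *\<^sub>R (b :: 'e)) \<in> L2 \<mu>"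
    by (rule test_over_h_L2[OF m B r])
  show "integrable lborel (\<lambda>x. \<psi> x * (U x \<bullet> b))"
    by (rule L2_times_bounded_integrable(1)[OF U m B r])
  show "(LINT x|lborel. \<psi> x * (U x \<bullet> b)) = (LINT x|\<mu>. U x \<bullet> ((\<psi> x / h x) *\<^sub>R b))"
    by (rule L2_times_bounded_integrable(2)[OF U m B r])
qed

lemma L2_eq_AE_of_pairing:
  fixes U V :: "real^'n \<Rightarrow> 'e::euclidean_space"
  assumes U: "U \<in> L2 \<mu>" and V: "V \<in> L2 \<mu>"
    and eq: "\<And>\<psi> b. \<psi> \<in> test_functions \<Longrightarrow> b \<in> Basis \<Longrightarrow>
      (LINT x|lborel. \<psi> x * (U x \<bullet> b)) = (LINT x|lborel. \<psi> x * (V x \<bullet> b))"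
  shows "AE x in lborel. U x = V x"
proof -
  have "AE x in lborel. (U x - V x) \<bullet> b = 0" if b: "b \<in> Basis" for b
  proof (rule weak_zero_AE)
    have UV: "(\<lambda>x. U x - V x) \<in> L2 \<mu>" by (rule L2_diff[OF U V])
    show "locally_integrable (\<lambda>x. (U x - V x) \<bullet> b)"
      by (rule L2_locally_integrable, rule L2_dominated[OF UV, of _ 1])
         (use L2_borel[OF UV] b in \<open>auto intro: Basis_le_norm\<close>)
    show "(LINT x|lborel. (U x - V x) \<bullet> b * \<psi> x) = 0" if "\<psi> \<in> test_functions" for \<psi>
      using eq[OF that b] test_pairing(2)[OF U that, of b] test_pairing(2)[OF V that, of b]
      by (simp add: inner_diff_left right_diff_distrib mult.commute[of _ "\<psi> _"])
  qed
  then have "AE x in lborel. \<forall>b\<in>Basis. (U x - V x) \<bullet> b = 0"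
    by (intro AE_finite_allI) auto
  then show ?thesis
  proof eventually_elim
    fix x assume "\<forall>b\<in>Basis. (U x - V x) \<bullet> b = 0"
    then have "U x - V x = 0" by (simp only: euclidean_all_zero_iff)
    then show "U x = V x" by simp
  qed
qed

lemma pair_L2_iff:
  fixes f :: "real^'n \<Rightarrow> 'e::euclidean_space" and F :: "real^'n \<Rightarrow> 'f::euclidean_space"
  shows "(\<lambda>x. (f x, F x)) \<in> L2 M \<longleftrightarrow> f \<in> L2 M \<and> F \<in> L2 M"
proof safe
  assume fF: "(\<lambda>x. (f x, F x)) \<in> L2 M"
  have c: "(fst :: 'e \<times> 'f \<Rightarrow> 'e) \<in> borel_measurable borel" "(snd :: 'e \<times> 'f \<Rightarrow> 'f) \<in> borel_measurable borel"
    by (intro borel_measurable_continuous_onI continuous_on_fst continuous_on_snd continuous_on_id)+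
  have m: "f \<in> borel_measurable M" "F \<in> borel_measurable M"
    using measurable_compose[OF L2_measurable[OF fF] c(1)] measurable_compose[OF L2_measurable[OF fF] c(2)]
    by simp_all
  show "f \<in> L2 M" "F \<in> L2 M"
    by (rule L2_dominated[OF fF, of _ 1]; use m norm_fst_le[of "f _" "F _"] norm_snd_le[of "F _" "f _"] in simp)+
next
  assume f: "f \<in> L2 M" and F: "F \<in> L2 M"
  then have "(\<lambda>x. (f x, F x)) \<in> borel_measurable M"
    by (intro borel_measurable_Pair) auto
  with f F show "(\<lambda>x. (f x, F x)) \<in> L2 M"
    by (simp add: L2_def norm_Pair)
qed

text \<open>Elements of \<open>H\<^sup>1(\<mu>)\<close> are handled as pairs of a function and its weak gradient.\<close>

definition graph :: "(real^'n \<Rightarrow> real \<times> (real^'n)) set" where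
  "graph = {U \<in> L2 \<mu>. has_weak_gradient (\<lambda>x. fst (U x)) (\<lambda>x. snd (U x))}"

text \<open>The closure of the test functions in H^1(\<mu>), realised inside the product space of
  functions and gradients.\<close>

definition smooth_graph :: "(real^'n \<Rightarrow> real \<times> (real^'n)) set" where
  "smooth_graph = {U \<in> L2 \<mu>. \<forall>e>0. \<exists>g\<in>test_functions. l2norm \<mu> (\<lambda>x. U x - (g x, grad g x)) < e}"

text \<open>Orthogonality to all the \<open>defect \<phi> i\<close> expresses that the second component is the weak gradient of
  the first.\<close>

definition defect :: "(real^'n \<Rightarrow> real) \<Rightarrow> 'n \<Rightarrow> real^'n \<Rightarrow> real \<times> (real^'n)" where
  "defect \<phi> i x = (partial i \<phi> x / h x) *\<^sub>R (1, 0) + (\<phi> x / h x) *\<^sub>R (0, axis i 1)"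

lemma defect_L2: "\<phi> \<in> test_functions \<Longrightarrow> defect \<phi> i \<in> L2 \<mu>"
proof -
  assume \<phi>: "\<phi> \<in> test_functions"
  have z: "(\<lambda>x. 0 :: real \<times> (real^'n)) \<in> L2 \<mu>" by (simp add: L2_def)
  show ?thesis
    unfolding defect_def[abs_def]
    by (intro L2_add test_pairing(1)[OF z] \<phi> test_partial)
qed

text \<open>Orthogonality in L2(\<mu>) to fixed elements is stable under linear combinations and
  norm limits, so the closure properties of weak gradients can be read off.\<close>

lemma graph_iff: "U \<in> graph \<longleftrightarrow> U \<in> L2 \<mu> \<and> (\<forall>\<phi>\<in>test_functions. \<forall>i. (LINT x|\<mu>. U x \<bullet> defect \<phi> i x) = 0)"
proof (cases "U \<in> L2 \<mu>")
  case U: True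
  then have U': "(\<lambda>x. fst (U x)) \<in> L2 \<mu>" "(\<lambda>x. snd (U x)) \<in> L2 \<mu>"
    using pair_L2_iff[of "\<lambda>x. fst (U x)" "\<lambda>x. snd (U x)"] by auto
  have eq: "(LINT x|\<mu>. U x \<bullet> defect \<phi> i x) =
      (LINT x|lborel. fst (U x) * partial i \<phi> x) + (LINT x|lborel. snd (U x) $ i * \<phi> x)"
    if \<phi>: "\<phi> \<in> test_functions" for \<phi> i
  proof -
    have "(LINT x|\<mu>. U x \<bullet> defect \<phi> i x) =
        (LINT x|\<mu>. U x \<bullet> ((partial i \<phi> x / h x) *\<^sub>R (1, 0))) + (LINT x|\<mu>. U x \<bullet> ((\<phi> x / h x) *\<^sub>R (0, axis i 1)))"
      unfolding defect_def inner_add_right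
      by (intro Bochner_Integration.integral_add L2_inner_integrable U test_pairing(1)[OF U] test_partial \<phi>)
    also have "\<dots> = (LINT x|lborel. partial i \<phi> x * (U x \<bullet> (1, 0))) + (LINT x|lborel. \<phi> x * (U x \<bullet> (0, axis i 1)))"
      by (simp only: test_pairing(3)[OF U test_partial[OF \<phi>]] test_pairing(3)[OF U \<phi>])
    finally show ?thesis
      by (simp add: inner_prod_def inner_axis mult.commute)
  qed
  show ?thesis
    using U L2_locally_integrable[OF U'(1)] L2_locally_integrable[OF U'(2)]
    by (auto simp: graph_def has_weak_gradient_def eq add_eq_0_iff2)
qed (simp add: graph_def)

lemma graph_L2: "U \<in> graph \<Longrightarrow> U \<in> L2 \<mu>"
  by (simp add: graph_def)

lemma graph_add: "U \<in> graph \<Longrightarrow> V \<in> graph \<Longrightarrow> (\<lambda>x. U x + V x) \<in> graph"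
  unfolding graph_iff
  by (simp add: inner_add_left L2_add L2_inner_integrable defect_L2)

lemma graph_scaleR: "U \<in> graph \<Longrightarrow> (\<lambda>x. c *\<^sub>R U x) \<in> graph"
  unfolding graph_iff by (auto simp: L2_scaleR)

lemma graph_closed:
  assumes U: "\<And>k::nat. U k \<in> graph" and V: "V \<in> L2 \<mu>"
    and lim: "(\<lambda>k. l2norm \<mu> (\<lambda>x. U k x - V x)) \<longlonglongrightarrow> 0"
  shows "V \<in> graph"
  unfolding graph_iff
proof (intro conjI ballI allI V)
  fix \<phi> :: "real^'n \<Rightarrow> real" and i assume \<phi>: "\<phi> \<in> test_functions"
  have "(\<lambda>k. LINT x|\<mu>. U k x \<bullet> defect \<phi> i x) \<longlonglongrightarrow> (LINT x|\<mu>. V x \<bullet> defect \<phi> i x)"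
    by (rule l2_inner_tendsto[OF graph_L2[OF U] defect_L2[OF \<phi>] V defect_L2[OF \<phi>] lim]) (simp add: l2norm_def)
  moreover have "(LINT x|\<mu>. U k x \<bullet> defect \<phi> i x) = 0" for k
    using U[of k] \<phi> by (simp add: graph_iff)
  ultimately show "(LINT x|\<mu>. V x \<bullet> defect \<phi> i x) = 0"
    by (simp add: LIMSEQ_const_iff)
qed

lemma pairing_tendsto:
  fixes U :: "nat \<Rightarrow> real^'n \<Rightarrow> 'e::euclidean_space"
  assumes U: "\<And>k. U k \<in> L2 \<mu>" and V: "V \<in> L2 \<mu>"
    and lim: "(\<lambda>k. l2norm \<mu> (\<lambda>x. U k x - V x)) \<longlonglongrightarrow> 0" and \<psi>: "\<psi> \<in> test_functions"
  shows "(\<lambda>k. LINT x|lborel. \<psi> x * (U k x \<bullet> b)) \<longlonglongrightarrow> (LINT x|lborel. \<psi> x * (V x \<bullet> b))"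
proof -
  have "(\<lambda>k. LINT x|\<mu>. U k x \<bullet> ((\<psi> x / h x) *\<^sub>R b)) \<longlonglongrightarrow> (LINT x|\<mu>. V x \<bullet> ((\<psi> x / h x) *\<^sub>R b))"
    by (rule l2_inner_tendsto[OF U test_pairing(1)[OF V \<psi>] V test_pairing(1)[OF V \<psi>] lim]) (simp add: l2norm_def)
  then show ?thesis
    using test_pairing(3)[OF U \<psi>] test_pairing(3)[OF V \<psi>] by simp
qed

text \<open>Pairing with a test function respects midpoints and is norm continuous, so it has the
  same limit along the Mazur combinations as along \<open>U\<close>. This identifies the strong
  limit \<open>V\<close> from distributional data.\<close>

lemma L2_Mazur_pairing:
  fixes U :: "nat \<Rightarrow> real^'n \<Rightarrow> 'e::euclidean_space"
  assumes U: "\<And>k. U k \<in> L2 \<mu>" and bd: "\<And>k. l2norm \<mu> (U k) \<le> K"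
  obtains W V where "\<And>N. W N \<in> midpoint_hull (U ` {N..})" "\<And>N. W N \<in> L2 \<mu>" "V \<in> L2 \<mu>"
    "(\<lambda>N. l2norm \<mu> (\<lambda>x. W N x - V x)) \<longlonglongrightarrow> 0"
    "\<And>\<psi> b L. \<psi> \<in> test_functions \<Longrightarrow> (\<lambda>k. LINT x|lborel. \<psi> x * (U k x \<bullet> b)) \<longlonglongrightarrow> L \<Longrightarrow>
       (LINT x|lborel. \<psi> x * (V x \<bullet> b)) = L"
proof -
  obtain W V where W: "\<And>N. W N \<in> midpoint_hull (U ` {N..})" "\<And>N. W N \<in> L2 \<mu>" "V \<in> L2 \<mu>"
    "(\<lambda>N. l2norm \<mu> (\<lambda>x. W N x - V x)) \<longlonglongrightarrow> 0"
    by (rule L2_Mazur[where U = U, OF U bd]) (rule that)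
  have "(LINT x|lborel. \<psi> x * (V x \<bullet> b)) = L"
    if \<psi>: "\<psi> \<in> test_functions" and lim: "(\<lambda>k. LINT x|lborel. \<psi> x * (U k x \<bullet> b)) \<longlonglongrightarrow> L" for \<psi> b L
  proof (rule LIMSEQ_unique)
    show "(\<lambda>N. LINT x|lborel. \<psi> x * (W N x \<bullet> b)) \<longlonglongrightarrow> (LINT x|lborel. \<psi> x * (V x \<bullet> b))"
      by (rule pairing_tendsto[OF W(2,3,4) \<psi>])
    show "(\<lambda>N. LINT x|lborel. \<psi> x * (W N x \<bullet> b)) \<longlonglongrightarrow> L"
    proof (rule midpoint_hull_tail_tendsto[of W U "L2 \<mu>" "\<lambda>f. LINT x|lborel. \<psi> x * (f x \<bullet> b)", OF W(1) U _ _ lim])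
      fix f g :: "real^'n \<Rightarrow> 'e" assume f: "f \<in> L2 \<mu>" and g: "g \<in> L2 \<mu>"
      show "(\<lambda>x. (1/2) *\<^sub>R f x + (1/2) *\<^sub>R g x) \<in> L2 \<mu>"
        by (intro L2_add L2_scaleR f g)
      show "(LINT x|lborel. \<psi> x * (((1/2) *\<^sub>R f x + (1/2) *\<^sub>R g x) \<bullet> b)) =
          ((LINT x|lborel. \<psi> x * (f x \<bullet> b)) + (LINT x|lborel. \<psi> x * (g x \<bullet> b))) / 2"
        using test_pairing(2)[OF f \<psi>, of b] test_pairing(2)[OF g \<psi>, of b]
        by (simp add: inner_add_left distrib_left)
    qed
  qed
  from W this show thesis by (rule that)
qed

lemma test_graph_L2:
  assumes g: "g \<in> test_functions"
  shows "(\<lambda>x. (g x, grad g x)) \<in> L2 \<mu>"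
proof -
  obtain r where r: "\<And>x. norm x > r \<Longrightarrow> g x = 0" "\<And>x i. norm x > r \<Longrightarrow> partial i g x = 0"
    using g by (rule test_functionsE) blast
  obtain B where B: "\<And>x. \<bar>g x\<bar> \<le> B" using g by (rule test_bounded) blast
  obtain B' where B': "\<And>x. norm (grad g x) \<le> B'" using g by (rule test_grad_bounded) blast
  have "grad g x = 0" if "norm x > r" for x
    using r(2)[OF that] by (simp add: grad_def vec_eq_iff)
  then show ?thesis
    unfolding pair_L2_iff using g r B B'
    by (intro conjI bounded_support_L2[of _ r B] bounded_support_L2[of _ r B']) auto
qed

lemma grad_lin:
  assumes "smooth f" "smooth g"
  shows "grad (\<lambda>x. c * f x + d * g x) x = c *\<^sub>R grad f x + d *\<^sub>R grad g x"
proof -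
  have *: "((\<lambda>x. c * f x + d * g x) has_derivative (\<lambda>z. c * (grad f x \<bullet> z) + d * (grad g x \<bullet> z))) (at x)"
    using assms by (intro derivative_intros has_derivative_grad smooth_differentiable)
  show ?thesis
    by (simp add: grad_def partial_eqI[OF *] vec_eq_iff inner_axis)
qed

lemma smooth_graph_closed:
  assumes U: "\<And>k::nat. U k \<in> smooth_graph" and V: "V \<in> L2 \<mu>"
    and lim: "(\<lambda>k. l2norm \<mu> (\<lambda>x. U k x - V x)) \<longlonglongrightarrow> 0"
  shows "V \<in> smooth_graph"
  unfolding smooth_graph_def
proof (intro CollectI conjI allI impI V)
  fix e :: real assume e: "e > 0"
  have "\<forall>\<^sub>F k in sequentially. l2norm \<mu> (\<lambda>x. U k x - V x) < e / 2"
    using lim e by (intro order_tendstoD) auto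
  then obtain k where k: "l2norm \<mu> (\<lambda>x. U k x - V x) < e / 2"
    by (auto simp: eventually_sequentially)
  obtain g where g: "g \<in> test_functions" "l2norm \<mu> (\<lambda>x. U k x - (g x, grad g x)) < e / 2"
    using U[of k] half_gt_zero[OF e] unfolding smooth_graph_def by blast
  have "U k \<in> L2 \<mu>" using U[of k] by (simp add: smooth_graph_def)
  from l2norm_triangle_diff[OF V this test_graph_L2[OF g(1)]] k g(2)
  have "l2norm \<mu> (\<lambda>x. V x - (g x, grad g x)) < e"
    by (simp add: l2norm_minus_commute[of \<mu> V])
  with g(1) show "\<exists>g\<in>test_functions. l2norm \<mu> (\<lambda>x. V x - (g x, grad g x)) < e" by blast
qed

lemma smooth_graph_mid:
  assumes U: "U \<in> smooth_graph" and V: "V \<in> smooth_graph"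
  shows "(\<lambda>x. (1/2) *\<^sub>R U x + (1/2) *\<^sub>R V x) \<in> smooth_graph"
  unfolding smooth_graph_def
proof (intro CollectI conjI allI impI)
  have L: "U \<in> L2 \<mu>" "V \<in> L2 \<mu>" using U V by (auto simp: smooth_graph_def)
  show "(\<lambda>x. (1/2) *\<^sub>R U x + (1/2) *\<^sub>R V x) \<in> L2 \<mu>" by (intro L2_add L2_scaleR L)
  fix e :: real assume e: "e > 0"
  obtain f where f: "f \<in> test_functions" "l2norm \<mu> (\<lambda>x. U x - (f x, grad f x)) < e"
    using U e by (auto simp: smooth_graph_def)
  obtain g where g: "g \<in> test_functions" "l2norm \<mu> (\<lambda>x. V x - (g x, grad g x)) < e"
    using V e by (auto simp: smooth_graph_def)
  let ?k = "\<lambda>x. f x * (1/2) + g x * (1/2)"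
  have k: "?k \<in> test_functions"
    by (intro test_add test_smooth_mult f g smooth_const)
  have gr: "grad ?k x = (1/2) *\<^sub>R grad f x + (1/2) *\<^sub>R grad g x" for x
    using grad_lin[of f g "1/2" "1/2" x] f(1) g(1) by (simp add: test_functions_iff mult.commute)
  have eq: "((1/2) *\<^sub>R U x + (1/2) *\<^sub>R V x) - (?k x, grad ?k x) =
      (1/2) *\<^sub>R (U x - (f x, grad f x)) + (1/2) *\<^sub>R (V x - (g x, grad g x))" for x
    unfolding gr by (simp add: prod_eq_iff algebra_simps)
  have "l2norm \<mu> (\<lambda>x. ((1/2) *\<^sub>R U x + (1/2) *\<^sub>R V x) - (?k x, grad ?k x)) \<le>
     l2norm \<mu> (\<lambda>x. (1/2) *\<^sub>R (U x - (f x, grad f x))) + l2norm \<mu> (\<lambda>x. (1/2) *\<^sub>R (V x - (g x, grad g x)))"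
    unfolding eq by (intro l2norm_triangle L2_scaleR L2_diff L test_graph_L2 f g)
  also have "\<dots> < e" using f(2) g(2) by (simp add: l2norm_scaleR)
  finally show "\<exists>k\<in>test_functions. l2norm \<mu> (\<lambda>x. ((1/2) *\<^sub>R U x + (1/2) *\<^sub>R V x) - (k x, grad k x)) < e"
    by (intro bexI[of _ ?k] k)
qed

text \<open>\<open>smooth_graph\<close> is convex and closed: Mazur's combinations stay in it, and
  their strong limit agrees with \<open>V\<close> almost everywhere because pairings with test
  functions separate points of L2(\<mu>).\<close>

lemma smooth_graph_weak_limit:
  assumes U: "\<And>k::nat. U k \<in> smooth_graph" and bd: "\<And>k. l2norm \<mu> (U k) \<le> K" and V: "V \<in> L2 \<mu>"
    and lim: "\<And>\<psi> b. \<psi> \<in> test_functions \<Longrightarrow> b \<in> Basis \<Longrightarrow>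
      (\<lambda>k. LINT x|lborel. \<psi> x * (U k x \<bullet> b)) \<longlonglongrightarrow> (LINT x|lborel. \<psi> x * (V x \<bullet> b))"
  shows "V \<in> smooth_graph"
proof -
  have U_L2: "U k \<in> L2 \<mu>" for k using U[of k] by (simp add: smooth_graph_def)
  obtain W V' where W: "\<And>N. W N \<in> midpoint_hull (U ` {N..})" "\<And>N. W N \<in> L2 \<mu>" "V' \<in> L2 \<mu>"
    "(\<lambda>N. l2norm \<mu> (\<lambda>x. W N x - V' x)) \<longlonglongrightarrow> 0"
    "\<And>\<psi> b L. \<psi> \<in> test_functions \<Longrightarrow> (\<lambda>k. LINT x|lborel. \<psi> x * (U k x \<bullet> b)) \<longlonglongrightarrow> L \<Longrightarrow>
       (LINT x|lborel. \<psi> x * (V' x \<bullet> b)) = L"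
    by (rule L2_Mazur_pairing[where U = U, OF U_L2 bd]) (rule that)
  have "AE x in lborel. V' x = V x"
    by (rule L2_eq_AE_of_pairing[OF W(3) V]) (rule W(5)[OF _ lim])
  then have AE: "AE x in \<mu>. V' x = V x" by (simp add: AE_\<mu>)
  have "l2norm \<mu> (\<lambda>x. W N x - V' x) = l2norm \<mu> (\<lambda>x. W N x - V x)" for N
    unfolding l2norm_def
  proof (rule arg_cong[of _ _ sqrt], rule integral_cong_AE)
    show "AE x in \<mu>. (norm (W N x - V' x))\<^sup>2 = (norm (W N x - V x))\<^sup>2"
      using AE by eventually_elim simp
  qed (rule borel_measurable_integrable[OF L2_integrable[OF L2_diff[OF W(2,3)]]]
      borel_measurable_integrable[OF L2_integrable[OF L2_diff[OF W(2) V]]])+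
  then have "(\<lambda>N. l2norm \<mu> (\<lambda>x. W N x - V x)) \<longlonglongrightarrow> 0" using W(4) by simp
  moreover have "f \<in> smooth_graph" if "f \<in> midpoint_hull (U ` {N..})" for f N
    using that
  proof induction
    case (base f)
    then show ?case using U by blast
  next
    case (mid f g)
    show ?case by (rule smooth_graph_mid[OF mid.IH])
  qed
  ultimately show ?thesis
    using smooth_graph_closed[of W V] W(1) V by blast
qed


text \<open>Closedness of \<open>graph\<close>, applied to a constant sequence at distance 0, gives
  invariance under changes on null sets.\<close>

lemma graph_eqI_AE:
  fixes U V :: "real^'n \<Rightarrow> real \<times> (real^'n)"
  assumes "U \<in> graph" "V \<in> L2 \<mu>" "AE x in lborel. U x = V x"
  shows "V \<in> graph"
proof (rule graph_closed)
  show "U \<in> graph" for k :: nat by fact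
  have "l2norm \<mu> (\<lambda>x. U x - V x) = 0"
  proof -
    have "AE x in \<mu>. (norm (U x - V x))\<^sup>2 = 0"
      unfolding AE_\<mu> using assms(3) by eventually_elim simp
    from integral_eq_zero_AE[OF this] show ?thesis
      by (simp add: l2norm_def)
  qed
  then show "(\<lambda>k::nat. l2norm \<mu> (\<lambda>x. U x - V x)) \<longlonglongrightarrow> 0" by simp
qed fact

lemma norm_product_rule_le:
  fixes w :: "real \<times> 'a::real_normed_vector"
  assumes s: "\<bar>s\<bar> \<le> B" and y: "norm y \<le> B'"
  shows "norm (s * fst w, s *\<^sub>R snd w + fst w *\<^sub>R y) \<le> (2 * B + B') * norm w"
proof -
  have B0: "B \<ge> 0" "B' \<ge> 0"
    using s y by (meson abs_ge_zero norm_ge_zero order_trans)+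
  have "norm (s * fst w, s *\<^sub>R snd w + fst w *\<^sub>R y) \<le> norm (s * fst w) + norm (s *\<^sub>R snd w + fst w *\<^sub>R y)"
    by (rule norm_Pair_le)
  also have "norm (s *\<^sub>R snd w + fst w *\<^sub>R y) \<le> \<bar>s\<bar> * norm (snd w) + \<bar>fst w\<bar> * norm y"
    by (rule order_trans[OF norm_triangle_ineq]) simp
  also have "norm (s * fst w) \<le> B * norm w"
    using mult_mono[OF s norm_fst_le[of "fst w" "snd w"] B0(1)] by (simp add: abs_mult)
  also have "\<bar>s\<bar> * norm (snd w) \<le> B * norm w"
    using mult_mono[OF s norm_snd_le[of "snd w" "fst w"] B0(1)] by simp
  also have "\<bar>fst w\<bar> * norm y \<le> B' * norm w"
    using mult_mono[OF y norm_fst_le[of "fst w" "snd w"] B0(2)] by (simp add: mult.commute)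
  finally show ?thesis by (simp add: algebra_simps)
qed

text \<open>Leibniz rule, by testing the weak gradient of \<open>U\<close> with the product of
  \<open>\<theta>\<close> and the given test function. The norm bound sees \<open>\<theta>\<close>
  through the bounds \<open>B\<close> and \<open>B'\<close> only, hence is uniform over a family of
  cut-offs.\<close>

lemma graph_mult_test:
  assumes U: "U \<in> graph" and \<theta>: "\<theta> \<in> test_functions"
  shows "(\<lambda>x. (\<theta> x * fst (U x), \<theta> x *\<^sub>R snd (U x) + fst (U x) *\<^sub>R grad \<theta> x)) \<in> graph"
    and "(\<And>x. \<bar>\<theta> x\<bar> \<le> B) \<Longrightarrow> (\<And>x. norm (grad \<theta> x) \<le> B') \<Longrightarrow>
      l2norm \<mu> (\<lambda>x. (\<theta> x * fst (U x), \<theta> x *\<^sub>R snd (U x) + fst (U x) *\<^sub>R grad \<theta> x)) \<le> (2 * B + B') * l2norm \<mu> U"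
proof -
  let ?V = "\<lambda>x. (\<theta> x * fst (U x), \<theta> x *\<^sub>R snd (U x) + fst (U x) *\<^sub>R grad \<theta> x)"
  have L: "U \<in> L2 \<mu>" by (rule graph_L2[OF U])
  have c: "(fst :: real \<times> (real^'n) \<Rightarrow> real) \<in> borel_measurable borel" "(snd :: real \<times> (real^'n) \<Rightarrow> (real^'n)) \<in> borel_measurable borel"
    by (intro borel_measurable_continuous_onI continuous_on_fst continuous_on_snd continuous_on_id)+
  have [measurable]: "(\<lambda>x. fst (U x)) \<in> borel_measurable borel" "(\<lambda>x. snd (U x)) \<in> borel_measurable borel"
    using measurable_compose[OF L2_borel[OF L] c(1)] measurable_compose[OF L2_borel[OF L] c(2)] .
  have [measurable]: "\<theta> \<in> borel_measurable borel" "grad \<theta> \<in> borel_measurable borel"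
    by (rule test_measurable[OF \<theta>], rule test_grad_measurable[OF \<theta>])
  have est: "norm (?V x) \<le> (2 * B + B') * norm (U x)"
    if "\<And>x. \<bar>\<theta> x\<bar> \<le> B" "\<And>x. norm (grad \<theta> x) \<le> B'" for B B' x
    by (rule norm_product_rule_le[OF that])
  obtain B where B: "\<And>x. \<bar>\<theta> x\<bar> \<le> B" using \<theta> by (rule test_bounded) blast
  obtain B' where B': "\<And>x. norm (grad \<theta> x) \<le> B'" using \<theta> by (rule test_grad_bounded) blast
  have V: "?V \<in> L2 \<mu>"
    by (rule L2_dominated[OF L, of _ "2 * B + B'"]) (use est[OF B B'] in auto)
  show "l2norm \<mu> ?V \<le> (2 * B + B') * l2norm \<mu> U"
    if BB: "\<And>x. \<bar>\<theta> x\<bar> \<le> B" "\<And>x. norm (grad \<theta> x) \<le> B'" for B B'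
  proof (rule l2norm_mono_AE[OF V L])
    have "0 \<le> \<bar>\<theta> 0\<bar>" "0 \<le> norm (grad \<theta> 0)" by auto
    with BB(1)[of 0] BB(2)[of 0] show "0 \<le> 2 * B + B'" by linarith
  qed (use est[OF BB] in simp)
  have lU: "locally_integrable (\<lambda>x. fst (U x))" "locally_integrable (\<lambda>x. snd (U x))"
    and wU: "\<And>\<phi> i. \<phi> \<in> test_functions \<Longrightarrow>
        (LINT x|lborel. fst (U x) * partial i \<phi> x) = - (LINT x|lborel. snd (U x) $ i * \<phi> x)"
    using U by (auto simp: graph_def has_weak_gradient_def)
  have lV: "locally_integrable (\<lambda>x. fst (?V x))" "locally_integrable (\<lambda>x. snd (?V x))"
    using V pair_L2_iff[of "\<lambda>x. fst (?V x)" "\<lambda>x. snd (?V x)" \<mu>] by (auto intro!: L2_locally_integrable)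
  have "(LINT x|lborel. fst (?V x) * partial i \<phi> x) = - (LINT x|lborel. snd (?V x) $ i * \<phi> x)"
    if \<phi>: "\<phi> \<in> test_functions" for \<phi> i
  proof -
    have sm: "smooth \<phi>" "smooth \<theta>" using \<phi> \<theta> by (auto simp: test_functions_iff)
    have t: "(\<lambda>x. \<theta> x * \<phi> x) \<in> test_functions" "(\<lambda>x. \<phi> x * partial i \<theta> x) \<in> test_functions"
      "(\<lambda>x. \<theta> x * partial i \<phi> x) \<in> test_functions"
      by (intro test_smooth_mult \<phi> \<theta> sm smooth_partial)+
    have p: "partial i (\<lambda>x. \<theta> x * \<phi> x) x = \<theta> x * partial i \<phi> x + \<phi> x * partial i \<theta> x" for x
      using partial_mult[OF smooth_differentiable[OF sm(2)] smooth_differentiable[OF sm(1)]] by (simp add: mult.commute)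
    have l: "locally_integrable (\<lambda>x. snd (U x) $ i)" by (rule locally_integrable_vec_nth[OF lU(2)])
    note i1 = locally_integrable_mult_test[OF lU(1) t(2)] locally_integrable_mult_test[OF lU(1) t(3)]
      locally_integrable_mult_test[OF l t(1)]
    have "(LINT x|lborel. fst (U x) * (\<theta> x * partial i \<phi> x + \<phi> x * partial i \<theta> x)) = - (LINT x|lborel. snd (U x) $ i * (\<theta> x * \<phi> x))"
      using wU[OF t(1), of i] unfolding p .
    then have "(LINT x|lborel. fst (U x) * (\<theta> x * partial i \<phi> x)) =
        - ((LINT x|lborel. snd (U x) $ i * (\<theta> x * \<phi> x)) + (LINT x|lborel. fst (U x) * (\<phi> x * partial i \<theta> x)))"
      using i1 by (simp add: distrib_left)
    also have "\<dots> = - (LINT x|lborel. snd (U x) $ i * (\<theta> x * \<phi> x) + fst (U x) * (\<phi> x * partial i \<theta> x))"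
      using i1 by simp
    finally show ?thesis by (simp add: grad_def algebra_simps)
  qed
  with V lV show "?V \<in> graph" by (simp add: graph_def has_weak_gradient_def)
qed

end

section \<open>Convolution with a test function\<close>

definition convolve :: "(real^'n::finite \<Rightarrow> real) \<Rightarrow> (real^'n \<Rightarrow> real) \<Rightarrow> real^'n \<Rightarrow> real" where
  "convolve f \<eta> x = (LINT y|lborel. f y * \<eta> (x - y))"

text \<open>As a function of \<open>y\<close> the kernel is itself a test function and can be
  inserted in the definition of the weak gradient; the sign produced by the reflection cancels the
  one from integration by parts.\<close>

lemma test_reflect:
  assumes "\<eta> \<in> test_functions"
  shows "(\<lambda>y. \<eta> (x - y)) \<in> test_functions"
    and "partial i (\<lambda>y. \<eta> (x - y)) y = - partial i \<eta> (x - y)"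
  using test_affine[OF assms, of "-1" x] partial_affine[of \<eta> "-1" y x i] assms
  by (auto simp: test_functions_iff smooth_differentiable)

lemma integrable_mult_test:
  assumes "integrable lborel f" "\<eta> \<in> test_functions"
  shows "integrable lborel (\<lambda>y. f y * \<eta> (x - y))"
proof -
  obtain B where B: "\<And>x. \<bar>\<eta> x\<bar> \<le> B" using assms(2) by (rule test_bounded) blast
  note [measurable] = test_measurable[OF assms(2)]
  have "norm (f y * \<eta> (x - y)) \<le> norm (B * f y)" for y
  proof -
    have "\<bar>\<eta> (x - y)\<bar> \<le> \<bar>B\<bar>" using B[of "x - y"] by linarith
    then show ?thesis by (simp add: abs_mult mult.commute[of "\<bar>B\<bar>"] mult_left_mono)
  qed
  then show ?thesis
    by (intro Bochner_Integration.integrable_bound[OF integrable_mult_right[OF assms(1), of B]])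
       (use assms(1) in auto)
qed

text \<open>Differentiation under the integral sign: the first-order remainder of
  \<open>\<eta>\<close> is uniform in its base point, so integrating it against \<open>f\<close>
  costs a factor no larger than the L1 norm of \<open>f\<close>.\<close>

lemma convolve_has_derivative:
  assumes f: "integrable lborel f" and \<eta>: "\<eta> \<in> test_functions"
  shows "(convolve f \<eta> has_derivative (\<lambda>z. (\<chi> i. convolve f (partial i \<eta>) x) \<bullet> z)) (at x)"
  unfolding has_derivative_within
proof (intro conjI bounded_linear_inner_right)
  have L: "(\<chi> i. convolve f (partial i \<eta>) x) \<bullet> z = (LINT y|lborel. f y * (grad \<eta> (x - y) \<bullet> z))" for z
  proof -
    have "(\<chi> i. convolve f (partial i \<eta>) x) \<bullet> z = (\<Sum>i\<in>UNIV. (LINT y|lborel. f y * partial i \<eta> (x - y) * z $ i))"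
      by (simp add: inner_vec_def convolve_def)
    also have "\<dots> = (LINT y|lborel. (\<Sum>i\<in>UNIV. f y * partial i \<eta> (x - y) * z $ i))"
      by (intro Bochner_Integration.integral_sum[symmetric] integrable_mult_left integrable_mult_test f test_partial \<eta>)
    finally show ?thesis
      by (simp add: inner_vec_def grad_def sum_distrib_left mult.assoc)
  qed
  have gi: "integrable lborel (\<lambda>y. f y * (grad \<eta> (x - y) \<bullet> z))" for z
  proof -
    have "integrable lborel (\<lambda>y. \<Sum>i\<in>UNIV. f y * partial i \<eta> (x - y) * z $ i)"
      by (intro Bochner_Integration.integrable_sum integrable_mult_left integrable_mult_test f test_partial \<eta>)
    then show ?thesis by (simp add: inner_vec_def grad_def sum_distrib_left mult.assoc)
  qed
  define A where "A = (LINT y|lborel. \<bar>f y\<bar>)"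
  have A: "A \<ge> 0" by (simp add: A_def)
  show "((\<lambda>y. (1 / norm (y - x)) *\<^sub>R (convolve f \<eta> y - (convolve f \<eta> x + (\<chi> i. convolve f (partial i \<eta>) x) \<bullet> (y - x)))) \<longlongrightarrow> 0) (at x)"
  proof (rule tendstoI)
    fix e :: real assume e: "e > 0"
    define e' where "e' = e / (2 * (A + 1))"
    have e': "e' > 0" using e A by (simp add: e'_def)
    obtain d where d: "d > 0" "\<And>x z. norm z < d \<Longrightarrow> \<bar>\<eta> (x + z) - \<eta> x - grad \<eta> x \<bullet> z\<bar> \<le> e' * norm z"
      using test_uniformly_differentiable[OF \<eta> e'] by blast
    have "dist ((1 / norm (y - x)) *\<^sub>R (convolve f \<eta> y - (convolve f \<eta> x + (\<chi> i. convolve f (partial i \<eta>) x) \<bullet> (y - x)))) 0 < e"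
      if y: "y \<noteq> x" "dist y x < d" for y
    proof -
      define z where "z = y - x"
      have z: "norm z < d" "norm z > 0" using y by (auto simp: z_def dist_norm)
      have "convolve f \<eta> y - (convolve f \<eta> x + (\<chi> i. convolve f (partial i \<eta>) x) \<bullet> (y - x)) =
          (LINT w|lborel. f w * (\<eta> ((x - w) + z) - \<eta> (x - w) - grad \<eta> (x - w) \<bullet> z))"
      proof -
        have eq: "f w * (\<eta> ((x - w) + z) - \<eta> (x - w) - grad \<eta> (x - w) \<bullet> z) =
            f w * \<eta> (y - w) - f w * \<eta> (x - w) - f w * (grad \<eta> (x - w) \<bullet> z)" for w
          by (simp add: z_def right_diff_distrib)
        show ?thesis
          unfolding eq z_def[symmetric] L convolve_def[of f \<eta>]
          using integrable_mult_test[OF f \<eta>, of y] integrable_mult_test[OF f \<eta>, of x] gi[of z]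
          by simp
      qed
      also have "\<bar>\<dots>\<bar> \<le> (LINT w|lborel. \<bar>f w\<bar> * (e' * norm z))"
      proof (rule order_trans[OF integral_abs_bound integral_mono'])
        show "integrable lborel (\<lambda>w. \<bar>f w\<bar> * (e' * norm z))"
          using f by (intro integrable_mult_left) auto
        show "\<bar>f w * (\<eta> ((x - w) + z) - \<eta> (x - w) - grad \<eta> (x - w) \<bullet> z)\<bar> \<le> \<bar>f w\<bar> * (e' * norm z)" for w
          unfolding abs_mult by (intro mult_left_mono d z) simp
      qed (use e' in simp)
      also have "\<dots> = A * e' * norm z" by (simp add: A_def)
      finally have "\<bar>convolve f \<eta> y - (convolve f \<eta> x + (\<chi> i. convolve f (partial i \<eta>) x) \<bullet> (y - x))\<bar> / norm z \<le> A * e'"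
        using z by (simp add: divide_le_eq)
      also have "A * e' < e"
        using e A by (simp add: e'_def field_simps) (smt (verit) mult_nonneg_nonneg)
      finally show ?thesis by (simp add: z_def dist_norm abs_mult divide_inverse mult.commute)
    qed
    then show "\<forall>\<^sub>F y in at x. dist ((1 / norm (y - x)) *\<^sub>R (convolve f \<eta> y - (convolve f \<eta> x + (\<chi> i. convolve f (partial i \<eta>) x) \<bullet> (y - x)))) 0 < e"
      using d(1) by (auto simp: eventually_at)
  qed
qed

lemma partial_convolve:
  assumes "integrable lborel f" "\<eta> \<in> test_functions"
  shows "partial i (convolve f \<eta>) = convolve f (partial i \<eta>)"
  by (rule ext) (simp add: partial_eqI[OF convolve_has_derivative[OF assms]] inner_axis)

text \<open>Every derivative falls on the kernel, so the induction runs over all kernels with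
  \<open>f\<close> fixed.\<close>

lemma smooth_convolve:
  assumes f: "integrable lborel f" and \<eta>: "\<eta> \<in> test_functions"
  shows "smooth (convolve f \<eta>)"
proof -
  have "C_k k (convolve f \<eta>)" for k
    using \<eta>
  proof (induction k arbitrary: \<eta>)
    case 0
    show ?case
      using has_derivative_continuous[OF convolve_has_derivative[OF f 0]]
      by (simp add: continuous_on_eq_continuous_at)
  next
    case (Suc k)
    show ?case
      using convolve_has_derivative[OF f Suc.prems] Suc.IH[OF test_partial[OF Suc.prems]]
      by (auto simp: partial_convolve[OF f Suc.prems] differentiable_def)
  qed
  then show ?thesis by (simp add: smooth_def)
qed

lemma convolve_eq_0:
  assumes "\<And>y. norm y > r \<Longrightarrow> f y = 0" "\<And>y. norm y > s \<Longrightarrow> \<eta> y = 0" "norm x > r + s"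
  shows "convolve f \<eta> x = 0"
proof -
  have "f y * \<eta> (x - y) = 0" for y
  proof (cases "norm y > r")
    case False
    have "norm x \<le> norm y + norm (x - y)" by (metis norm_triangle_sub)
    with False assms(3) have "norm (x - y) > s" by linarith
    with assms(2) show ?thesis by simp
  qed (use assms(1) in simp)
  then have "(\<lambda>y. f y * \<eta> (x - y)) = (\<lambda>_. 0)" by (rule ext)
  then show ?thesis unfolding convolve_def by simp
qed

section \<open>Density of test functions\<close>

text \<open>The case \<open>s = 1\<close> is translation and \<open>s = -1\<close> reflection
  invariance, the two changes of variable that convolutions require.\<close>

lemma lborel_distr_isometry:
  fixes t :: "'a::euclidean_space"
  assumes "\<bar>s\<bar> = 1"
  shows "distr lborel borel (\<lambda>x. t + s *\<^sub>R x) = lborel"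
proof -
  have "s \<noteq> 0" using assms by auto
  from lborel_affine[OF this, of t] assms show ?thesis
    by (simp add: density_1)
qed

lemma integral_shift:
  fixes k :: "'a::euclidean_space \<Rightarrow> real"
  assumes [measurable]: "k \<in> borel_measurable borel"
  shows "(LINT x|lborel. k (x - y)) = (LINT x|lborel. k x)"
    and "integrable lborel (\<lambda>x. k (x - y)) \<longleftrightarrow> integrable lborel k"
    and "(LINT x|lborel. k (y - x)) = (LINT x|lborel. k x)"
    and "integrable lborel (\<lambda>x. k (y - x)) \<longleftrightarrow> integrable lborel k"
proof -
  note d = lborel_distr_isometry[of 1 "- y"] lborel_distr_isometry[of "-1" y]
  show "(LINT x|lborel. k (x - y)) = (LINT x|lborel. k x)"
    by (subst (2) d(1)[symmetric], simp, subst integral_distr) auto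
  show "integrable lborel (\<lambda>x. k (x - y)) \<longleftrightarrow> integrable lborel k"
    by (subst (2) d(1)[symmetric], simp, subst integrable_distr_eq) auto
  show "(LINT x|lborel. k (y - x)) = (LINT x|lborel. k x)"
    by (subst (2) d(2)[symmetric], simp, subst integral_distr) auto
  show "integrable lborel (\<lambda>x. k (y - x)) \<longleftrightarrow> integrable lborel k"
    by (subst (2) d(2)[symmetric], simp, subst integrable_distr_eq) auto
qed

lemma test_integrable: "\<eta> \<in> test_functions \<Longrightarrow> integrable lborel \<eta>"
  using locally_integrable_mult_test[of "\<lambda>_. 1" \<eta>] locally_integrable_continuous[of "\<lambda>_. 1 :: real"] by simp

text \<open>The kernels are normalised bumps on cubes of half-side 1/(k + 1); bounding the Euclidean
  norm by the l1 norm yields the support radius.\<close>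

lemma mollifier_exists:
  obtains \<eta> :: "nat \<Rightarrow> real^'n::finite \<Rightarrow> real"
  where "\<And>k. \<eta> k \<in> test_functions" "\<And>k x. \<eta> k x \<ge> 0" "\<And>k. (LINT x|lborel. \<eta> k x) = 1"
    "\<And>k x. norm x > real CARD('n) / real (Suc k) \<Longrightarrow> \<eta> k x = 0"
proof -
  define e :: "nat \<Rightarrow> real^'n" where "e k = (\<chi> i. 1 / real (Suc k))" for k
  define b where "b k = bump (- e k) (e k)" for k
  define I where "I k = (LINT x|lborel. b k x)" for k
  have b: "b k \<in> test_functions" "b k x \<ge> 0" "b k x > 0 \<longleftrightarrow> x \<in> box (- e k) (e k)" for k x
    by (auto simp: b_def bump_test bump_nonneg bump_pos_iff)
  have I: "I k > 0" for k
  proof -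
    have "I k \<noteq> 0"
    proof
      assume "I k = 0"
      then have "AE x in lborel. b k x = 0"
        using integral_nonneg_eq_0_iff_AE[OF test_integrable[OF b(1)]] b(2) by (simp add: I_def)
      then have "AE x in lborel. x \<notin> box (- e k) (e k)"
        by eventually_elim (use b(3) in force)
      then have "emeasure lborel (box (- e k) (e k)) = 0"
        by (subst (asm) AE_iff_measurable[OF _ refl]) auto
      moreover have "emeasure lborel (box (- e k) (e k)) > 0"
        by (subst emeasure_lborel_box) (auto simp: e_def Basis_vec_def inner_axis intro!: prod_pos)
      ultimately show False by simp
    qed
    moreover have "I k \<ge> 0" unfolding I_def using b(2) by simp
    ultimately show ?thesis by linarith
  qed
  show thesis
  proof (rule that[of "\<lambda>k x. b k x * (1 / I k)"])
    show "(\<lambda>x. b k x * (1 / I k)) \<in> test_functions" for k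
      by (intro test_smooth_mult b smooth_const)
    show "b k x * (1 / I k) \<ge> 0" for k x
      using b(2)[of k x] I[of k] by simp
    show "(LINT x|lborel. b k x * (1 / I k)) = 1" for k
      using I[of k] by (simp add: I_def)
    show "b k x * (1 / I k) = 0" if "norm x > real CARD('n) / real (Suc k)" for k x
    proof -
      have "x \<notin> box (- e k) (e k)"
      proof
        assume "x \<in> box (- e k) (e k)"
        then have "\<bar>x $ i\<bar> \<le> 1 / real (Suc k)" for i
          by (auto simp: mem_box_cart e_def abs_le_iff intro: less_imp_le dest!: spec[of _ i])
        then have "(\<Sum>i\<in>UNIV. \<bar>x $ i\<bar>) \<le> (\<Sum>i\<in>(UNIV :: 'n set). 1 / real (Suc k))"
          by (intro sum_mono)
        with norm_le_l1_cart[of x] that show False by simp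
      qed
      then have "b k x = 0" using b(2,3)[of k x] by force
      then show ?thesis by simp
    qed
  qed
qed

lemma convolve_pair_integrable:
  assumes g: "integrable lborel g" and \<eta>: "\<eta> \<in> test_functions"
  shows "integrable (lborel \<Otimes>\<^sub>M lborel) (\<lambda>(y, x). g y * \<eta> (x - y))"
proof (rule lborel_pair.Fubini_integrable)
  have [measurable]: "\<eta> \<in> borel_measurable borel" "g \<in> borel_measurable borel"
    using test_measurable[OF \<eta>] borel_measurable_integrable[OF g] by auto
  show "(\<lambda>(y, x). g y * \<eta> (x - y)) \<in> borel_measurable (lborel \<Otimes>\<^sub>M lborel)"
    by measurable
  have "(LINT x|lborel. norm (case (y, x) of (y, x) \<Rightarrow> g y * \<eta> (x - y))) = \<bar>g y\<bar> * (LINT x|lborel. \<bar>\<eta> x\<bar>)" for y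
    using integral_shift(1)[of "\<lambda>x. \<bar>\<eta> x\<bar>" y] by (simp add: abs_mult)
  then show "integrable lborel (\<lambda>y. LINT x|lborel. norm (case (y, x) of (y, x) \<Rightarrow> g y * \<eta> (x - y)))"
    using g by simp
  show "AE y in lborel. integrable lborel (\<lambda>x. case (y, x) of (y, x) \<Rightarrow> g y * \<eta> (x - y))"
    using integral_shift(2)[of \<eta>] test_integrable[OF \<eta>] by simp
qed

text \<open>The translated kernel is a probability density, so Jensen's inequality bounds the square
  of the average by the average of the squares; Fubini and translation invariance integrate the
  latter exactly.\<close>

lemma convolve_L2_bound:
  assumes g: "integrable lborel g" "integrable lborel (\<lambda>x. (g x)\<^sup>2)"
    and \<eta>: "\<eta> \<in> test_functions" "\<And>x. \<eta> x \<ge> 0" "(LINT x|lborel. \<eta> x) = 1"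
  shows "integrable lborel (\<lambda>x. (convolve g \<eta> x)\<^sup>2)"
    and "(LINT x|lborel. (convolve g \<eta> x)\<^sup>2) \<le> (LINT x|lborel. (g x)\<^sup>2)"
proof -
  have m [measurable]: "\<eta> \<in> borel_measurable borel" by (rule test_measurable[OF \<eta>(1)])
  have \<eta>_int: "integrable lborel (\<lambda>y. \<eta> (x - y))" "(LINT y|lborel. \<eta> (x - y)) = 1" for x
    using integral_shift(3,4)[OF m, of x] test_integrable[OF \<eta>(1)] \<eta>(3) by simp_all
  have Jensen: "(convolve g \<eta> x)\<^sup>2 \<le> convolve (\<lambda>x. (g x)\<^sup>2) \<eta> x" for x
  proof -
    define m where "m = convolve g \<eta> x"
    have i: "integrable lborel (\<lambda>y. (g y)\<^sup>2 * \<eta> (x - y))" "integrable lborel (\<lambda>y. g y * \<eta> (x - y))"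
      by (intro integrable_mult_test g \<eta>)+
    \<comment> \<open>Jensen is obtained as nonnegativity of the variance about the mean
      \<open>m\<close>.\<close>
    have eq: "(g y - m)\<^sup>2 * \<eta> (x - y) = (g y)\<^sup>2 * \<eta> (x - y) - 2 * m * (g y * \<eta> (x - y)) + m\<^sup>2 * \<eta> (x - y)" for y
      by (simp add: power2_eq_square algebra_simps)
    have "0 \<le> (LINT y|lborel. (g y - m)\<^sup>2 * \<eta> (x - y))"
      using \<eta>(2) by simp
    also have "\<dots> = (LINT y|lborel. (g y)\<^sup>2 * \<eta> (x - y)) - 2 * m * (LINT y|lborel. g y * \<eta> (x - y)) + m\<^sup>2 * (LINT y|lborel. \<eta> (x - y))"
      unfolding eq using i \<eta>_int(1)[of x] by simp
    also have "\<dots> = convolve (\<lambda>x. (g x)\<^sup>2) \<eta> x - 2 * m * m + m\<^sup>2"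
      using \<eta>_int(2) by (simp add: convolve_def m_def)
    finally show ?thesis by (simp add: m_def power2_eq_square)
  qed
  note p = convolve_pair_integrable[OF g(2) \<eta>(1)]
  have ci: "integrable lborel (convolve (\<lambda>x. (g x)\<^sup>2) \<eta>)"
    using lborel_pair.integrable_snd[OF p] by (simp add: convolve_def[abs_def])
  have "(LINT x|lborel. convolve (\<lambda>x. (g x)\<^sup>2) \<eta> x) = (LINT y|lborel. (LINT x|lborel. (g y)\<^sup>2 * \<eta> (x - y)))"
    using lborel_pair.Fubini_integral[OF p] by (simp add: convolve_def)
  also have "\<dots> = (LINT y|lborel. (g y)\<^sup>2)"
    using integral_shift(1)[OF m] \<eta>(3) by simp
  finally have eq: "(LINT x|lborel. convolve (\<lambda>x. (g x)\<^sup>2) \<eta> x) = (LINT y|lborel. (g y)\<^sup>2)" .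
  have cm: "convolve g \<eta> \<in> borel_measurable borel"
    by (intro borel_measurable_continuous_onI smooth_continuous smooth_convolve g \<eta>)
  show i: "integrable lborel (\<lambda>x. (convolve g \<eta> x)\<^sup>2)"
    by (rule Bochner_Integration.integrable_bound[OF ci]) (use Jensen cm in \<open>auto intro: order_trans[OF _ abs_ge_self]\<close>)
  show "(LINT x|lborel. (convolve g \<eta> x)\<^sup>2) \<le> (LINT x|lborel. (g x)\<^sup>2)"
    unfolding eq[symmetric] by (rule integral_mono[OF i ci Jensen])
qed

text \<open>Fubini transfers the mollifier from \<open>g\<close>, known only to be integrable, to
  \<open>\<psi>\<close>, whose oscillation over the support of the kernel is at most
  \<open>e\<close>.\<close>

lemma convolve_pairing:
  assumes g: "integrable lborel g" and \<eta>: "\<eta> \<in> test_functions" "\<And>x. \<eta> x \<ge> 0" "(LINT x|lborel. \<eta> x) = 1"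
    and sp: "\<And>x. norm x > r \<Longrightarrow> \<eta> x = 0"
    and \<psi>: "\<psi> \<in> test_functions" "\<And>x y. dist x y \<le> r \<Longrightarrow> \<bar>\<psi> x - \<psi> y\<bar> \<le> e"
  shows "\<bar>(LINT x|lborel. \<psi> x * convolve g \<eta> x) - (LINT x|lborel. \<psi> x * g x)\<bar> \<le> e * (LINT x|lborel. \<bar>g x\<bar>)"
proof -
  have [measurable]: "\<eta> \<in> borel_measurable borel" "g \<in> borel_measurable borel" "\<psi> \<in> borel_measurable borel"
    using test_measurable[OF \<eta>(1)] test_measurable[OF \<psi>(1)] borel_measurable_integrable[OF g] by auto
  obtain B where B: "\<And>x. \<bar>\<psi> x\<bar> \<le> B" using \<psi>(1) by (rule test_bounded) blast
  have p: "integrable (lborel \<Otimes>\<^sub>M lborel) (\<lambda>(y, x). \<psi> x * (g y * \<eta> (x - y)))"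
  proof (rule Bochner_Integration.integrable_bound)
    show "integrable (lborel \<Otimes>\<^sub>M lborel) (\<lambda>z. B * (case z of (y, x) \<Rightarrow> g y * \<eta> (x - y)))"
      by (intro integrable_mult_right convolve_pair_integrable g \<eta>)
    have "\<bar>\<psi> x\<bar> * \<bar>t\<bar> \<le> \<bar>B\<bar> * \<bar>t\<bar>" for x t
      using B[of x] by (intro mult_right_mono) auto
    then show "AE z in lborel \<Otimes>\<^sub>M lborel. norm (case z of (y, x) \<Rightarrow> \<psi> x * (g y * \<eta> (x - y))) \<le>
        norm (B * (case z of (y, x) \<Rightarrow> g y * \<eta> (x - y)))"
      by (intro AE_I2) (auto simp: abs_mult[of _ "_ * _"])
  qed measurable
  define J where "J y = (LINT x|lborel. \<psi> x * \<eta> (x - y))" for y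
  have J_int: "integrable lborel (\<lambda>x. \<psi> x * \<eta> (x - y))" for y
    using integrable_mult_test[OF test_integrable[OF \<psi>(1)], of "\<lambda>z. \<eta> (- 1 *\<^sub>R z + 0)" y] test_affine[OF \<eta>(1), of "-1" 0]
    by simp
  have J: "\<bar>J y - \<psi> y\<bar> \<le> e" for y
  proof -
    have i: "integrable lborel (\<lambda>x. \<eta> (x - y))" "(LINT x|lborel. \<eta> (x - y)) = 1"
      using integral_shift(1,2)[of \<eta> y] test_integrable[OF \<eta>(1)] \<eta>(3) by auto
    have "J y - \<psi> y = (LINT x|lborel. \<psi> x * \<eta> (x - y)) - \<psi> y * (LINT x|lborel. \<eta> (x - y))"
      by (simp add: J_def i)
    also have "\<dots> = (LINT x|lborel. (\<psi> x - \<psi> y) * \<eta> (x - y))"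
      using J_int i by (simp add: left_diff_distrib)
    also have "\<bar>\<dots>\<bar> \<le> (LINT x|lborel. e * \<eta> (x - y))"
    proof (rule order_trans[OF integral_abs_bound], rule integral_mono')
      show "integrable lborel (\<lambda>x. e * \<eta> (x - y))" using i by simp
      \<comment> \<open>The sign of \<open>e\<close> follows from the oscillation bound wherever the
        kernel can be nonzero.\<close>
      have e: "e \<ge> 0 \<or> \<eta> (x - y) = 0" for x
        using \<psi>(2)[of x y] sp[of "x - y"] by (cases "dist x y \<le> r") (auto simp: dist_norm)
      show "\<bar>(\<psi> x - \<psi> y) * \<eta> (x - y)\<bar> \<le> e * \<eta> (x - y)" for x
        using \<psi>(2)[of x y] sp[of "x - y"] \<eta>(2)[of "x - y"]
        by (cases "dist x y \<le> r") (auto simp: dist_norm abs_mult intro!: mult_right_mono)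
      show "0 \<le> e * \<eta> (x - y)" for x using e[of x] \<eta>(2)[of "x - y"] by auto
    qed
    also have "\<dots> = e" by (simp add: i)
    finally show ?thesis .
  qed
  have gJ: "integrable lborel (\<lambda>y. g y * J y)" and eqJ: "(LINT x|lborel. \<psi> x * convolve g \<eta> x) = (LINT y|lborel. g y * J y)"
  proof -
    have 1: "(LINT x|lborel. \<psi> x * (g y * \<eta> (x - y))) = g y * J y" for y
      unfolding J_def by (subst Bochner_Integration.integral_mult_right_zero[symmetric]) (simp add: mult_ac)
    show "integrable lborel (\<lambda>y. g y * J y)"
      using lborel_pair.integrable_fst[OF p] unfolding 1 .
    show "(LINT x|lborel. \<psi> x * convolve g \<eta> x) = (LINT y|lborel. g y * J y)"
      using lborel_pair.Fubini_integral[OF p] unfolding 1 by (simp add: convolve_def)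
  qed
  have gp: "integrable lborel (\<lambda>y. g y * \<psi> y)"
    using integrable_mult_test[OF g, of "\<lambda>z. \<psi> (- 1 *\<^sub>R z + 0)" 0] test_affine[OF \<psi>(1), of "-1" 0] by simp
  have "(LINT x|lborel. \<psi> x * convolve g \<eta> x) - (LINT x|lborel. \<psi> x * g x) = (LINT y|lborel. g y * (J y - \<psi> y))"
    unfolding eqJ right_diff_distrib using gJ gp by (simp add: mult.commute)
  also have "\<bar>\<dots>\<bar> \<le> (LINT y|lborel. e * \<bar>g y\<bar>)"
  proof (rule order_trans[OF integral_abs_bound], rule integral_mono)
    show "integrable lborel (\<lambda>y. \<bar>g y * (J y - \<psi> y)\<bar>)"
      unfolding right_diff_distrib using gJ gp by (intro integrable_abs Bochner_Integration.integrable_diff)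
    show "integrable lborel (\<lambda>y. e * \<bar>g y\<bar>)" using g by simp
    show "\<bar>g y * (J y - \<psi> y)\<bar> \<le> e * \<bar>g y\<bar>" for y
      using J[of y] by (simp add: abs_mult mult.commute[of e] mult_left_mono)
  qed
  also have "\<dots> = e * (LINT y|lborel. \<bar>g y\<bar>)" by simp
  finally show ?thesis .
qed

context continuous_weight
begin

text \<open>Mollification commutes with the weak gradient and does not increase the Lebesgue L2 norm
  of any component; bounded support lets an upper bound of \<open>h\<close> on a ball transfer this
  to L2(\<mu>). With convergence of the pairings this places \<open>U\<close> in the weakly closed
  set \<open>smooth_graph\<close>.\<close>

lemma compact_graph_smooth:
  assumes U: "U \<in> graph" and sp: "\<And>x. norm x > r \<Longrightarrow> U x = 0"
  shows "U \<in> smooth_graph"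
proof -
  obtain \<eta> :: "nat \<Rightarrow> real^'n \<Rightarrow> real" where \<eta>: "\<And>k. \<eta> k \<in> test_functions" "\<And>k x. \<eta> k x \<ge> 0"
    "\<And>k. (LINT x|lborel. \<eta> k x) = 1" "\<And>k x. norm x > real CARD('n) / real (Suc k) \<Longrightarrow> \<eta> k x = 0"
    by (rule mollifier_exists) (rule that)
  have L: "U \<in> L2 \<mu>" by (rule graph_L2[OF U])
  note [measurable] = L2_borel[OF L]
  have gi: "integrable lborel (\<lambda>x. U x \<bullet> b)" for b
  proof -
    have "integrable lborel (\<lambda>x. indicator (cball 0 r) x * (U x \<bullet> b))"
      by (rule L2_times_bounded_integrable(1)[OF L, of _ 1 r]) (auto simp: indicator_def)
    moreover have "indicator (cball 0 r) x * (U x \<bullet> b) = U x \<bullet> b" for x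
      using sp[of x] by (auto simp: indicator_def)
    ultimately show ?thesis by simp
  qed
  have g2: "integrable lborel (\<lambda>x. (U x \<bullet> b)\<^sup>2)" for b
  proof (rule integrable_lborel_local)
    have "(\<lambda>x. U x \<bullet> b) \<in> L2 \<mu>"
      by (rule L2_dominated[OF L, of _ "norm b"])
         (auto simp: mult.commute intro!: order_trans[OF Cauchy_Schwarz_ineq2])
    from L2_integrable[OF this] show "integrable \<mu> (\<lambda>x. (U x \<bullet> b)\<^sup>2)" by simp
    show "(U x \<bullet> b)\<^sup>2 = 0" if "norm x > r" for x using sp[OF that] by simp
  qed
  define f where "f x = fst (U x)" for x
  have f: "integrable lborel f" using gi[of "(1, 0)"] by (simp add: f_def[abs_def] inner_prod_def)
  define g where "g k = convolve f (\<eta> k)" for k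
  \<comment> \<open>All kernels live in the ball of radius \<open>CARD('n)\<close>, so one larger
    ball supports every mollified function.\<close>
  let ?R = "r + real CARD('n)"
  have \<eta>0: "\<eta> k x = 0" if "norm x > real CARD('n)" for k x
  proof (rule \<eta>(4))
    have "real CARD('n) / real (Suc k) \<le> real CARD('n)" by (simp add: divide_le_eq)
    with that show "real CARD('n) / real (Suc k) < norm x" by linarith
  qed
  have g_test: "g k \<in> test_functions" for k
  proof (rule test_functionsI[of _ "cball 0 ?R"])
    show "smooth (g k)" unfolding g_def by (rule smooth_convolve[OF f \<eta>(1)])
    show "g k x = 0" if "x \<notin> cball 0 ?R" for x
      unfolding g_def by (rule convolve_eq_0[of r _ "real CARD('n)"]) (use that sp \<eta>0 in \<open>auto simp: f_def\<close>)
  qed simp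
  have grad_g: "partial i (g k) x = convolve (\<lambda>x. snd (U x) $ i) (\<eta> k) x" for i k x
  proof -
    have "(LINT y|lborel. f y * partial i (\<lambda>y. \<eta> k (x - y)) y) = - (LINT y|lborel. snd (U y) $ i * \<eta> k (x - y))"
      using U test_reflect(1)[OF \<eta>(1)] by (auto simp: graph_def has_weak_gradient_def f_def)
    then show ?thesis
      unfolding g_def partial_convolve[OF f \<eta>(1)] test_reflect(2)[OF \<eta>(1)] by (simp add: convolve_def)
  qed
  define V where "V k x = (g k x, grad (g k) x)" for k x
  have V_comp: "V k x \<bullet> b = convolve (\<lambda>x. U x \<bullet> b) (\<eta> k) x" if b: "b \<in> Basis" for k x b
  proof -
    consider "b = (1, 0)" | i where "b = (0, axis i 1)"
      using b by (auto simp: Basis_prod_def Basis_vec_def)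
    then show ?thesis
      by cases (simp add: V_def inner_prod_def g_def f_def[abs_def],
          simp add: V_def inner_prod_def grad_def inner_axis grad_g)
  qed
  have V_sg: "V k \<in> smooth_graph" for k
    unfolding smooth_graph_def V_def[abs_def]
    using test_graph_L2[OF g_test] g_test by (auto simp: l2norm_def intro!: bexI[of _ "g k"])
  obtain c C where C: "C > 0" "\<And>x. norm x \<le> ?R \<Longrightarrow> h x \<le> C"
    by (rule h_bounds[of ?R]) blast
  define K where "K = C * (\<Sum>b\<in>Basis. LINT x|lborel. (U x \<bullet> b)\<^sup>2)"
  have V_bd: "l2norm \<mu> (V k) \<le> sqrt K" for k
  proof -
    have vL: "V k \<in> L2 \<mu>" using V_sg[of k] by (simp add: smooth_graph_def)
    have vi: "integrable lborel (\<lambda>x. (V k x \<bullet> b)\<^sup>2)" "(LINT x|lborel. (V k x \<bullet> b)\<^sup>2) \<le> (LINT x|lborel. (U x \<bullet> b)\<^sup>2)"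
      if "b \<in> Basis" for b
      unfolding V_comp[OF that] by (intro convolve_L2_bound gi g2 \<eta>)+
    have n2: "(norm (V k x))\<^sup>2 = (\<Sum>b\<in>Basis. (V k x \<bullet> b)\<^sup>2)" for x
      by (subst power2_norm_eq_inner, subst euclidean_inner) (simp add: power2_eq_square)
    have "(l2norm \<mu> (V k))\<^sup>2 = (LINT x|lborel. h x * (norm (V k x))\<^sup>2)"
      unfolding l2norm_sq using L2_borel[OF vL] by (subst integral_\<mu>) auto
    also have "\<dots> \<le> (LINT x|lborel. C * (\<Sum>b\<in>Basis. (V k x \<bullet> b)\<^sup>2))"
    proof (rule integral_mono)
      show "integrable lborel (\<lambda>x. h x * (norm (V k x))\<^sup>2)"
        using L2_integrable[OF vL] L2_borel[OF vL] by (subst (asm) integrable_\<mu>) auto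
      show "integrable lborel (\<lambda>x. C * (\<Sum>b\<in>Basis. (V k x \<bullet> b)\<^sup>2))"
        by (intro integrable_mult_right Bochner_Integration.integrable_sum vi)
      show "h x * (norm (V k x))\<^sup>2 \<le> C * (\<Sum>b\<in>Basis. (V k x \<bullet> b)\<^sup>2)" for x
      proof (cases "norm x \<le> ?R")
        case False
        then have "V k x \<bullet> b = 0" if "b \<in> Basis" for b
          unfolding V_comp[OF that] by (intro convolve_eq_0[of r _ "real CARD('n)"]) (use sp \<eta>0 in auto)
        then show ?thesis unfolding n2 by simp
      qed (unfold n2, intro mult_right_mono C sum_nonneg, auto)
    qed
    also have "\<dots> = C * (\<Sum>b\<in>Basis. LINT x|lborel. (V k x \<bullet> b)\<^sup>2)"
      using vi by (simp add: Bochner_Integration.integral_sum)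
    also have "\<dots> \<le> K"
      unfolding K_def using C(1) vi by (intro mult_left_mono sum_mono) auto
    finally show ?thesis by (rule real_le_rsqrt)
  qed
  show ?thesis
  proof (rule smooth_graph_weak_limit[of V, OF V_sg V_bd L])
    fix \<psi> :: "real^'n \<Rightarrow> real" and b :: "real \<times> (real^'n)" assume \<psi>: "\<psi> \<in> test_functions" and b: "b \<in> Basis"
    define A where "A = (LINT x|lborel. \<bar>U x \<bullet> b\<bar>)"
    show "(\<lambda>k. LINT x|lborel. \<psi> x * (V k x \<bullet> b)) \<longlonglongrightarrow> (LINT x|lborel. \<psi> x * (U x \<bullet> b))"
    proof (rule LIMSEQ_I)
      fix e :: real assume e: "e > 0"
      define e' where "e' = e / (2 * (A + 1))"
      have A: "A \<ge> 0" by (simp add: A_def)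
      have e': "e' > 0" using e A by (simp add: e'_def)
      have e'A: "e' * A < e"
      proof -
        have "e' * A \<le> e' * (A + 1)" using e' by simp
        also have "\<dots> = e / 2" using A by (simp add: e'_def field_simps)
        finally show ?thesis using e by linarith
      qed
      obtain s where s: "\<And>x. norm x > s \<Longrightarrow> \<psi> x = 0" using \<psi> by (rule test_functionsE) blast
      obtain d where d: "d > 0" "\<And>x y. dist x y < d \<Longrightarrow> dist (\<psi> x) (\<psi> y) < e'"
        using compact_support_uniformly_continuous[where f = \<psi>, OF smooth_continuous s e'] \<psi>
        unfolding test_functions_iff by blast
      have "(\<lambda>k. real CARD('n) / real (Suc k)) \<longlonglongrightarrow> 0"
        by (intro LIMSEQ_Suc lim_const_over_n)
      then have "\<forall>\<^sub>F k in sequentially. real CARD('n) / real (Suc k) < d"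
        using d(1) by (intro order_tendstoD)
      then obtain N where N: "\<And>k. k \<ge> N \<Longrightarrow> real CARD('n) / real (Suc k) < d"
        by (auto simp: eventually_sequentially)
      have "\<bar>(LINT x|lborel. \<psi> x * (V k x \<bullet> b)) - (LINT x|lborel. \<psi> x * (U x \<bullet> b))\<bar> \<le> e' * A" if "k \<ge> N" for k
        unfolding V_comp[OF b] A_def
      proof (rule convolve_pairing[OF gi \<eta>(1,2,3,4) \<psi>])
        show "\<bar>\<psi> x - \<psi> y\<bar> \<le> e'" if "dist x y \<le> real CARD('n) / real (Suc k)" for x y
          using d(2)[of x y] that N[OF \<open>k \<ge> N\<close>] by (simp add: dist_real_def)
      qed
      then show "\<exists>N. \<forall>k\<ge>N. norm ((LINT x|lborel. \<psi> x * (V k x \<bullet> b)) - (LINT x|lborel. \<psi> x * (U x \<bullet> b))) < e"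
        using e'A by (intro exI[of _ N]) (auto intro: le_less_trans)
    qed
  qed
qed

text \<open>Meyers-Serrin: cut off, then mollify. Bounded approximations that converge in the sense of
  distributions suffice, because \<open>smooth_graph\<close> is weakly closed.\<close>

theorem graph_smooth:
  assumes U: "U \<in> graph"
  shows "U \<in> smooth_graph"
proof -
  \<comment> \<open>Scaled to take the value 1 at the origin, so that its dilations converge to 1
    everywhere.\<close>
  define \<theta> where "\<theta> x = bump (- 1) 1 x * (1 / bump (- 1) 1 (0 :: real^'n))" for x :: "real^'n"
  have b0: "bump (- 1) 1 (0 :: real^'n) > 0" by (simp add: bump_pos_iff mem_box_cart)
  have \<theta>: "\<theta> \<in> test_functions" unfolding \<theta>_def[abs_def] by (intro test_smooth_mult bump_test smooth_const)
  have \<theta>0: "\<theta> 0 = 1" using b0 by (simp add: \<theta>_def)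
  \<comment> \<open>Dilation by \<open>Suc k\<close> spreads the cut-off while its gradient shrinks
    like 1/(k + 1): the H^1 norms of the products stay bounded, and the extra term of the product
    rule vanishes in the limit.\<close>
  define \<theta>' where "\<theta>' k x = \<theta> ((1 / real (Suc k)) *\<^sub>R x + 0)" for k x
  have \<theta>': "\<theta>' k \<in> test_functions" for k
    unfolding \<theta>'_def[abs_def] by (intro test_affine \<theta>) simp
  have sm: "smooth \<theta>" using \<theta> by (simp add: test_functions_iff)
  have grad_\<theta>': "grad (\<theta>' k) x = (1 / real (Suc k)) *\<^sub>R grad \<theta> ((1 / real (Suc k)) *\<^sub>R x + 0)" for k x
  proof -
    have "partial i (\<theta>' k) x = (1 / real (Suc k)) * partial i \<theta> ((1 / real (Suc k)) *\<^sub>R x + 0)" for i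
      unfolding \<theta>'_def[abs_def] by (rule partial_affine[OF smooth_differentiable[OF sm]])
    then show ?thesis by (simp add: grad_def vec_eq_iff)
  qed
  obtain B where B: "\<And>x. \<bar>\<theta> x\<bar> \<le> B" using \<theta> by (rule test_bounded) blast
  obtain B' where B': "\<And>x. norm (grad \<theta> x) \<le> B'" using \<theta> by (rule test_grad_bounded) blast
  have bd1: "\<bar>\<theta>' k x\<bar> \<le> B" for k x by (simp add: \<theta>'_def B)
  have bd2': "norm (grad (\<theta>' k) x) \<le> B' / real (Suc k)" for k x
    using B' by (simp add: grad_\<theta>' divide_right_mono)
  have "B' \<ge> 0" using B'[of 0] norm_ge_zero order_trans by blast
  have bd2: "norm (grad (\<theta>' k) x) \<le> B'" for k x
  proof -
    have "B' / real (Suc k) \<le> B'" using mult_left_mono[of 1 "real (Suc k)" B'] \<open>B' \<ge> 0\<close> by (simp add: divide_le_eq)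
    with bd2'[of k x] show ?thesis by linarith
  qed
  define V where "V k x = (\<theta>' k x * fst (U x), \<theta>' k x *\<^sub>R snd (U x) + fst (U x) *\<^sub>R grad (\<theta>' k) x)" for k x
  have V: "V k \<in> graph" "l2norm \<mu> (V k) \<le> (2 * B + B') * l2norm \<mu> U" for k
    unfolding V_def[abs_def] using graph_mult_test[OF U \<theta>'] bd1 bd2 by blast+
  have L: "U \<in> L2 \<mu>" by (rule graph_L2[OF U])
  have VL: "V k \<in> L2 \<mu>" for k by (rule graph_L2[OF V(1)])
  have V_sg: "V k \<in> smooth_graph" for k
  proof -
    obtain r where r: "\<And>x. norm x > r \<Longrightarrow> \<theta>' k x = 0" "\<And>x i. norm x > r \<Longrightarrow> partial i (\<theta>' k) x = 0"
      using \<theta>' by (rule test_functionsE) blast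
    have "V k x = 0" if "norm x > r" for x
      using r(1)[OF that] r(2)[OF that] by (simp add: V_def grad_def vec_eq_iff zero_prod_def)
    then show ?thesis by (rule compact_graph_smooth[OF V(1)])
  qed
  have V_norm: "norm (V k x) \<le> (2 * B + B') * norm (U x)" for k x
    unfolding V_def by (rule norm_product_rule_le[OF bd1 bd2])
  have V_lim: "(\<lambda>k. V k x) \<longlonglongrightarrow> U x" for x
  proof -
    have "(\<lambda>k. (1 / real (Suc k)) *\<^sub>R x + 0) \<longlonglongrightarrow> 0 *\<^sub>R x + 0"
      by (intro tendsto_intros LIMSEQ_Suc lim_const_over_n)
    moreover have "isCont \<theta> 0"
      using smooth_continuous[OF sm, of UNIV] by (simp add: continuous_on_eq_continuous_at)
    ultimately have "(\<lambda>k. \<theta>' k x) \<longlonglongrightarrow> \<theta> 0"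
      unfolding \<theta>'_def by (intro isCont_tendsto_compose[of _ \<theta>]) auto
    moreover have "(\<lambda>k. grad (\<theta>' k) x) \<longlonglongrightarrow> 0"
      by (rule Lim_null_comparison[OF always_eventually[OF allI[OF bd2']] LIMSEQ_Suc[OF lim_const_over_n]])
    ultimately have "(\<lambda>k. V k x) \<longlonglongrightarrow> (\<theta> 0 * fst (U x), \<theta> 0 *\<^sub>R snd (U x) + fst (U x) *\<^sub>R 0)"
      unfolding V_def by (intro tendsto_intros)
    then show ?thesis by (simp add: \<theta>0)
  qed
  show ?thesis
  proof (rule smooth_graph_weak_limit[of V, OF V_sg V(2) L])
    fix \<psi> :: "real^'n \<Rightarrow> real" and b :: "real \<times> (real^'n)" assume \<psi>: "\<psi> \<in> test_functions"
    have nL: "(\<lambda>x. norm (U x)) \<in> L2 \<mu>"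
      by (rule L2_dominated[OF L, of _ 1]) (use L2_borel[OF L] in auto)
    show "(\<lambda>k. LINT x|lborel. \<psi> x * (V k x \<bullet> b)) \<longlonglongrightarrow> (LINT x|lborel. \<psi> x * (U x \<bullet> b))"
    proof (rule integral_dominated_convergence)
      show "integrable lborel (\<lambda>x. (2 * B + B') * norm b * \<bar>\<psi> x * (norm (U x) \<bullet> 1)\<bar>)"
        by (intro integrable_mult_right integrable_abs test_pairing(2)[OF nL \<psi>])
      show "AE x in lborel. norm (\<psi> x * (V k x \<bullet> b)) \<le> (2 * B + B') * norm b * \<bar>\<psi> x * (norm (U x) \<bullet> 1)\<bar>" for k
      proof (rule AE_I2)
        fix x
        have "\<bar>V k x \<bullet> b\<bar> \<le> (2 * B + B') * norm (U x) * norm b"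
          by (rule order_trans[OF Cauchy_Schwarz_ineq2 mult_right_mono[OF V_norm]]) simp
        from mult_left_mono[OF this, of "\<bar>\<psi> x\<bar>"]
        show "norm (\<psi> x * (V k x \<bullet> b)) \<le> (2 * B + B') * norm b * \<bar>\<psi> x * (norm (U x) \<bullet> 1)\<bar>"
          by (simp add: abs_mult mult_ac)
      qed
      show "AE x in lborel. (\<lambda>k. \<psi> x * (V k x \<bullet> b)) \<longlonglongrightarrow> \<psi> x * (U x \<bullet> b)"
        by (intro AE_I2 tendsto_intros V_lim)
    qed (use test_pairing(2)[OF L \<psi>, of b] test_pairing(2)[OF VL \<psi>, of _ b] in \<open>auto dest!: borel_measurable_integrable\<close>)
  qed
qed

end

section \<open>Flows of Lipschitz fields\<close>

text \<open>The reference velocity \<open>w0\<close> is free: 0 bounds the displacement, and the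
  velocity at the start gives the first-order expansion.\<close>

lemma vector_derivative_bound:
  fixes c :: "real \<Rightarrow> 'a::real_normed_vector"
  assumes d: "\<And>t. t \<in> {s..s'} \<Longrightarrow> (c has_vector_derivative w t) (at t within {s..s'})"
    and bd: "\<And>t. t \<in> {s..s'} \<Longrightarrow> norm (w t - w0) \<le> K" and ss: "s \<le> s'"
  shows "norm (c s' - c s - (s' - s) *\<^sub>R w0) \<le> K * (s' - s)"
proof -
  have "norm ((\<lambda>t. c t - t *\<^sub>R w0) s' - (\<lambda>t. c t - t *\<^sub>R w0) s) \<le> K * norm (s' - s)"
  proof (rule differentiable_bound[of "{s..s'}" _ "\<lambda>t r. r *\<^sub>R (w t - w0)"])
    fix t assume t: "t \<in> {s..s'}"
    have "(c has_derivative (\<lambda>r. r *\<^sub>R w t)) (at t within {s..s'})"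
      using d[OF t] by (simp add: has_vector_derivative_def)
    then show "((\<lambda>t. c t - t *\<^sub>R w0) has_derivative (\<lambda>r. r *\<^sub>R (w t - w0))) (at t within {s..s'})"
      by (auto intro!: derivative_eq_intros simp: scaleR_diff_right)
    have "K \<ge> 0" using bd[OF t] norm_ge_zero order_trans by blast
    then show "onorm (\<lambda>r. r *\<^sub>R (w t - w0)) \<le> K"
      using bd[OF t] by (intro onorm_bound) (auto simp: mult.commute[of K] mult_left_mono)
  qed (use ss in auto)
  with ss show ?thesis by (simp add: algebra_simps)
qed

text \<open>Picard-Lindeloef on a short interval: boundedness of \<open>v\<close> keeps the integral
  operator within bounded functions, and the bound 1/4 on \<open>\<tau> * L\<close> makes it a
  contraction.\<close>

lemma Lipschitz_ODE_exists:
  fixes v :: "'a::euclidean_space \<Rightarrow> 'a"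
  assumes L: "L-lipschitz_on UNIV v" and B: "\<And>x. norm (v x) \<le> B" and \<tau>: "\<tau> > 0" "\<tau> * L \<le> 1/4"
  obtains c where "c 0 = x" "\<And>t. t \<in> {0..\<tau>} \<Longrightarrow> (c has_vector_derivative v (c t)) (at t within {0..\<tau>})"
proof -
  have v_cont: "continuous_on S v" for S
    using lipschitz_on_continuous_on[OF L] continuous_on_subset by blast
  have L0: "L \<ge> 0" using L by (rule lipschitz_on_nonneg)
  have B0: "B \<ge> 0" using B[of 0] norm_ge_zero order_trans by blast
  \<comment> \<open>Clamping time lets the operator act on bounded continuous functions of the whole
    line, a complete metric type; its images are constant on either side of
    \<open>{0..\<tau>}\<close>.\<close>
  define cl where "cl t = min (max t 0) \<tau>" for t
  have cl: "cl t \<in> {0..\<tau>}" for t using \<tau> by (auto simp: cl_def)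
  define I where "I \<phi> t = x + integral {0..cl t} (\<lambda>s. v (apply_bcontfun \<phi> s))" for \<phi> :: "real \<Rightarrow>\<^sub>C 'a" and t
  have vc: "continuous_on {a..b} (\<lambda>s. v (apply_bcontfun \<phi> s))" for \<phi> :: "real \<Rightarrow>\<^sub>C 'a" and a b
    by (rule continuous_on_compose2[OF v_cont[of UNIV]]) auto
  have vi: "(\<lambda>s. v (apply_bcontfun \<phi> s)) integrable_on {a..b}" for \<phi> :: "real \<Rightarrow>\<^sub>C 'a" and a b
    by (rule integrable_continuous_real[OF vc])
  have I_bc: "I \<phi> \<in> bcontfun" for \<phi>
  proof (rule bcontfun_normI)
    show "continuous_on UNIV (I \<phi>)"
      unfolding I_def
      by (intro continuous_intros continuous_on_compose2[OF indefinite_integral_continuous_1[OF vi, of 0 \<tau>]])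
         (use cl in \<open>auto simp: cl_def intro!: continuous_intros\<close>)
    show "norm (I \<phi> t) \<le> norm x + B * \<tau>" for t
    proof -
      have "norm (integral {0..cl t} (\<lambda>s. v (apply_bcontfun \<phi> s))) \<le> B * (cl t - 0)"
        by (rule integral_bound) (use cl[of t] B vc in auto)
      also have "\<dots> \<le> B * \<tau>" using cl[of t] B0 by (intro mult_left_mono) auto
      finally show ?thesis unfolding I_def by (intro order_trans[OF norm_triangle_ineq]) simp
    qed
  qed
  have app: "apply_bcontfun (Bcontfun (I \<phi>)) = I \<phi>" for \<phi>
    by (rule Bcontfun_inverse[OF I_bc])
  have "\<exists>!\<phi>. Bcontfun (I \<phi>) = \<phi>"
  proof (rule banach_fix_type[of "1/4"])
    show "\<forall>\<phi> \<psi>. dist (Bcontfun (I \<phi>)) (Bcontfun (I \<psi>)) \<le> 1/4 * dist \<phi> \<psi>"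
    proof (intro allI dist_bound, unfold app)
      fix \<phi> \<psi> :: "real \<Rightarrow>\<^sub>C 'a" and t
      have "I \<phi> t - I \<psi> t = integral {0..cl t} (\<lambda>s. v (apply_bcontfun \<phi> s) - v (apply_bcontfun \<psi> s))"
        unfolding I_def by (simp add: Henstock_Kurzweil_Integration.integral_diff[OF vi vi])
      also have "norm \<dots> \<le> (L * dist \<phi> \<psi>) * (cl t - 0)"
      proof (rule integral_bound)
        show "norm (v (apply_bcontfun \<phi> s) - v (apply_bcontfun \<psi> s)) \<le> L * dist \<phi> \<psi>" for s
          using lipschitz_onD[OF L, of "apply_bcontfun \<phi> s" "apply_bcontfun \<psi> s"]
            mult_left_mono[OF dist_bounded[of \<phi> s \<psi>] L0] by (simp add: dist_norm)
      qed (use cl[of t] in \<open>auto intro!: continuous_intros vc\<close>)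
      also have "\<dots> \<le> (L * dist \<phi> \<psi>) * \<tau>"
        using cl[of t] L0 by (intro mult_left_mono) auto
      also have "\<dots> \<le> 1/4 * dist \<phi> \<psi>"
        using mult_right_mono[OF \<tau>(2), of "dist \<phi> \<psi>"] by (simp add: mult_ac)
      finally show "dist (I \<phi> t) (I \<psi> t) \<le> 1/4 * dist \<phi> \<psi>" by (simp add: dist_norm)
    qed
  qed auto
  then obtain \<phi> where "Bcontfun (I \<phi>) = \<phi>" by blast
  then have fix_eq: "apply_bcontfun \<phi> t = I \<phi> t" for t using app by metis
  show thesis
  proof (rule that[of "apply_bcontfun \<phi>"])
    show "apply_bcontfun \<phi> 0 = x"
      using \<tau> by (subst fix_eq) (simp add: I_def cl_def)
    fix t assume t: "t \<in> {0..\<tau>}"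
    have "((\<lambda>t. x + integral {0..t} (\<lambda>s. v (apply_bcontfun \<phi> s))) has_vector_derivative v (apply_bcontfun \<phi> t)) (at t within {0..\<tau>})"
      using has_vector_derivative_add[OF has_vector_derivative_const integral_has_vector_derivative[OF vc t]] by simp
    then show "(apply_bcontfun \<phi> has_vector_derivative v (apply_bcontfun \<phi> t)) (at t within {0..\<tau>})"
      by (rule has_vector_derivative_transform[OF t, rotated]) (subst fix_eq, simp add: I_def cl_def)
  qed
qed

text \<open>One solution curve per starting point is chosen, without any assumed regularity in that
  point; the smallness of \<open>\<tau> * L\<close> provides it in the lemmas that follow.\<close>

locale Lipschitz_flow =
  fixes v :: "'a::euclidean_space \<Rightarrow> 'a" and L B \<tau> :: real and \<phi> :: "'a \<Rightarrow> real \<Rightarrow> 'a"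
  assumes L: "L-lipschitz_on UNIV v" and B: "norm (v x) \<le> B" and \<tau>: "\<tau> > 0" "\<tau> * L \<le> 1/4"
    and \<phi>_0: "\<phi> x 0 = x"
    and \<phi>_deriv: "t \<in> {0..\<tau>} \<Longrightarrow> (\<phi> x has_vector_derivative v (\<phi> x t)) (at t within {0..\<tau>})"
begin

lemma L_nonneg: "L \<ge> 0" using L by (rule lipschitz_on_nonneg)
lemma B_nonneg: "B \<ge> 0" using B[of 0] norm_ge_zero order_trans by blast

lemma v_continuous: "continuous_on S v"
  using lipschitz_on_continuous_on[OF L] continuous_on_subset by blast

lemma v_diff: "norm (v x - v y) \<le> L * norm (x - y)"
  using lipschitz_onD[OF L, of x y] by (simp add: dist_norm)

lemma \<phi>_deriv_within:
  "0 \<le> s \<Longrightarrow> s' \<le> \<tau> \<Longrightarrow> t \<in> {s..s'} \<Longrightarrow> (\<phi> x has_vector_derivative v (\<phi> x t)) (at t within {s..s'})"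
  by (rule has_vector_derivative_within_subset[OF \<phi>_deriv]) auto

lemma \<phi>_speed:
  assumes "0 \<le> s" "s \<le> s'" "s' \<le> \<tau>"
  shows "norm (\<phi> x s' - \<phi> x s) \<le> B * (s' - s)"
  using vector_derivative_bound[of s s' "\<phi> x" "\<lambda>t. v (\<phi> x t)" 0 B] \<phi>_deriv_within assms B by simp

lemma \<phi>_first_order:
  assumes "0 \<le> s" "s \<le> s'" "s' \<le> \<tau>"
  shows "norm (\<phi> x s' - \<phi> x s - (s' - s) *\<^sub>R v (\<phi> x s)) \<le> L * B * (s' - s)\<^sup>2"
proof -
  have "norm (\<phi> x s' - \<phi> x s - (s' - s) *\<^sub>R v (\<phi> x s)) \<le> (L * (B * (s' - s))) * (s' - s)"
  proof (rule vector_derivative_bound[OF \<phi>_deriv_within])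
    fix t assume t: "t \<in> {s..s'}"
    have "norm (\<phi> x t - \<phi> x s) \<le> B * (t - s)" using \<phi>_speed[of s t] assms t by simp
    also have "\<dots> \<le> B * (s' - s)" using t B_nonneg by (intro mult_left_mono) auto
    finally show "norm (v (\<phi> x t) - v (\<phi> x s)) \<le> L * (B * (s' - s))"
      using v_diff[of "\<phi> x t" "\<phi> x s"] mult_left_mono[OF _ L_nonneg] order_trans by blast
  qed (use assms in auto)
  then show ?thesis by (simp add: power2_eq_square mult_ac)
qed

text \<open>Absorption in the manner of Gronwall: the separation of two curves deviates from
  \<open>x - y\<close> by at most a quarter of its maximal size, which forces the maximum to be at
  most 4/3 of \<open>norm (x - y)\<close>; a quarter of that is the third in the bound.\<close>

lemma \<phi>_near_isometry:
  assumes t: "t \<in> {0..\<tau>}"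
  shows "norm (\<phi> x t - \<phi> y t - (x - y)) \<le> 1/3 * norm (x - y)"
proof -
  define d where "d s = norm (\<phi> x s - \<phi> y s)" for s
  have "continuous_on {0..\<tau>} (\<phi> x)" for x
    using \<phi>_deriv by (intro continuous_on_vector_derivative) auto
  then have "continuous_on {0..\<tau>} d"
    unfolding d_def by (intro continuous_intros) auto
  then obtain s0 where s0: "s0 \<in> {0..\<tau>}" "\<And>s. s \<in> {0..\<tau>} \<Longrightarrow> d s \<le> d s0"
    using continuous_attains_sup[of "{0..\<tau>}" d] \<tau> by auto
  have est: "norm (\<phi> x t - \<phi> y t - (x - y)) \<le> 1/4 * d s0" if t: "t \<in> {0..\<tau>}" for t
  proof -
    have "norm ((\<phi> x t - \<phi> y t) - (\<phi> x 0 - \<phi> y 0) - (t - 0) *\<^sub>R 0) \<le> (L * d s0) * (t - 0)"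
    proof (rule vector_derivative_bound[where w = "\<lambda>s. v (\<phi> x s) - v (\<phi> y s)"])
      fix s assume s: "s \<in> {0..t}"
      show "((\<lambda>s. \<phi> x s - \<phi> y s) has_vector_derivative v (\<phi> x s) - v (\<phi> y s)) (at s within {0..t})"
        using s t by (intro has_vector_derivative_diff \<phi>_deriv_within) auto
      have "d s \<le> d s0" using s t by (intro s0) auto
      from mult_left_mono[OF this L_nonneg] v_diff[of "\<phi> x s" "\<phi> y s"]
      show "norm (v (\<phi> x s) - v (\<phi> y s) - 0) \<le> L * d s0" by (simp add: d_def)
    qed (use t in auto)
    also have "\<dots> \<le> (L * d s0) * \<tau>"
      using t L_nonneg by (intro mult_left_mono) (auto simp: d_def)
    also have "\<dots> \<le> 1/4 * d s0"
      using mult_right_mono[OF \<tau>(2), of "d s0"] by (simp add: d_def mult_ac)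
    finally show ?thesis by (simp add: \<phi>_0)
  qed
  have "d s0 \<le> norm (x - y) + norm (\<phi> x s0 - \<phi> y s0 - (x - y))"
    unfolding d_def by (metis add.commute diff_add_cancel norm_triangle_ineq)
  with est[OF s0(1)] have "d s0 \<le> 4/3 * norm (x - y)" by linarith
  with est[OF t] show ?thesis by linarith
qed

text \<open>A deviation of one third gives the factors 4/3 and 3/2; both are rounded up to
  2.\<close>

lemma \<phi>_bilipschitz:
  assumes t: "t \<in> {0..\<tau>}"
  shows "norm (\<phi> x t - \<phi> y t) \<le> 2 * norm (x - y)" and "norm (x - y) \<le> 2 * norm (\<phi> x t - \<phi> y t)"
proof -
  note n = \<phi>_near_isometry[OF t, of x y]
  have "norm (\<phi> x t - \<phi> y t) \<le> norm (x - y) + norm (\<phi> x t - \<phi> y t - (x - y))"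
    by (metis add.commute diff_add_cancel norm_triangle_ineq)
  with n show "norm (\<phi> x t - \<phi> y t) \<le> 2 * norm (x - y)"
    using norm_ge_zero[of "x - y"] by linarith
  have "norm (x - y) \<le> norm (\<phi> x t - \<phi> y t) + norm (\<phi> x t - \<phi> y t - (x - y))"
    by (metis norm_minus_commute norm_triangle_sub)
  with n show "norm (x - y) \<le> 2 * norm (\<phi> x t - \<phi> y t)"
    using norm_ge_zero[of "\<phi> x t - \<phi> y t"] by linarith
qed

lemma \<phi>_continuous: "t \<in> {0..\<tau>} \<Longrightarrow> continuous_on UNIV (\<lambda>x. \<phi> x t)"
  by (rule lipschitz_on_continuous_on[of 2], rule lipschitz_onI) (auto simp: dist_norm \<phi>_bilipschitz)

end

section \<open>Measure of preimages under maps with Lipschitz inverse\<close>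

lemma open_eq_UN_cubes:
  fixes A :: "'a::euclidean_space set"
  assumes A: "open A" "A \<subseteq> box (- r *\<^sub>R One) (r *\<^sub>R One)" and r: "r > 0"
  obtains Q :: "nat \<Rightarrow> 'a set" where "A = (\<Union>n. Q n)"
    "\<And>n. Q n = {} \<or> (\<exists>a s. s \<ge> 0 \<and> Q n = cbox a (a + s *\<^sub>R One))"
    "\<And>m n. m \<noteq> n \<Longrightarrow> interior (Q m) \<inter> interior (Q n) = {}"
proof -
  \<comment> \<open>A gauge equal to \<open>A\<close> at the points of \<open>A\<close> forces every
    cube of the covering lemma to lie inside \<open>A\<close>.\<close>
  define g where "g x = (if x \<in> A then A else UNIV)" for x
  have gau: "gauge g" using A(1) by (auto simp: gauge_def g_def)
  have sub: "A \<subseteq> cbox (- r *\<^sub>R One) (r *\<^sub>R One :: 'a)" using A(2) box_subset_cbox by blast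
  have ne: "box (- r *\<^sub>R One) (r *\<^sub>R One :: 'a) \<noteq> {}" using r by (auto simp: box_ne_empty inner_sum_left_Basis)
  obtain D where D: "countable D" "\<Union>D \<subseteq> cbox (- r *\<^sub>R One) (r *\<^sub>R One)"
    "\<And>K. K \<in> D \<Longrightarrow> interior K \<noteq> {} \<and> (\<exists>c d. K = cbox c d)"
    "pairwise (\<lambda>A B. interior A \<inter> interior B = {}) D"
    "\<And>K. K \<in> D \<Longrightarrow> \<exists>x \<in> A \<inter> K. K \<subseteq> g x"
    "\<And>c d. cbox c d \<in> D \<Longrightarrow> \<exists>n. \<forall>i \<in> Basis. d \<bullet> i - c \<bullet> i = ((r *\<^sub>R One) \<bullet> i - (- r *\<^sub>R One) \<bullet> i) / 2^n"
    "A \<subseteq> \<Union>D"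
    by (rule covering_lemma[OF sub ne gau]) (rule that)
  \<comment> \<open>Enumeration by natural numbers, padded with empty sets; nonempty members with
    different indices are different cubes.\<close>
  define Q where "Q n = (if n \<in> to_nat_on D ` D then from_nat_into D n else {})" for n
  have Q1: "Q (to_nat_on D K) = K" if "K \<in> D" for K
    using that D(1) by (simp add: Q_def)
  have Q2: "Q n \<in> D \<and> n = to_nat_on D (Q n)" if "Q n \<noteq> {}" for n
  proof -
    have "n \<in> to_nat_on D ` D"
    proof (rule ccontr)
      assume "n \<notin> to_nat_on D ` D"
      then have "Q n = {}" unfolding Q_def by (rule if_not_P)
      with that show False by contradiction
    qed
    then obtain K where "K \<in> D" "n = to_nat_on D K" by (rule imageE)
    then show ?thesis using Q1 by simp
  qed
  show thesis
  proof (rule that[of Q])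
    have KA: "K \<subseteq> A" if "K \<in> D" for K using D(5)[OF that] by (auto simp: g_def)
    have "Q n \<subseteq> A" for n
      by (cases "Q n = {}") (simp, use KA Q2[of n] in blast)
    moreover have "x \<in> (\<Union>n. Q n)" if xA: "x \<in> A" for x
    proof -
      obtain K where "K \<in> D" "x \<in> K" using D(7) xA by blast
      then have "x \<in> Q (to_nat_on D K)" by (simp add: Q1)
      then show ?thesis by (rule UN_I[OF UNIV_I])
    qed
    ultimately show "A = (\<Union>n. Q n)" by blast
    show "Q n = {} \<or> (\<exists>a s. s \<ge> 0 \<and> Q n = cbox a (a + s *\<^sub>R One))" for n
    proof (cases "Q n = {}")
      case False
      then have QD: "Q n \<in> D" using Q2 by blast
      obtain c d where cd: "Q n = cbox c d" using D(3)[OF QD] by blast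
      then obtain k where "\<forall>i \<in> Basis. d \<bullet> i - c \<bullet> i = ((r *\<^sub>R One) \<bullet> i - (- r *\<^sub>R One) \<bullet> i) / 2 ^ k"
        using D(6)[of c d] QD by auto
      then have k: "d \<bullet> i - c \<bullet> i = 2 * r / 2 ^ k" if "i \<in> Basis" for i
        using that by (simp add: inner_sum_left_Basis)
      have "d = c + (2 * r / 2 ^ k) *\<^sub>R One"
      proof (rule euclidean_eqI)
        fix i :: 'a assume i: "i \<in> Basis"
        have "d \<bullet> i = c \<bullet> i + 2 * r / 2 ^ k" using k[OF i] by linarith
        with i show "d \<bullet> i = (c + (2 * r / 2 ^ k) *\<^sub>R One) \<bullet> i"
          by (simp add: inner_add_left inner_sum_left_Basis)
      qed
      with cd r show ?thesis by (intro disjI2 exI[of _ c] exI[of _ "2 * r / 2 ^ k"]) auto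
    qed simp
    show "interior (Q m) \<inter> interior (Q n) = {}" if "m \<noteq> n" for m n
    proof (cases "Q m = {} \<or> Q n = {}")
      case False
      then have "Q m \<in> D" "Q n \<in> D" "Q m \<noteq> Q n" using Q2[of m] Q2[of n] that by auto
      with D(4) show ?thesis by (auto simp: pairwise_def)
    qed auto
  qed
qed

text \<open>Let n be the dimension. By the l1 bound for the norm, two points of a cube of side s are
  at most n s apart, so their preimages are at most 2 n s apart and fit into a cube of side 4 n s.
  Cubes serve because their volume is comparable with a power of their diameter.\<close>

definition distortion :: "'a::euclidean_space itself \<Rightarrow> real" where
  "distortion _ = (4 * real DIM('a)) ^ DIM('a)"

context
  fixes T :: "'a::euclidean_space \<Rightarrow> 'a"
  assumes T_cont: "continuous_on UNIV T" and T_inv: "\<And>x y. norm (x - y) \<le> 2 * norm (T x - T y)"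
begin

lemma T_measurable: "T \<in> borel_measurable borel"
  by (rule borel_measurable_continuous_onI[OF T_cont])

lemma T_vimage_borel: "A \<in> sets borel \<Longrightarrow> T -` A \<in> sets borel"
  using measurable_sets[OF T_measurable, of A] by simp

lemma emeasure_vimage_cube:
  assumes s: "s \<ge> 0"
  shows "emeasure lborel (T -` cbox a (a + s *\<^sub>R One)) \<le> ennreal (distortion TYPE('a)) * emeasure lborel (cbox a (a + s *\<^sub>R One))"
proof (cases "T -` cbox a (a + s *\<^sub>R One) = {}")
  case False
  then obtain x0 where x0: "T x0 \<in> cbox a (a + s *\<^sub>R One)" by blast
  define R where "R = 2 * (real DIM('a) * s)"
  have R: "R \<ge> 0" using s by (simp add: R_def)
  have "T -` cbox a (a + s *\<^sub>R One) \<subseteq> cbox (x0 - R *\<^sub>R One) (x0 + R *\<^sub>R One)"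
  proof
    fix x assume "x \<in> T -` cbox a (a + s *\<^sub>R One)"
    then have x: "T x \<in> cbox a (a + s *\<^sub>R One)" by simp
    have "norm (T x - T x0) \<le> (\<Sum>i\<in>Basis. \<bar>(T x - T x0) \<bullet> i\<bar>)" by (rule norm_le_l1)
    also have "\<dots> \<le> (\<Sum>i\<in>(Basis :: 'a set). s)"
    proof (rule sum_mono)
      fix i :: 'a assume i: "i \<in> Basis"
      have "a \<bullet> i \<le> T x \<bullet> i" "T x \<bullet> i \<le> a \<bullet> i + s" "a \<bullet> i \<le> T x0 \<bullet> i" "T x0 \<bullet> i \<le> a \<bullet> i + s"
        using x x0 i by (auto simp: mem_box inner_add_left inner_sum_left_Basis)
      then show "\<bar>(T x - T x0) \<bullet> i\<bar> \<le> s" by (simp add: inner_diff_left abs_le_iff)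
    qed
    finally have "norm (x - x0) \<le> R" using T_inv[of x x0] by (simp add: R_def)
    then have "\<bar>(x - x0) \<bullet> i\<bar> \<le> R" if "i \<in> Basis" for i
      using Basis_le_norm[OF that, of "x - x0"] by linarith
    then show "x \<in> cbox (x0 - R *\<^sub>R One) (x0 + R *\<^sub>R One)"
      by (force simp: mem_box inner_diff_left inner_add_left inner_sum_left_Basis abs_le_iff)
  qed
  then have "emeasure lborel (T -` cbox a (a + s *\<^sub>R One)) \<le> emeasure lborel (cbox (x0 - R *\<^sub>R One) (x0 + R *\<^sub>R One))"
    by (rule emeasure_mono) simp
  also have "\<dots> = ennreal ((2 * R) ^ DIM('a))"
    using R by (subst emeasure_lborel_cbox) (auto simp: inner_diff_left inner_add_left inner_sum_left_Basis)
  also have "(2 * R) ^ DIM('a) = distortion TYPE('a) * s ^ DIM('a)"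
  proof -
    have "2 * R = (4 * real DIM('a)) * s" by (simp add: R_def)
    then show ?thesis by (simp only: distortion_def power_mult_distrib)
  qed
  also have "ennreal \<dots> = ennreal (distortion TYPE('a)) * emeasure lborel (cbox a (a + s *\<^sub>R One))"
    using s by (subst emeasure_lborel_cbox) (auto simp: inner_add_left inner_sum_left_Basis distortion_def ennreal_mult)
  finally show ?thesis .
qed simp

text \<open>The cubes overlap in faces only. Passing to interiors makes them disjoint without
  changing their measure, so the sum over the cubes does not exceed the measure of
  \<open>A\<close>.\<close>

lemma emeasure_vimage_open:
  assumes A: "open A" "A \<subseteq> box (- r *\<^sub>R One) (r *\<^sub>R One)" and r: "r > 0"
  shows "emeasure lborel (T -` A) \<le> ennreal (distortion TYPE('a)) * emeasure lborel A"
proof -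
  let ?C = "ennreal (distortion TYPE('a))"
  obtain Q :: "nat \<Rightarrow> 'a set" where Q: "A = (\<Union>n. Q n)"
    "\<And>n. Q n = {} \<or> (\<exists>a s. s \<ge> 0 \<and> Q n = cbox a (a + s *\<^sub>R One))"
    "\<And>m n. m \<noteq> n \<Longrightarrow> interior (Q m) \<inter> interior (Q n) = {}"
    by (rule open_eq_UN_cubes[OF A r]) (rule that)
  have Qb: "Q n \<in> sets borel" for n using Q(2)[of n] by auto
  have 1: "emeasure lborel (T -` Q n) \<le> ?C * emeasure lborel (interior (Q n))" for n
  proof (cases "Q n = {}")
    case False
    then obtain a s where as: "s \<ge> 0" "Q n = cbox a (a + s *\<^sub>R One)" using Q(2) by blast
    have "emeasure lborel (cbox a (a + s *\<^sub>R One)) = emeasure lborel (box a (a + s *\<^sub>R One))"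
      by (simp add: emeasure_lborel_box_eq emeasure_lborel_cbox_eq)
    then show ?thesis
      using emeasure_vimage_cube[OF as(1), of a] by (simp add: as(2) interior_cbox)
  qed simp
  have "T -` A = (\<Union>n. T -` Q n)" using Q(1) by auto
  then have "emeasure lborel (T -` A) \<le> (\<Sum>n. emeasure lborel (T -` Q n))"
    using Qb by (simp only:) (intro emeasure_subadditive_countably, auto intro: T_vimage_borel)
  also have "\<dots> \<le> (\<Sum>n. ?C * emeasure lborel (interior (Q n)))"
    by (intro suminf_le 1) auto
  also have "\<dots> = ?C * (\<Sum>n. emeasure lborel (interior (Q n)))" by simp
  also have "(\<Sum>n. emeasure lborel (interior (Q n))) = emeasure lborel (\<Union>n. interior (Q n))"
    using Q(3) by (intro suminf_emeasure) (auto simp: disjoint_family_on_def)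
  also have "?C * \<dots> \<le> ?C * emeasure lborel A"
  proof (intro mult_left_mono emeasure_mono)
    show "(\<Union>n. interior (Q n)) \<subseteq> A"
      unfolding Q(1) by (intro UN_mono interior_subset order_refl)
  qed (use A(1) in auto)
  finally show ?thesis .
qed

text \<open>Outer regularity transfers the bound from open to bounded Borel sets, and an increasing
  exhaustion by boxes removes boundedness.\<close>

lemma emeasure_vimage_borel:
  assumes A: "A \<in> sets borel"
  shows "emeasure lborel (T -` A) \<le> ennreal (distortion TYPE('a)) * emeasure lborel A"
proof -
  let ?C = "ennreal (distortion TYPE('a))"
  have bounded: "emeasure lborel (T -` A) \<le> ?C * emeasure lborel A"
    if A: "A \<in> sets borel" "A \<subseteq> box (- r *\<^sub>R One) (r *\<^sub>R One)" "r > 0" for A r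
  proof (rule ennreal_le_epsilon)
    fix e :: real assume e: "e > 0"
    define d where "d = e / (distortion TYPE('a) + 1)"
    have dist0: "distortion TYPE('a) \<ge> 0" by (simp add: distortion_def)
    have d: "d > 0" using e dist0 by (simp add: d_def)
    obtain U where U: "open U" "A \<subseteq> U" "emeasure lborel (U - A) < ennreal d"
      by (rule outer_regular_lborel[OF A(1) d])
    let ?U = "U \<inter> box (- r *\<^sub>R One) (r *\<^sub>R One)"
    have "emeasure lborel (T -` A) \<le> emeasure lborel (T -` ?U)"
      using A U by (intro emeasure_mono) (auto intro!: T_vimage_borel)
    also have "\<dots> \<le> ?C * emeasure lborel ?U"
      using U A by (intro emeasure_vimage_open[of _ r]) auto
    also have "emeasure lborel ?U \<le> emeasure lborel (A \<union> (U - A))"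
      using A U by (intro emeasure_mono) auto
    also have "\<dots> \<le> emeasure lborel A + emeasure lborel (U - A)"
      using A U by (intro emeasure_subadditive) auto
    also have "\<dots> \<le> emeasure lborel A + ennreal d"
      using U(3) by (intro add_left_mono) auto
    finally have "emeasure lborel (T -` A) \<le> ?C * (emeasure lborel A + ennreal d)"
      by (simp add: mult_left_mono)
    also have "\<dots> = ?C * emeasure lborel A + ennreal (distortion TYPE('a) * d)"
      using dist0 d by (simp add: distrib_left ennreal_mult)
    also have "\<dots> \<le> ?C * emeasure lborel A + ennreal e"
      using e dist0 by (intro add_left_mono ennreal_leI) (simp add: d_def field_simps)
    finally show "emeasure lborel (T -` A) \<le> ?C * emeasure lborel A + ennreal e" .
  qed
  define X where "X k = A \<inter> box (- real (Suc k) *\<^sub>R One) (real (Suc k) *\<^sub>R One)" for k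
  have Xb: "X k \<in> sets borel" for k using A by (simp add: X_def)
  have X: "emeasure lborel (T -` X k) \<le> ?C * emeasure lborel A" for k
  proof -
    have "emeasure lborel (T -` X k) \<le> ?C * emeasure lborel (X k)"
      by (rule bounded[OF Xb, where r = "real (Suc k)"]) (unfold X_def, rule Int_lower2, simp)
    also have "\<dots> \<le> ?C * emeasure lborel A"
      using A by (intro mult_left_mono emeasure_mono) (auto simp: X_def)
    finally show ?thesis .
  qed
  have inc: "incseq (\<lambda>k. T -` X k)"
  proof (unfold incseq_def, intro allI impI vimage_mono subsetI)
    fix m n :: nat and x assume mn: "m \<le> n" and x: "x \<in> X m"
    have "- real (Suc n) < x \<bullet> i \<and> x \<bullet> i < real (Suc n)" if i: "i \<in> Basis" for i
    proof -
      have "- real (Suc m) < x \<bullet> i" "x \<bullet> i < real (Suc m)"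
        using x i by (auto simp: X_def mem_box inner_sum_left_Basis)
      moreover have "real (Suc m) \<le> real (Suc n)" using mn by simp
      ultimately show ?thesis by linarith
    qed
    with x show "x \<in> X n" by (auto simp: X_def mem_box inner_sum_left_Basis)
  qed
  have "A = (\<Union>k. X k)"
  proof -
    have "\<exists>k. x \<in> box (- real (Suc k) *\<^sub>R One) (real (Suc k) *\<^sub>R One)" for x :: 'a
    proof -
      obtain k where k: "norm x < real k" using reals_Archimedean2 by blast
      have "\<bar>x \<bullet> i\<bar> < real (Suc k)" if "i \<in> Basis" for i
        using Basis_le_norm[OF that, of x] k by simp
      then show ?thesis by (intro exI[of _ k]) (force simp: mem_box abs_less_iff inner_sum_left_Basis)
    qed
    then show ?thesis by (auto simp: X_def)
  qed
  then have "T -` A = (\<Union>k. T -` X k)" by auto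
  then have "emeasure lborel (T -` A) = (SUP k. emeasure lborel (T -` X k))"
  proof -
    have "range (\<lambda>k. T -` X k) \<subseteq> sets lborel" using T_vimage_borel[OF Xb] by auto
    from SUP_emeasure_incseq[OF this inc] \<open>T -` A = (\<Union>k. T -` X k)\<close> show ?thesis by simp
  qed
  also have "\<dots> \<le> ?C * emeasure lborel A"
    by (intro SUP_least X)
  finally show ?thesis .
qed

lemma nn_integral_compose_le:
  assumes "f \<in> borel_measurable borel"
  shows "(\<integral>\<^sup>+x. f (T x) \<partial>lborel) \<le> ennreal (distortion TYPE('a)) * (\<integral>\<^sup>+x. f x \<partial>lborel)"
  using assms
proof (induction rule: borel_measurable_induct)
  case (cong f g)
  then have "f = g" by auto
  with cong show ?case by simp
next
  case (set A)
  have "(\<lambda>x. indicator A (T x)) = (indicator (T -` A) :: 'a \<Rightarrow> ennreal)"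
    by (auto simp: indicator_def)
  then show ?case using emeasure_vimage_borel[OF set] set T_vimage_borel[OF set] by simp
next
  case (mult u c)
  then show ?case
    by (simp add: nn_integral_cmult measurable_compose[OF T_measurable]) (simp add: mult.left_commute mult_left_mono)
next
  case (add u w)
  then show ?case
    by (simp add: nn_integral_add measurable_compose[OF T_measurable] distrib_left add_mono)
next
  case (seq U)
  have SUPeq: "(SUP i. U i) x = (SUP i. U i x)" for x by (simp add: image_comp)
  have "(\<integral>\<^sup>+x. (SUP i. U i (T x)) \<partial>lborel) = (SUP i. \<integral>\<^sup>+x. U i (T x) \<partial>lborel)"
    using seq by (intro nn_integral_monotone_convergence_SUP)
      (auto simp: incseq_def le_fun_def intro!: measurable_compose[OF T_measurable])
  also have "\<dots> \<le> (SUP i. ennreal (distortion TYPE('a)) * (\<integral>\<^sup>+x. U i x \<partial>lborel))"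
    using seq by (intro SUP_mono) blast
  also have "\<dots> = ennreal (distortion TYPE('a)) * (SUP i. \<integral>\<^sup>+x. U i x \<partial>lborel)"
    by (rule SUP_mult_left_ennreal[symmetric])
  also have "(SUP i. \<integral>\<^sup>+x. U i x \<partial>lborel) = (\<integral>\<^sup>+x. (SUP i. U i x) \<partial>lborel)"
    using seq by (intro nn_integral_monotone_convergence_SUP[symmetric]) auto
  finally show ?case unfolding SUPeq .
qed

lemma integral_compose_le:
  fixes w :: "'a \<Rightarrow> real"
  assumes w: "integrable lborel w" "\<And>x. w x \<ge> 0"
  shows "integrable lborel (\<lambda>x. w (T x))"
    and "(LINT x|lborel. w (T x)) \<le> distortion TYPE('a) * (LINT x|lborel. w x)"
proof -
  note [measurable] = T_measurable
  have [measurable]: "w \<in> borel_measurable borel" using w(1) by auto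
  have d0: "distortion TYPE('a) \<ge> 0" by (simp add: distortion_def)
  have le: "(\<integral>\<^sup>+x. ennreal (w (T x)) \<partial>lborel) \<le> ennreal (distortion TYPE('a) * (LINT x|lborel. w x))"
  proof -
    have "(\<integral>\<^sup>+x. ennreal (w (T x)) \<partial>lborel) \<le> ennreal (distortion TYPE('a)) * (\<integral>\<^sup>+x. ennreal (w x) \<partial>lborel)"
      by (rule nn_integral_compose_le) simp
    also have "(\<integral>\<^sup>+x. ennreal (w x) \<partial>lborel) = ennreal (LINT x|lborel. w x)"
      by (rule nn_integral_eq_integral[OF w(1)]) (use w(2) in simp)
    also have "ennreal (distortion TYPE('a)) * \<dots> = ennreal (distortion TYPE('a) * (LINT x|lborel. w x))"
      by (rule ennreal_mult[symmetric]) (use w(2) d0 in simp_all)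
    finally show ?thesis .
  qed
  show i: "integrable lborel (\<lambda>x. w (T x))"
    using le_less_trans[OF le ennreal_less_top] w(2) by (intro integrableI_bounded) auto
  show "(LINT x|lborel. w (T x)) \<le> distortion TYPE('a) * (LINT x|lborel. w x)"
  proof -
    have "ennreal (LINT x|lborel. w (T x)) \<le> ennreal (distortion TYPE('a) * (LINT x|lborel. w x))"
      using le nn_integral_eq_integral[OF i] w(2) by simp
    moreover have "0 \<le> distortion TYPE('a) * (LINT x|lborel. w x)"
      using d0 w(2) by (intro mult_nonneg_nonneg) simp_all
    ultimately show ?thesis by (simp only: ennreal_le_iff)
  qed
qed

end


lemma (in Lipschitz_flow) \<phi>_compose_le:
  fixes w :: "'a \<Rightarrow> real"
  assumes t: "t \<in> {0..\<tau>}" and w: "integrable lborel w" "\<And>x. w x \<ge> 0"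
  shows "integrable lborel (\<lambda>x. w (\<phi> x t))"
    and "(LINT x|lborel. w (\<phi> x t)) \<le> distortion TYPE('a) * (LINT x|lborel. w x)"
  using integral_compose_le[OF \<phi>_continuous[OF t] \<phi>_bilipschitz(2)[OF t] w] by auto

section \<open>Local L1 estimates along the flow\<close>

locale weighted_flow = continuous_weight h + Lipschitz_flow v L B \<tau> \<phi>
  for h :: "real^'n::finite \<Rightarrow> real" and v L B \<tau> and \<phi> :: "real^'n \<Rightarrow> real \<Rightarrow> real^'n"
begin

text \<open>Two expansions are combined, each granted half of the error: that of \<open>g\<close>,
  uniform in the base point, and that of the curve, whose remainder is quadratic in the time step
  because \<open>v\<close> is Lipschitz.\<close>

lemma test_along_flow:
  assumes g: "g \<in> test_functions" and e: "e > 0"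
  obtains d where "d > 0" "\<And>x s s'. 0 \<le> s \<Longrightarrow> s \<le> s' \<Longrightarrow> s' \<le> \<tau> \<Longrightarrow> s' - s < d \<Longrightarrow>
    \<bar>g (\<phi> x s') - g (\<phi> x s) - (s' - s) * (grad g (\<phi> x s) \<bullet> v (\<phi> x s))\<bar> \<le> e * (s' - s)"
proof -
  obtain G where G: "G > 0" "\<And>x. norm (grad g x) \<le> G" using g by (rule test_grad_bounded) blast
  define e1 where "e1 = e / (2 * (B + 1))"
  have e1: "e1 > 0" using e B_nonneg by (simp add: e1_def)
  have e1B: "e1 * B \<le> e / 2"
    using e B_nonneg by (simp add: e1_def divide_le_eq mult_left_mono)
  obtain d1 where d1: "d1 > 0" "\<And>x z. norm z < d1 \<Longrightarrow> \<bar>g (x + z) - g x - grad g x \<bullet> z\<bar> \<le> e1 * norm z"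
    using test_uniformly_differentiable[OF g e1] by blast
  \<comment> \<open>The first bound keeps the displacement within the range \<open>d1\<close> of the
    expansion of \<open>g\<close>, the second makes \<open>G * L * B\<close> times the time step at
    most \<open>e / 2\<close>; the added ones allow \<open>B\<close> or \<open>L\<close> to be
    0.\<close>
  define d where "d = min (d1 / (B + 1)) (e / (2 * (G * L * B + 1)))"
  have GLB: "G * L * B \<ge> 0" using G(1) L_nonneg B_nonneg by simp
  have d: "d > 0" using d1(1) B_nonneg e GLB by (simp add: d_def)
  show thesis
  proof (rule that[OF d])
    fix x s s' assume s: "0 \<le> s" "s \<le> s'" "s' \<le> \<tau>" "s' - s < d"
    define z where "z = \<phi> x s' - \<phi> x s"
    have z1: "norm z \<le> B * (s' - s)" unfolding z_def by (rule \<phi>_speed[OF s(1-3)])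
    have "B * (s' - s) \<le> (B + 1) * (s' - s)" using s by (intro mult_right_mono) auto
    also have "\<dots> < d1"
    proof -
      have "s' - s < d1 / (B + 1)" using s(4) by (simp add: d_def)
      then show ?thesis using B_nonneg by (simp add: pos_less_divide_eq mult.commute)
    qed
    finally have "\<bar>g (\<phi> x s + z) - g (\<phi> x s) - grad g (\<phi> x s) \<bullet> z\<bar> \<le> e1 * norm z"
      using z1 by (intro d1(2)) linarith
    also have "\<dots> \<le> e1 * (B * (s' - s))" using z1 e1 by (intro mult_left_mono) auto
    also have "\<dots> \<le> e / 2 * (s' - s)" using mult_right_mono[OF e1B, of "s' - s"] s by (simp add: mult_ac)
    finally have a: "\<bar>g (\<phi> x s') - g (\<phi> x s) - grad g (\<phi> x s) \<bullet> z\<bar> \<le> e / 2 * (s' - s)"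
      by (simp add: z_def)
    have "\<bar>grad g (\<phi> x s) \<bullet> (z - (s' - s) *\<^sub>R v (\<phi> x s))\<bar> \<le> G * (L * B * (s' - s)\<^sup>2)"
      unfolding z_def
      by (rule order_trans[OF Cauchy_Schwarz_ineq2 mult_mono[OF G(2) \<phi>_first_order[OF s(1-3)]]]) (use G(1) in auto)
    also have "\<dots> = (G * L * B * (s' - s)) * (s' - s)" by (simp add: power2_eq_square mult_ac)
    also have "\<dots> \<le> e / 2 * (s' - s)"
    proof (rule mult_right_mono)
      have "(s' - s) * (2 * (G * L * B + 1)) \<le> e"
        using s(4) GLB by (simp add: d_def pos_less_divide_eq)
      moreover have "G * L * B * (s' - s) * 2 \<le> (s' - s) * (2 * (G * L * B + 1))"
        using s by (simp add: algebra_simps)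
      ultimately show "G * L * B * (s' - s) \<le> e / 2" by linarith
    qed (use s in simp)
    finally have b: "\<bar>grad g (\<phi> x s) \<bullet> z - (s' - s) * (grad g (\<phi> x s) \<bullet> v (\<phi> x s))\<bar> \<le> e / 2 * (s' - s)"
      by (simp add: inner_diff_right)
    have "e * (s' - s) = e / 2 * (s' - s) + e / 2 * (s' - s)" by simp
    with a b show "\<bar>g (\<phi> x s') - g (\<phi> x s) - (s' - s) * (grad g (\<phi> x s) \<bullet> v (\<phi> x s))\<bar> \<le> e * (s' - s)"
      by linarith
  qed
qed

lemma \<phi>_in_ball:
  assumes "t \<in> {0..\<tau>}" "norm x \<le> r"
  shows "norm (\<phi> x t) \<le> r + B * \<tau>"
proof -
  have "norm (\<phi> x t - x) \<le> B * (t - 0)" using \<phi>_speed[of 0 t x] assms by (simp add: \<phi>_0)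
  also have "\<dots> \<le> B * \<tau>" using assms B_nonneg by (intro mult_left_mono) auto
  finally show ?thesis using norm_triangle_ineq2[of "\<phi> x t" x] assms(2) by linarith
qed

text \<open>The composition bound for the flow concerns Lebesgue measure, and on a ball the weighted
  L2 norm dominates this L1 seminorm, so errors measured in L2(\<mu>) can be carried through the
  flow.\<close>

definition loc :: "real \<Rightarrow> (real^'n \<Rightarrow> real) \<Rightarrow> real" where
  "loc r q = (LINT x|lborel. indicator (cball 0 r) x * \<bar>q x\<bar>)"

abbreviation loc_int :: "real \<Rightarrow> (real^'n \<Rightarrow> real) \<Rightarrow> bool" where
  "loc_int r q \<equiv> integrable lborel (\<lambda>x. indicator (cball 0 r) x * \<bar>q x\<bar>)"

lemma loc_nonneg: "loc r q \<ge> 0"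
  by (simp add: loc_def)

lemma loc_int_continuous:
  assumes "continuous_on UNIV q"
  shows "loc_int r q"
proof -
  have "locally_integrable (\<lambda>x. \<bar>q x\<bar>)"
    by (intro locally_integrable_continuous continuous_on_rabs assms)
  then show ?thesis
    unfolding locally_integrable_def set_integrable_def using compact_cball by simp
qed

lemma loc_add:
  assumes "loc_int r p" "loc_int r q" "\<And>x. norm x \<le> r \<Longrightarrow> \<bar>k x\<bar> \<le> \<bar>p x\<bar> + \<bar>q x\<bar>"
  shows "loc r k \<le> loc r p + loc r q"
proof -
  have "loc r k \<le> (LINT x|lborel. indicator (cball 0 r) x * \<bar>p x\<bar> + indicator (cball 0 r) x * \<bar>q x\<bar>)"
    unfolding loc_def using assms
    by (intro integral_mono' Bochner_Integration.integrable_add) (auto simp: indicator_def)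
  then show ?thesis using assms(1,2) by (simp add: loc_def)
qed

lemma loc_const: "loc r (\<lambda>_. c) = \<bar>c\<bar> * loc r (\<lambda>_. 1)"
  by (simp add: loc_def mult.commute)

text \<open>Within time \<open>\<tau>\<close> a curve moves at most \<open>B * \<tau>\<close>, hence
  the enlarged ball on the right.\<close>

lemma loc_compose:
  assumes t: "t \<in> {0..\<tau>}" and q: "loc_int (r + B * \<tau>) q" "q \<in> borel_measurable borel"
  shows "loc_int r (\<lambda>x. q (\<phi> x t))"
    and "loc r (\<lambda>x. q (\<phi> x t)) \<le> distortion TYPE(real^'n) * loc (r + B * \<tau>) q"
proof -
  let ?w = "\<lambda>x. indicator (cball 0 (r + B * \<tau>)) x * \<bar>q x\<bar>"
  have w0: "0 \<le> ?w x" for x by simp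
  note c = \<phi>_compose_le[OF t q(1) w0]
  have le: "indicator (cball 0 r) x * \<bar>q (\<phi> x t)\<bar> \<le> ?w (\<phi> x t)" for x
    using \<phi>_in_ball[OF t, of x r] by (auto simp: indicator_def)
  have m: "(\<lambda>x. q (\<phi> x t)) \<in> borel_measurable lborel"
    unfolding measurable_lborel2
    by (rule measurable_compose[OF borel_measurable_continuous_onI[OF \<phi>_continuous[OF t]] q(2)])
  show i: "loc_int r (\<lambda>x. q (\<phi> x t))"
  proof (rule Bochner_Integration.integrable_bound[OF c(1)])
    show "AE x in lborel. norm (indicator (cball 0 r) x * \<bar>q (\<phi> x t)\<bar>) \<le> norm (?w (\<phi> x t))"
      using le by (intro AE_I2) simp
    show "(\<lambda>x. indicator (cball 0 r) x * \<bar>q (\<phi> x t)\<bar>) \<in> borel_measurable lborel"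
      by (rule borel_measurable_times[OF borel_measurable_indicator borel_measurable_abs[OF m]]) simp
  qed
  have "loc r (\<lambda>x. q (\<phi> x t)) \<le> (LINT x|lborel. ?w (\<phi> x t))"
    unfolding loc_def by (rule integral_mono[OF i c(1) le])
  also have "\<dots> \<le> distortion TYPE(real^'n) * loc (r + B * \<tau>) q"
    unfolding loc_def by (rule c(2))
  finally show "loc r (\<lambda>x. q (\<phi> x t)) \<le> distortion TYPE(real^'n) * loc (r + B * \<tau>) q" .
qed

text \<open>A discrete form of writing \<open>g (\<phi> x t) - g x\<close> as the time integral of
  \<open>grad g \<bullet> v\<close> along the curve. Summing over short steps uses estimates at
  fixed times only, so an integral over space is never exchanged with one over time.\<close>

lemma flow_difference_le:
  assumes g: "g \<in> test_functions" and t: "t \<in> {0..\<tau>}"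
  shows "loc r (\<lambda>x. g (\<phi> x t) - g x) \<le> t * (distortion TYPE(real^'n) * loc (r + B * \<tau>) (\<lambda>x. grad g x \<bullet> v x))"
proof -
  have sg: "smooth g" using g by (simp add: test_functions_iff)
  define P where "P x = grad g x \<bullet> v x" for x
  have P_cont: "continuous_on UNIV P"
    unfolding P_def by (intro continuous_intros continuous_on_grad sg v_continuous)
  define M where "M = distortion TYPE(real^'n) * loc (r + B * \<tau>) P"
  define b where "b = loc r (\<lambda>_. 1)"
  have b: "b \<ge> 0" by (simp add: b_def loc_nonneg)
  have g\<phi>: "continuous_on UNIV (\<lambda>x. g (\<phi> x s))" if "s \<in> {0..\<tau>}" for s
    by (rule continuous_on_compose2[OF smooth_continuous[OF sg, of UNIV] \<phi>_continuous[OF that]]) simp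
  have gc: "continuous_on UNIV g" by (rule smooth_continuous[OF sg])
  have main: "loc r (\<lambda>x. g (\<phi> x t) - g x) \<le> t * (M + e * b)" if e: "e > 0" for e
  proof -
    obtain d where d: "d > 0" "\<And>x s s'. 0 \<le> s \<Longrightarrow> s \<le> s' \<Longrightarrow> s' \<le> \<tau> \<Longrightarrow> s' - s < d \<Longrightarrow>
      \<bar>g (\<phi> x s') - g (\<phi> x s) - (s' - s) * (grad g (\<phi> x s) \<bullet> v (\<phi> x s))\<bar> \<le> e * (s' - s)"
      using test_along_flow[OF g e] by blast
    \<comment> \<open>The number of steps only has to make the step length shorter than
      \<open>d\<close>; the error \<open>e * b\<close> per unit of time does not depend on it and is
      sent to 0 at the end.\<close>
    obtain N :: nat where N: "real N > t / d" using reals_Archimedean2 by blast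
    have N0: "N > 0" 
    proof -
      have "t / d \<ge> 0" using t d(1) by simp
      with N have "real N > 0" by linarith
      then show ?thesis by simp
    qed
    define \<delta> where "\<delta> = t / real N"
    have \<delta>: "0 \<le> \<delta>" "\<delta> < d" using t d(1) N N0 by (auto simp: \<delta>_def field_simps)
    have N\<delta>: "real N * \<delta> = t" using N0 by (simp add: \<delta>_def)
    have "loc r (\<lambda>x. g (\<phi> x (real k * \<delta>)) - g x) \<le> real k * (\<delta> * (M + e * b))" if "k \<le> N" for k
      using that
    proof (induction k)
      case 0
      then show ?case by (simp add: \<phi>_0 loc_def)
    next
      case (Suc k)
      let ?s = "real k * \<delta>" and ?s' = "real (Suc k) * \<delta>"
      have s: "0 \<le> ?s" "?s \<le> ?s'" "?s' - ?s = \<delta>" using \<delta> by (auto simp: algebra_simps)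
      have "?s' \<le> real N * \<delta>" using Suc.prems \<delta>(1) by (intro mult_right_mono) auto
      then have s': "?s' \<le> \<tau>" using N\<delta> t by simp
      then have sin: "?s \<in> {0..\<tau>}" "?s' \<in> {0..\<tau>}" using s by auto
      have P\<phi>: "continuous_on UNIV (\<lambda>x. P (\<phi> x ?s))"
        by (rule continuous_on_compose2[OF P_cont \<phi>_continuous[OF sin(1)]]) simp
      have "loc r (\<lambda>x. g (\<phi> x ?s') - g (\<phi> x ?s)) \<le> loc r (\<lambda>x. \<delta> * P (\<phi> x ?s)) + loc r (\<lambda>_. e * \<delta>)"
      proof (rule loc_add)
        show "\<bar>g (\<phi> x ?s') - g (\<phi> x ?s)\<bar> \<le> \<bar>\<delta> * P (\<phi> x ?s)\<bar> + \<bar>e * \<delta>\<bar>" for x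
          using d(2)[OF s(1,2) s', of x] s(3) \<delta> e by (simp add: P_def)
      qed (intro loc_int_continuous continuous_intros P\<phi>)+
      also have "loc r (\<lambda>x. \<delta> * P (\<phi> x ?s)) = \<delta> * loc r (\<lambda>x. P (\<phi> x ?s))"
        using \<delta>(1) by (simp add: loc_def abs_mult mult.left_commute)
      also have "loc r (\<lambda>x. P (\<phi> x ?s)) \<le> M"
        unfolding M_def by (rule loc_compose[OF sin(1) loc_int_continuous[OF P_cont] borel_measurable_continuous_onI[OF P_cont]])
      also have "loc r (\<lambda>_. e * \<delta>) = \<delta> * (e * b)"
        unfolding b_def using loc_const[of r "e * \<delta>"] e \<delta>(1) by simp
      finally have step: "loc r (\<lambda>x. g (\<phi> x ?s') - g (\<phi> x ?s)) \<le> \<delta> * (M + e * b)"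
        using \<delta>(1) by (simp add: mult_left_mono distrib_left)
      have "loc r (\<lambda>x. g (\<phi> x ?s') - g x) \<le> loc r (\<lambda>x. g (\<phi> x ?s) - g x) + loc r (\<lambda>x. g (\<phi> x ?s') - g (\<phi> x ?s))"
      proof (rule loc_add)
        show "\<bar>g (\<phi> x ?s') - g x\<bar> \<le> \<bar>g (\<phi> x ?s) - g x\<bar> + \<bar>g (\<phi> x ?s') - g (\<phi> x ?s)\<bar>" for x
          by linarith
      qed (intro loc_int_continuous continuous_on_diff g\<phi> sin gc)+
      with step Suc show ?case by (simp add: algebra_simps)
    qed
    from this[of N] show ?thesis by (simp add: N\<delta> mult.assoc[symmetric])
  qed
  show ?thesis
    unfolding P_def[symmetric] M_def[symmetric]
  proof (rule field_le_epsilon)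
    fix e :: real assume e: "e > 0"
    define e' where "e' = e / (t * b + 1)"
    have tb: "t * b \<ge> 0" using t b by simp
    have "e' > 0" using e tb by (simp add: e'_def)
    moreover have "t * (e' * b) \<le> e"
    proof -
      have "t * (e' * b) = e * (t * b / (t * b + 1))" by (simp add: e'_def)
      also have "\<dots> \<le> e * 1" using e tb by (intro mult_left_mono) auto
      finally show ?thesis by simp
    qed
    ultimately show "loc r (\<lambda>x. g (\<phi> x t) - g x) \<le> t * M + e"
      using main[of e'] by (simp add: distrib_left)
  qed
qed

text \<open>Cauchy-Schwarz in L2(\<mu>) against the indicator of the ball divided by
  \<open>h\<close>.\<close>

lemma loc_L2_bound:
  obtains K where "K \<ge> 0" "\<And>q. q \<in> L2 \<mu> \<Longrightarrow> loc_int r q \<and> loc r q \<le> K * l2norm \<mu> q"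
proof (rule that)
  let ?w = "\<lambda>x. (indicator (cball 0 r) x / h x) *\<^sub>R (1 :: real)"
  have bd: "\<bar>indicator (cball 0 r) x\<bar> \<le> (1::real)" for x :: "real^'n" by (simp add: indicator_def)
  have sp: "indicator (cball 0 r) x = (0::real)" if "norm x > r" for x :: "real^'n"
    using that by (simp add: indicator_def)
  have m: "(indicator (cball 0 r) :: real^'n \<Rightarrow> real) \<in> borel_measurable borel"
    by (intro borel_measurable_indicator) simp
  have w: "?w \<in> L2 \<mu>" by (rule test_over_h_L2[OF m bd sp])
  show "0 \<le> l2norm \<mu> ?w" by simp
  fix q :: "real^'n \<Rightarrow> real" assume q: "q \<in> L2 \<mu>"
  have aq: "(\<lambda>x. \<bar>q x\<bar>) \<in> L2 \<mu>" 
    by (rule L2_dominated[OF q borel_measurable_abs[OF L2_measurable[OF q]], of 1]) simp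
  have n: "l2norm \<mu> (\<lambda>x. \<bar>q x\<bar>) = l2norm \<mu> q" by (simp add: l2norm_def)
  have 1: "loc_int r q"
    using L2_times_bounded_integrable(1)[where b = 1, OF aq m bd sp] by simp
  have 2: "loc r q = (LINT x|\<mu>. \<bar>q x\<bar> \<bullet> ?w x)"
    unfolding loc_def using L2_times_bounded_integrable(2)[where b = 1, OF aq m bd sp] by simp
  have "loc r q \<le> l2norm \<mu> q * l2norm \<mu> ?w"
    using l2_Cauchy_Schwarz[OF aq w] unfolding 2 n by linarith
  with 1 show "loc_int r q \<and> loc r q \<le> l2norm \<mu> ?w * l2norm \<mu> q" by (simp add: mult.commute)
qed

end

section \<open>Functions invariant under the flow\<close>

lemma le_of_le_add_const_over_n:
  fixes X Y Z :: real
  assumes "\<And>j. X \<le> Y + Z / real (Suc j)"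
  shows "X \<le> Y"
proof (rule LIMSEQ_le_const)
  show "(\<lambda>j. Y + Z / real (Suc j)) \<longlonglongrightarrow> Y"
    using tendsto_add[OF tendsto_const LIMSEQ_Suc[OF lim_const_over_n]] by simp
qed (use assms in blast)

context continuous_weight
begin

lemma graph_approx:
  assumes "U \<in> graph"
  obtains g where "\<And>k. g k \<in> test_functions"
    "\<And>k. l2norm \<mu> (\<lambda>x. U x - (g k x, grad (g k) x)) \<le> 1 / real (Suc k)"
proof -
  have ap: "\<forall>e>0. \<exists>g\<in>test_functions. l2norm \<mu> (\<lambda>x. U x - (g x, grad g x)) < e"
    using graph_smooth[OF assms] unfolding smooth_graph_def by (elim CollectE conjE)
  have "\<forall>k. \<exists>g. g \<in> test_functions \<and> l2norm \<mu> (\<lambda>x. U x - (g x, grad g x)) \<le> 1 / real (Suc k)"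
  proof
    fix k
    have "(0::real) < 1 / real (Suc k)" by simp
    then obtain g where "g \<in> test_functions" "l2norm \<mu> (\<lambda>x. U x - (g x, grad g x)) < 1 / real (Suc k)"
      using ap by blast
    then show "\<exists>g. g \<in> test_functions \<and> l2norm \<mu> (\<lambda>x. U x - (g x, grad g x)) \<le> 1 / real (Suc k)"
      by (intro exI[of _ g]) simp
  qed
  from choice[OF this] obtain g where "\<forall>k. g k \<in> test_functions \<and>
      l2norm \<mu> (\<lambda>x. U x - (g k x, grad (g k) x)) \<le> 1 / real (Suc k)" by blast
  then show thesis by (intro that[of g]) blast+
qed

lemma L2_fst:
  assumes "U \<in> L2 \<mu>"
  shows "(\<lambda>x. fst (U x :: real \<times> (real^'n))) \<in> L2 \<mu>"
  using assms pair_L2_iff[of "\<lambda>x. fst (U x)" "\<lambda>x. snd (U x)" \<mu>] by simp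

lemma L2_snd:
  assumes "U \<in> L2 \<mu>"
  shows "(\<lambda>x. snd (U x :: real \<times> (real^'n))) \<in> L2 \<mu>"
  using assms pair_L2_iff[of "\<lambda>x. fst (U x)" "\<lambda>x. snd (U x)" \<mu>] by simp

lemma L2_inner_bounded:
  assumes F: "F \<in> L2 \<mu>" and v: "v \<in> borel_measurable borel" "\<And>x. norm (v x) \<le> B"
  shows "(\<lambda>x. v x \<bullet> (F x :: real^'n)) \<in> L2 \<mu>"
proof (rule L2_dominated[OF F])
  show "(\<lambda>x. v x \<bullet> F x) \<in> borel_measurable \<mu>"
    using v(1) L2_measurable[OF F] by (intro borel_measurable_inner) simp_all
  have "norm (v x \<bullet> F x) \<le> B * norm (F x)" for x
    using order_trans[OF Cauchy_Schwarz_ineq2 mult_right_mono[OF v(2)]] by simp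
  then show "AE x in \<mu>. norm (v x \<bullet> F x) \<le> B * norm (F x)" by simp
qed

lemma test_fst_dist:
  assumes U: "U \<in> L2 \<mu>" and g: "g \<in> test_functions"
  shows "(\<lambda>x. g x - fst (U x)) \<in> L2 \<mu>"
    and "l2norm \<mu> (\<lambda>x. g x - fst (U x)) \<le> l2norm \<mu> (\<lambda>x. U x - (g x, grad g x))"
proof -
  show L: "(\<lambda>x. g x - fst (U x)) \<in> L2 \<mu>"
    using L2_diff[OF L2_fst[OF test_graph_L2[OF g]] L2_fst[OF U]] by simp
  have "norm (g x - fst (U x)) \<le> 1 * norm (U x - (g x, grad g x))" for x
    using norm_fst_le[of "fst (U x) - g x" "snd (U x) - grad g x"]
    by (cases "U x") (simp add: norm_minus_commute)
  then have "l2norm \<mu> (\<lambda>x. g x - fst (U x)) \<le> 1 * l2norm \<mu> (\<lambda>x. U x - (g x, grad g x))"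
    by (intro l2norm_mono_AE[OF L L2_diff[OF U test_graph_L2[OF g]]]) auto
  then show "l2norm \<mu> (\<lambda>x. g x - fst (U x)) \<le> l2norm \<mu> (\<lambda>x. U x - (g x, grad g x))" by simp
qed

lemma test_directional_dist:
  assumes U: "U \<in> L2 \<mu>" and g: "g \<in> test_functions"
    and v: "v \<in> borel_measurable borel" "\<And>x. norm (v x) \<le> B"
  shows "(\<lambda>x. v x \<bullet> grad g x - v x \<bullet> snd (U x)) \<in> L2 \<mu>"
    and "l2norm \<mu> (\<lambda>x. v x \<bullet> grad g x - v x \<bullet> snd (U x)) \<le> B * l2norm \<mu> (\<lambda>x. U x - (g x, grad g x))"
proof -
  have B0: "B \<ge> 0" using v(2)[of 0] norm_ge_zero order_trans by blast
  have D: "(\<lambda>x. U x - (g x, grad g x)) \<in> L2 \<mu>" by (intro L2_diff U test_graph_L2 g)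
  show L: "(\<lambda>x. v x \<bullet> grad g x - v x \<bullet> snd (U x)) \<in> L2 \<mu>"
    using L2_snd[OF test_graph_L2[OF g]] by (intro L2_diff L2_inner_bounded[OF _ v] L2_snd U) simp
  have "norm (v x \<bullet> grad g x - v x \<bullet> snd (U x)) \<le> B * norm (U x - (g x, grad g x))" for x
  proof -
    have "norm (v x \<bullet> grad g x - v x \<bullet> snd (U x)) \<le> norm (v x) * norm (snd (U x) - grad g x)"
      using Cauchy_Schwarz_ineq2[of "v x" "grad g x - snd (U x)"]
      by (simp add: inner_diff_right norm_minus_commute)
    also have "norm (snd (U x) - grad g x) \<le> norm (U x - (g x, grad g x))"
      using norm_snd_le[of "snd (U x) - grad g x" "fst (U x) - g x"] by (cases "U x") simp
    then have "norm (v x) * norm (snd (U x) - grad g x) \<le> B * norm (U x - (g x, grad g x))"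
      using B0 by (intro mult_mono v) auto
    finally show ?thesis .
  qed
  then show "l2norm \<mu> (\<lambda>x. v x \<bullet> grad g x - v x \<bullet> snd (U x)) \<le> B * l2norm \<mu> (\<lambda>x. U x - (g x, grad g x))"
    by (intro l2norm_mono_AE[OF L D]) (auto simp: B0)
qed

text \<open>Both factors are approximated by test functions, for which the product is again a test function.\<close>

lemma divergence_free_product:
  assumes div: "has_weak_divergence (\<lambda>x. h x *\<^sub>R v x) (\<lambda>x. 0)"
    and v: "continuous_on UNIV v" "\<And>x. norm (v x) \<le> B"
    and U: "U \<in> graph" and V: "V \<in> graph"
  shows "(LINT x|\<mu>. fst (U x) * (v x \<bullet> snd (V x))) + (LINT x|\<mu>. fst (V x) * (v x \<bullet> snd (U x))) = 0"
proof -
  obtain f where f: "\<And>k. f k \<in> test_functions" "\<And>k. l2norm \<mu> (\<lambda>x. U x - (f k x, grad (f k) x)) \<le> 1 / real (Suc k)"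
    by (rule graph_approx[OF U]) (rule that)
  obtain g where g: "\<And>k. g k \<in> test_functions" "\<And>k. l2norm \<mu> (\<lambda>x. V x - (g k x, grad (g k) x)) \<le> 1 / real (Suc k)"
    by (rule graph_approx[OF V]) (rule that)
  have B0: "B \<ge> 0" using v(2)[of 0] norm_ge_zero order_trans by blast
  have vm: "v \<in> borel_measurable borel" by (rule borel_measurable_continuous_onI[OF v(1)])
  have c1: "(\<lambda>k. l2norm \<mu> (\<lambda>x. f k x - fst (U x))) \<longlonglongrightarrow> 0 \<and>
            (\<lambda>k. l2norm \<mu> (\<lambda>x. v x \<bullet> grad (f k) x - v x \<bullet> snd (U x))) \<longlonglongrightarrow> 0"
    if U: "U \<in> graph" and f: "\<And>k. f k \<in> test_functions" "\<And>k. l2norm \<mu> (\<lambda>x. U x - (f k x, grad (f k) x)) \<le> 1 / real (Suc k)"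
    for U f
  proof -
    note UL = graph_L2[OF U]
    have a: "norm (l2norm \<mu> (\<lambda>x. f k x - fst (U x))) \<le> 1 / real (Suc k)" for k
      using order_trans[OF test_fst_dist(2)[OF UL f(1)] f(2), of k] by simp
    have b: "norm (l2norm \<mu> (\<lambda>x. v x \<bullet> grad (f k) x - v x \<bullet> snd (U x))) \<le> B / real (Suc k)" for k
      using order_trans[OF test_directional_dist(2)[OF UL f(1) vm v(2)] mult_left_mono[OF f(2) B0], of k] by simp
    show ?thesis
      using Lim_null_comparison[OF always_eventually[OF allI[OF a]] LIMSEQ_Suc[OF lim_const_over_n]]
        Lim_null_comparison[OF always_eventually[OF allI[OF b]] LIMSEQ_Suc[OF lim_const_over_n]] by blast
  qed
  have fL: "f k \<in> L2 \<mu>" "(\<lambda>x. v x \<bullet> grad (f k) x) \<in> L2 \<mu>" for k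
    using L2_fst[OF test_graph_L2[OF f(1)[of k]]] L2_inner_bounded[OF L2_snd[OF test_graph_L2[OF f(1)[of k]]] vm v(2)] by simp_all
  have gL: "g k \<in> L2 \<mu>" "(\<lambda>x. v x \<bullet> grad (g k) x) \<in> L2 \<mu>" for k
    using L2_fst[OF test_graph_L2[OF g(1)[of k]]] L2_inner_bounded[OF L2_snd[OF test_graph_L2[OF g(1)[of k]]] vm v(2)] by simp_all
  have UL: "(\<lambda>x. fst (U x)) \<in> L2 \<mu>" "(\<lambda>x. v x \<bullet> snd (U x)) \<in> L2 \<mu>"
    and VL: "(\<lambda>x. fst (V x)) \<in> L2 \<mu>" "(\<lambda>x. v x \<bullet> snd (V x)) \<in> L2 \<mu>"
    by (intro L2_fst L2_inner_bounded[OF _ vm v(2)] L2_snd graph_L2 U V)+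
  have z: "(LINT x|\<mu>. f k x \<bullet> (v x \<bullet> grad (g k) x)) + (LINT x|\<mu>. g k x \<bullet> (v x \<bullet> grad (f k) x)) = 0" for k
  proof -
    have sm: "smooth (f k)" "smooth (g k)" using f(1) g(1) by (auto simp: test_functions_iff)
    have t: "(\<lambda>x. f k x * g k x) \<in> test_functions" by (rule test_smooth_mult[OF f(1) sm(2)])
    have gr: "grad (\<lambda>x. f k x * g k x) x = f k x *\<^sub>R grad (g k) x + g k x *\<^sub>R grad (f k) x" for x
      using partial_mult[OF smooth_differentiable[OF sm(1)] smooth_differentiable[OF sm(2)]]
      by (simp add: grad_def vec_eq_iff mult.commute)
    have i: "integrable \<mu> (\<lambda>x. f k x \<bullet> (v x \<bullet> grad (g k) x))" "integrable \<mu> (\<lambda>x. g k x \<bullet> (v x \<bullet> grad (f k) x))"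
      by (intro L2_inner_integrable fL gL)+
    have m: "(\<lambda>x. f k x \<bullet> (v x \<bullet> grad (g k) x) + g k x \<bullet> (v x \<bullet> grad (f k) x)) \<in> borel_measurable borel"
      using borel_measurable_integrable[OF Bochner_Integration.integrable_add[OF i]] by simp
    have "(LINT x|lborel. (h x *\<^sub>R v x) \<bullet> grad (\<lambda>x. f k x * g k x) x) = 0"
      using div t by (simp add: has_weak_divergence_def)
    also have "(LINT x|lborel. (h x *\<^sub>R v x) \<bullet> grad (\<lambda>x. f k x * g k x) x) =
        (LINT x|\<mu>. f k x \<bullet> (v x \<bullet> grad (g k) x) + g k x \<bullet> (v x \<bullet> grad (f k) x))"
      unfolding integral_\<mu>[OF m] gr by (simp add: inner_add_right algebra_simps)
    finally show ?thesis using i by simp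
  qed
  have "(\<lambda>k. (LINT x|\<mu>. f k x \<bullet> (v x \<bullet> grad (g k) x)) + (LINT x|\<mu>. g k x \<bullet> (v x \<bullet> grad (f k) x)))
     \<longlonglongrightarrow> (LINT x|\<mu>. fst (U x) \<bullet> (v x \<bullet> snd (V x))) + (LINT x|\<mu>. fst (V x) \<bullet> (v x \<bullet> snd (U x)))"
    using c1[OF U f] c1[OF V g] by (intro tendsto_add l2_inner_tendsto fL gL UL VL) auto
  then show ?thesis unfolding z by (simp add: LIMSEQ_const_iff)
qed

text \<open>The choice behind \<open>wgrad\<close> may return a gradient other than the one known to
  be in L2(\<mu>); uniqueness almost everywhere transfers square integrability to it.\<close>

lemma H1_graph:
  assumes "f \<in> H1 h"
  shows "(\<lambda>x. (f x, wgrad f x)) \<in> graph"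
proof -
  obtain F where F: "f \<in> L2 \<mu>" "has_weak_gradient f F" "F \<in> L2 \<mu>"
    using assms by (auto simp: H1_def)
  have w: "has_weak_gradient f (wgrad f)"
    unfolding wgrad_def by (rule someI[of _ F]) (rule F)
  have "AE x in \<mu>. wgrad f x = F x"
    unfolding AE_\<mu> by (rule has_weak_gradient_unique[OF w F(2)])
  then have "wgrad f \<in> L2 \<mu>"
    using w by (intro L2_dominated[OF F(3), of _ 1])
      (auto simp: has_weak_gradient_def locally_integrable_measurable)
  with F w show ?thesis
    by (simp add: graph_def pair_L2_iff)
qed

lemma graph_H1:
  assumes "U \<in> graph"
  shows "(\<lambda>x. fst (U x)) \<in> H1 h" and "AE x in lborel. wgrad (\<lambda>x. fst (U x)) x = snd (U x)"
proof -
  have w: "has_weak_gradient (\<lambda>x. fst (U x)) (\<lambda>x. snd (U x))"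
    using assms by (simp add: graph_def)
  show H: "(\<lambda>x. fst (U x)) \<in> H1 h"
    using w L2_fst[OF graph_L2[OF assms]] L2_snd[OF graph_L2[OF assms]] by (auto simp: H1_def)
  show "AE x in lborel. wgrad (\<lambda>x. fst (U x)) x = snd (U x)"
    using H1_graph[OF H] by (intro has_weak_gradient_unique[OF _ w]) (simp add: graph_def)
qed

lemma graph_hull:
  assumes "f \<in> midpoint_hull (U ` {N..})" "\<And>k. U k \<in> graph"
  shows "f \<in> graph"
  using assms(1)
proof induction
  case (base f)
  then show ?case using assms(2) by blast
next
  case (mid f g)
  show ?case by (intro graph_add graph_scaleR mid.IH)
qed

text \<open>Only the functions converge weakly; of their gradients nothing but a bound is known. The
  strong limit of the combinations lies in \<open>graph\<close>, and pairing with the first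
  coordinate alone identifies its function part as \<open>p\<close>.\<close>

lemma graph_Mazur:
  assumes U: "\<And>k. U k \<in> graph" and bd: "\<And>k. l2norm \<mu> (U k) \<le> K" and p: "p \<in> L2 \<mu>"
    and lim: "\<And>q. q \<in> L2 \<mu> \<Longrightarrow> (\<lambda>k. LINT x|\<mu>. fst (U k x) * q x) \<longlonglongrightarrow> (LINT x|\<mu>. p x * q x)"
  obtains W F where "\<And>N. W N \<in> midpoint_hull (U ` {N..})" "(\<lambda>x. (p x, F x)) \<in> graph"
    "(\<lambda>N. l2norm \<mu> (\<lambda>x. W N x - (p x, F x))) \<longlonglongrightarrow> 0"
proof -
  obtain W V where W: "\<And>N. W N \<in> midpoint_hull (U ` {N..})" "\<And>N. W N \<in> L2 \<mu>" "V \<in> L2 \<mu>"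
    "(\<lambda>N. l2norm \<mu> (\<lambda>x. W N x - V x)) \<longlonglongrightarrow> 0"
    and pair: "\<And>\<psi> b L. \<psi> \<in> test_functions \<Longrightarrow> (\<lambda>k. LINT x|lborel. \<psi> x * (U k x \<bullet> b)) \<longlonglongrightarrow> L \<Longrightarrow>
       (LINT x|lborel. \<psi> x * (V x \<bullet> b)) = L"
    by (rule L2_Mazur_pairing[where U = U, OF graph_L2[OF U] bd]) (rule that)
  have Vg: "V \<in> graph" by (rule graph_closed[OF graph_hull[OF W(1) U] W(3,4)])
  have "AE x in lborel. fst (V x) = p x"
  proof (rule L2_eq_AE_of_pairing[OF L2_fst[OF W(3)] p])
    fix \<psi> :: "real^'n \<Rightarrow> real" and b :: real assume \<psi>: "\<psi> \<in> test_functions" and b: "b \<in> Basis"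
    then have b1: "b = 1" by simp
    have q: "(\<lambda>x. (\<psi> x / h x) *\<^sub>R (1::real)) \<in> L2 \<mu>" by (rule test_pairing(1)[OF p \<psi>])
    have "(\<lambda>k. LINT x|lborel. \<psi> x * (U k x \<bullet> (1, 0))) \<longlonglongrightarrow> (LINT x|lborel. \<psi> x * (p x \<bullet> 1))"
      using lim[OF q] test_pairing(3)[OF L2_fst[OF graph_L2[OF U]] \<psi>, of _ 1] test_pairing(3)[OF p \<psi>, of 1]
      by (simp add: inner_prod_def)
    from pair[OF \<psi> this] show "(LINT x|lborel. \<psi> x * (fst (V x) \<bullet> b)) = (LINT x|lborel. \<psi> x * (p x \<bullet> b))"
      by (simp add: b1 inner_prod_def)
  qed
  then have AE: "AE x in lborel. V x = (p x, snd (V x))"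
    by eventually_elim (simp add: prod_eq_iff)
  have pL: "(\<lambda>x. (p x, snd (V x))) \<in> L2 \<mu>"
    using p L2_snd[OF W(3)] by (simp add: pair_L2_iff)
  have "l2norm \<mu> (\<lambda>x. W N x - V x) = l2norm \<mu> (\<lambda>x. W N x - (p x, snd (V x)))" for N
    unfolding l2norm_def
  proof (rule arg_cong[of _ _ sqrt], rule integral_cong_AE)
    show "AE x in \<mu>. (norm (W N x - V x))\<^sup>2 = (norm (W N x - (p x, snd (V x))))\<^sup>2"
      unfolding AE_\<mu> using AE by eventually_elim simp
  qed (rule borel_measurable_integrable[OF L2_integrable[OF L2_diff[OF W(2,3)]]]
      borel_measurable_integrable[OF L2_integrable[OF L2_diff[OF W(2) pL]]])+
  with W(4) have "(\<lambda>N. l2norm \<mu> (\<lambda>x. W N x - (p x, snd (V x)))) \<longlonglongrightarrow> 0" by simp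
  with W(1) graph_eqI_AE[OF Vg pL AE] show thesis by (rule that)
qed

end

context weighted_flow
begin

text \<open>Along the flow, \<open>g \<circ> \<phi>\<^sub>t - g\<close> is \<open>t (\<nabla>g \<cdot> v) + o(t)\<close> for a test function \<open>g\<close> close to \<open>U\<close>,
  while it almost vanishes because \<open>U\<close> is invariant.\<close>

lemma invariant_directional_derivative_zero:
  assumes U: "U \<in> graph" and inv: "\<And>x t. t \<in> {0..\<tau>} \<Longrightarrow> fst (U (\<phi> x t)) = fst (U x)"
  shows "AE x in lborel. v x \<bullet> snd (U x) = 0"
proof -
  have UL: "U \<in> L2 \<mu>" by (rule graph_L2[OF U])
  obtain g where g: "\<And>k. g k \<in> test_functions"
    "\<And>k. l2norm \<mu> (\<lambda>x. U x - (g k x, grad (g k) x)) \<le> 1 / real (Suc k)"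
    by (rule graph_approx[OF U]) (rule that)
  have sg: "smooth (g k)" for k using g(1) by (auto simp: test_functions_iff)
  have gc: "continuous_on UNIV (g k)" for k by (rule smooth_continuous[OF sg])
  define P where "P x = snd (U x) \<bullet> v x" for x
  define Pk where "Pk k x = grad (g k) x \<bullet> v x" for k x
  have Pkc: "continuous_on UNIV (Pk k)" for k
    unfolding Pk_def by (intro continuous_on_inner continuous_on_grad sg v_continuous)
  have vm: "v \<in> borel_measurable borel" by (rule borel_measurable_continuous_onI[OF v_continuous])
  define C where "C = distortion TYPE(real^'n)"
  have C: "C \<ge> 0" by (simp add: C_def distortion_def)
  have P_L2: "P \<in> L2 \<mu>"
    unfolding P_def using L2_inner_bounded[OF L2_snd[OF UL] vm B] by (simp add: inner_commute)
  have "loc r P = 0" for r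
  proof -
    \<comment> \<open>The larger ball contains all flow curves up to time \<open>\<tau>\<close> that
      start in the smaller one.\<close>
    define R where "R = r + B * \<tau>"
    have rR: "r \<le> R" using B_nonneg \<tau> by (simp add: R_def)
    obtain K where K: "K \<ge> 0" "\<And>q. q \<in> L2 \<mu> \<Longrightarrow> loc_int R q \<and> loc R q \<le> K * l2norm \<mu> q"
      using loc_L2_bound[of R] by blast
    obtain K' where K': "K' \<ge> 0" "\<And>q. q \<in> L2 \<mu> \<Longrightarrow> loc_int r q \<and> loc r q \<le> K' * l2norm \<mu> q"
      using loc_L2_bound[of r] by blast
    have d1: "(\<lambda>x. g k x - fst (U x)) \<in> L2 \<mu>" "l2norm \<mu> (\<lambda>x. g k x - fst (U x)) \<le> 1 / real (Suc k)" for k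
      using test_fst_dist(1)[OF UL g(1)] order_trans[OF test_fst_dist(2)[OF UL g(1)] g(2)] .
    have d2: "(\<lambda>x. Pk k x - P x) \<in> L2 \<mu>" "l2norm \<mu> (\<lambda>x. Pk k x - P x) \<le> B / real (Suc k)" for k
      using test_directional_dist(1)[OF UL g(1) vm B]
        order_trans[OF test_directional_dist(2)[OF UL g(1) vm B] mult_left_mono[OF g(2) B_nonneg], of k]
      by (simp_all add: Pk_def P_def inner_commute)
    have e1: "loc_int R (\<lambda>x. g k x - fst (U x))" "loc R (\<lambda>x. g k x - fst (U x)) \<le> K / real (Suc k)" for k
      using K(2)[OF d1(1)[of k]] mult_left_mono[OF d1(2)[of k] K(1)] by auto
    have e2: "loc_int R (\<lambda>x. Pk k x - P x)" "loc R (\<lambda>x. Pk k x - P x) \<le> K * B / real (Suc k)" for k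
      using K(2)[OF d2(1)[of k]] mult_left_mono[OF d2(2)[of k] K(1)] by auto
    have key: "loc r (Pk k) \<le> C * (K * B / real (Suc k))" for k
    proof -
      define b where "b = loc r (\<lambda>_. 1)"
      have b: "b \<ge> 0" by (simp add: b_def loc_nonneg)
      have "loc r (Pk k) \<le> C * (K * B / real (Suc k)) + e * b" if e: "e > 0" for e
      proof -
        obtain d where d: "d > 0" "\<And>x s s'. 0 \<le> s \<Longrightarrow> s \<le> s' \<Longrightarrow> s' \<le> \<tau> \<Longrightarrow> s' - s < d \<Longrightarrow>
          \<bar>g k (\<phi> x s') - g k (\<phi> x s) - (s' - s) * (grad (g k) (\<phi> x s) \<bullet> v (\<phi> x s))\<bar> \<le> e * (s' - s)"
          using test_along_flow[OF g(1) e] by blast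
        define t where "t = min (d / 2) \<tau>"
        have t: "t > 0" "t < d" "t \<in> {0..\<tau>}" using d(1) \<tau> by (auto simp: t_def)
        have g\<phi>: "continuous_on UNIV (\<lambda>x. g j (\<phi> x t))" for j
          by (rule continuous_on_compose2[OF gc \<phi>_continuous[OF t(3)]]) simp
        have s1: "t * loc r (Pk k) \<le> loc r (\<lambda>x. g k (\<phi> x t) - g k x) + e * t * b"
        proof -
          have "loc r (\<lambda>x. t * Pk k x) \<le> loc r (\<lambda>x. g k (\<phi> x t) - g k x) + loc r (\<lambda>_. e * t)"
          proof (rule loc_add)
            show "\<bar>t * Pk k x\<bar> \<le> \<bar>g k (\<phi> x t) - g k x\<bar> + \<bar>e * t\<bar>" for x
              using d(2)[of 0 t x] t e by (simp add: \<phi>_0 Pk_def)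
          qed (intro loc_int_continuous continuous_intros g\<phi> gc)+
          moreover have "loc r (\<lambda>x. t * Pk k x) = t * loc r (Pk k)"
            using t(1) by (simp add: loc_def abs_mult mult.left_commute)
          moreover have "loc r (\<lambda>_. e * t) = e * t * b"
            unfolding b_def using loc_const[of r "e * t"] e t by simp
          ultimately show ?thesis by simp
        qed
        \<comment> \<open>The time \<open>t\<close> stays fixed while \<open>j\<close> tends to
          infinity. Replacing \<open>g k\<close> by \<open>g j\<close> costs a multiple of
          \<open>t\<close>, by the flow estimate for their difference. Replacing \<open>g j\<close>
          by the invariant function costs an error without the factor \<open>t\<close>, admissible
          because it vanishes as \<open>j\<close> grows. Division by \<open>t\<close> is then
          possible.\<close>
        have s2: "loc r (\<lambda>x. g k (\<phi> x t) - g k x) \<le> t * (C * (K * B / real (Suc k))) + (t * C * K * B + (C + 1) * K) / real (Suc j)" for j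
        proof -
          let ?q = "\<lambda>x. 1 * g k x + (-1) * g j x"
          have qt: "?q \<in> test_functions"
            using test_add[OF test_smooth_mult[OF g(1)[of k] smooth_const[of 1]] test_smooth_mult[OF g(1)[of j] smooth_const[of "-1"]]]
            by (simp add: mult.commute)
          have "loc r (\<lambda>x. g k (\<phi> x t) - g k x) \<le> loc r (\<lambda>x. ?q (\<phi> x t) - ?q x) + loc r (\<lambda>x. g j (\<phi> x t) - g j x)"
          proof (rule loc_add)
            show "\<bar>g k (\<phi> x t) - g k x\<bar> \<le> \<bar>?q (\<phi> x t) - ?q x\<bar> + \<bar>g j (\<phi> x t) - g j x\<bar>" for x by linarith
          qed (intro loc_int_continuous continuous_intros g\<phi> gc)+
          also have "loc r (\<lambda>x. ?q (\<phi> x t) - ?q x) \<le> t * (C * loc R (\<lambda>x. grad ?q x \<bullet> v x))"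
            unfolding C_def R_def by (rule flow_difference_le[OF qt t(3)])
          also have "loc R (\<lambda>x. grad ?q x \<bullet> v x) \<le> loc R (\<lambda>x. Pk k x - P x) + loc R (\<lambda>x. Pk j x - P x)"
          proof (rule loc_add[OF e2(1) e2(1)])
            show "\<bar>grad ?q x \<bullet> v x\<bar> \<le> \<bar>Pk k x - P x\<bar> + \<bar>Pk j x - P x\<bar>" for x
              unfolding grad_lin[OF sg sg] by (simp add: inner_diff_left Pk_def)
          qed
          also have "\<dots> \<le> K * B / real (Suc k) + K * B / real (Suc j)" by (intro add_mono e2)
          also have "loc r (\<lambda>x. g j (\<phi> x t) - g j x) \<le> (C + 1) * (K / real (Suc j))"
          proof -
            have lc: "loc_int r (\<lambda>x. (g j (\<phi> x t) - fst (U (\<phi> x t))))"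
              "loc r (\<lambda>x. (g j (\<phi> x t) - fst (U (\<phi> x t)))) \<le> C * loc R (\<lambda>x. g j x - fst (U x))"
              using loc_compose[OF t(3), of r "\<lambda>x. g j x - fst (U x)"] e1(1)[of j] L2_borel[OF d1(1)[of j]]
              by (auto simp: R_def C_def)
            have li: "loc_int r (\<lambda>x. g j x - fst (U x))" using K'(2)[OF d1(1)[of j]] by blast
            have "loc r (\<lambda>x. g j (\<phi> x t) - g j x) \<le> loc r (\<lambda>x. (g j (\<phi> x t) - fst (U (\<phi> x t)))) + loc r (\<lambda>x. g j x - fst (U x))"
            proof (rule loc_add[OF lc(1) li])
              show "\<bar>g j (\<phi> x t) - g j x\<bar> \<le> \<bar>g j (\<phi> x t) - fst (U (\<phi> x t))\<bar> + \<bar>g j x - fst (U x)\<bar>" for x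
                unfolding inv[OF t(3)] by linarith
            qed
            also have "loc r (\<lambda>x. g j x - fst (U x)) \<le> loc R (\<lambda>x. g j x - fst (U x))"
              unfolding loc_def by (rule integral_mono[OF li e1(1)]) (use rR in \<open>auto simp: indicator_def\<close>)
            also note lc(2)
            also have "C * loc R (\<lambda>x. g j x - fst (U x)) + loc R (\<lambda>x. g j x - fst (U x)) = (C + 1) * loc R (\<lambda>x. g j x - fst (U x))"
              by (simp add: distrib_right)
            also have "\<dots> \<le> (C + 1) * (K / real (Suc j))" using C by (intro mult_left_mono e1) simp
            finally show ?thesis by simp
          qed
          finally have "loc r (\<lambda>x. g k (\<phi> x t) - g k x) \<le>
              t * (C * (K * B / real (Suc k) + K * B / real (Suc j))) + (C + 1) * (K / real (Suc j))"
            using t(1) C by (simp add: mult_left_mono)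
          also have "\<dots> = t * (C * (K * B / real (Suc k))) + (t * C * K * B + (C + 1) * K) / real (Suc j)"
            by (simp add: distrib_left add_divide_distrib mult.assoc)
          finally show ?thesis .
        qed
        have "loc r (\<lambda>x. g k (\<phi> x t) - g k x) \<le> t * (C * (K * B / real (Suc k)))"
          by (rule le_of_le_add_const_over_n[OF s2])
        with s1 have "t * loc r (Pk k) \<le> t * (C * (K * B / real (Suc k))) + e * t * b" by linarith
        also have "\<dots> = t * (C * (K * B / real (Suc k)) + e * b)" by (simp add: distrib_left)
        finally show ?thesis using t(1) by (simp only: mult_le_cancel_left_pos)
      qed
      from this[of "1 / real (Suc j)" for j]
      have "loc r (Pk k) \<le> C * (K * B / real (Suc k)) + b / real (Suc j)" for j
        by simp
      then show ?thesis by (rule le_of_le_add_const_over_n)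
    qed
    have "loc r P \<le> 0 + (K' * B + C * (K * B)) / real (Suc k)" for k
    proof -
      have "loc r P \<le> loc r (\<lambda>x. Pk k x - P x) + loc r (Pk k)"
      proof (rule loc_add)
        show "loc_int r (\<lambda>x. Pk k x - P x)" using K'(2)[OF d2(1)[of k]] by blast
        show "loc_int r (Pk k)" by (rule loc_int_continuous[OF Pkc])
      qed linarith
      also have "loc r (\<lambda>x. Pk k x - P x) \<le> K' * (B / real (Suc k))"
        using K'(2)[OF d2(1)[of k]] mult_left_mono[OF d2(2)[of k] K'(1)] by auto
      also note key[of k]
      finally show ?thesis by (simp add: add_divide_distrib)
    qed
    then have "loc r P \<le> 0" by (rule le_of_le_add_const_over_n)
    with loc_nonneg[of r P] show ?thesis by simp
  qed note loc0 = this
  have "AE x in lborel. norm x \<le> real r \<longrightarrow> P x = 0" for r :: nat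
  proof -
    obtain K where "\<And>q. q \<in> L2 \<mu> \<Longrightarrow> loc_int (real r) q \<and> loc (real r) q \<le> K * l2norm \<mu> q"
      using loc_L2_bound[of "real r"] by blast
    then have "loc_int (real r) P" using P_L2 by blast
    from integral_nonneg_eq_0_iff_AE[OF this] loc0[of "real r"]
    have "AE x in lborel. indicator (cball 0 (real r)) x * \<bar>P x\<bar> = 0" by (simp add: loc_def)
    then show ?thesis by eventually_elim (auto simp: indicator_def split: if_splits)
  qed
  then have "AE x in lborel. \<forall>r::nat. norm x \<le> real r \<longrightarrow> P x = 0"
    by (intro AE_all_countable[THEN iffD2] allI)
  then show ?thesis
  proof eventually_elim
    fix x assume *: "\<forall>r::nat. norm x \<le> real r \<longrightarrow> P x = 0"
    obtain r :: nat where "norm x \<le> real r" using real_arch_simple by blast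
    with * have "P x = 0" by blast
    then show "v x \<bullet> snd (U x) = 0" by (simp add: P_def inner_commute)
  qed
qed

end

section \<open>Level components, subinvariance and energy bounds\<close>

lemma level_comp_along_curve:
  fixes G :: "real^'n::finite \<Rightarrow> real^'m::finite" and c :: "real \<Rightarrow> real^'n"
  assumes G: "\<And>x. G differentiable (at x)" "\<And>x. jacobian G (at x) *v v x = 0"
    and c: "\<And>t. t \<in> {0..\<tau>} \<Longrightarrow> (c has_vector_derivative v (c t)) (at t within {0..\<tau>})"
    and t: "t \<in> {0..\<tau>}"
  shows "level_comp G (c t) = level_comp G (c 0)"
proof -
  have "((\<lambda>t. G (c t)) has_derivative (\<lambda>_. 0)) (at s within {0..\<tau>})" if s: "s \<in> {0..\<tau>}" for s
  proof -
    have "(c has_derivative (\<lambda>r. r *\<^sub>R v (c s))) (at s within {0..\<tau>})"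
      using c[OF s] by (simp add: has_vector_derivative_def)
    moreover have "(G has_derivative (\<lambda>z. jacobian G (at (c s)) *v z)) (at (c s))"
      using G(1)[of "c s"] by (simp add: jacobian_works)
    ultimately have "((\<lambda>t. G (c t)) has_derivative (\<lambda>r. jacobian G (at (c s)) *v (r *\<^sub>R v (c s)))) (at s within {0..\<tau>})"
      by (rule has_derivative_compose)
    then show ?thesis by (simp add: matrix_vector_mult_scaleR G(2))
  qed
  then have G_const: "G (c s) = G (c 0)" if "s \<in> {0..\<tau>}" for s
    using has_derivative_zero_unique[of "{0..\<tau>}" "\<lambda>t. G (c t)" 0 s] that t by auto
  \<comment> \<open>The image of the curve is a connected subset of one level set, so all its points
    lie in one component.\<close>
  have "connected (c ` {0..\<tau>})"
    using c by (intro connected_continuous_image continuous_on_vector_derivative) auto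
  then have "connected_component {y. G y = G (c 0)} (c 0) (c t)"
    unfolding connected_component_def
  proof (intro exI conjI)
    show "c ` {0..\<tau>} \<subseteq> {y. G y = G (c 0)}" using G_const by blast
    show "c 0 \<in> c ` {0..\<tau>}" "c t \<in> c ` {0..\<tau>}" using t by auto
  qed
  then show ?thesis
    unfolding level_comp_def G_const[OF t] by (simp add: connected_component_eq connected_component_sym)
qed


text \<open>It suffices to test. Pairing \<open>h \<Phi>\<close> with a gradient splits into a drift
  term and a term with \<open>d\<close>; testing the divergence of the matrix field with the partial
  derivatives of \<open>\<phi>\<close> turns the latter into the second-order term of
  subinvariance.\<close>

lemma subinvariant_divergence_nonneg:
  fixes u :: "real^'n::finite \<Rightarrow> real^'n" and a :: "real^'n \<Rightarrow> real^'n^'n"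
  assumes h: "\<And>x. h x > 0" "continuous_on UNIV h" and u: "continuous_on UNIV u" and a: "continuous_on UNIV a"
    and subinv: "weak_subinvariant \<epsilon> u a h"
    and div_ah: "has_weak_matrix_divergence (\<lambda>x. h x *\<^sub>R a x) d"
    and \<Phi>: "\<Phi> = (\<lambda>x. u x - (\<epsilon> / h x) *\<^sub>R d x)"
    and div_\<Phi>h: "has_weak_divergence (\<lambda>x. h x *\<^sub>R \<Phi> x) \<rho>"
  shows "AE x in lborel. \<rho> x \<ge> 0"
proof (rule weak_nonneg_AE)
  show "locally_integrable \<rho>" using div_\<Phi>h by (simp add: has_weak_divergence_def)
  fix \<phi> :: "real^'n \<Rightarrow> real" assume \<phi>: "\<phi> \<in> test_functions" and nn: "\<And>x. \<phi> x \<ge> 0"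
  have lu: "locally_integrable (\<lambda>x. h x *\<^sub>R u x)"
    by (intro locally_integrable_continuous continuous_intros h u)
  have ld: "locally_integrable (\<lambda>x. d x $ j)" for j
    using div_ah by (simp add: has_weak_matrix_divergence_def has_weak_divergence_def)
  have la: "locally_integrable (\<lambda>x. a x $ i $ j * h x)" for i j
    by (intro locally_integrable_continuous continuous_intros h a)
  have A: "(LINT x|lborel. d x $ j * partial j \<phi> x) =
      - (\<Sum>i\<in>UNIV. LINT x|lborel. a x $ i $ j * h x * partial i (partial j \<phi>) x)" for j
  proof -
    have "(LINT x|lborel. column j (h x *\<^sub>R a x) \<bullet> grad (partial j \<phi>) x) = - (LINT x|lborel. d x $ j * partial j \<phi> x)"
      using div_ah test_partial[OF \<phi>] by (simp add: has_weak_matrix_divergence_def has_weak_divergence_def)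
    moreover have "column j (h x *\<^sub>R a x) \<bullet> grad (partial j \<phi>) x =
        (\<Sum>i\<in>UNIV. a x $ i $ j * h x * partial i (partial j \<phi>) x)" for x
      by (simp add: inner_vec_def column_def grad_def mult.commute)
    moreover have "(LINT x|lborel. (\<Sum>i\<in>UNIV. a x $ i $ j * h x * partial i (partial j \<phi>) x)) =
        (\<Sum>i\<in>UNIV. LINT x|lborel. a x $ i $ j * h x * partial i (partial j \<phi>) x)"
      by (intro Bochner_Integration.integral_sum locally_integrable_mult_test la test_partial \<phi>)
    ultimately show ?thesis by simp
  qed
  have eq: "(h x *\<^sub>R \<Phi> x) \<bullet> grad \<phi> x = h x * (u x \<bullet> grad \<phi> x) - \<epsilon> * (\<Sum>j\<in>UNIV. d x $ j * partial j \<phi> x)" for x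
  proof -
    have "h x *\<^sub>R \<Phi> x = h x *\<^sub>R u x - \<epsilon> *\<^sub>R d x"
      using h(1)[of x] by (simp add: \<Phi> scaleR_diff_right)
    moreover have "d x \<bullet> grad \<phi> x = (\<Sum>j\<in>UNIV. d x $ j * partial j \<phi> x)"
      by (simp add: inner_vec_def grad_def)
    ultimately show ?thesis by (simp add: inner_diff_left)
  qed
  have i1: "integrable lborel (\<lambda>x. h x * (u x \<bullet> grad \<phi> x))"
    using locally_integrable_inner_grad[OF lu \<phi>] by simp
  have i2: "integrable lborel (\<lambda>x. d x $ j * partial j \<phi> x)" for j
    by (intro locally_integrable_mult_test ld test_partial \<phi>)
  have "- (LINT x|lborel. \<rho> x * \<phi> x) = (LINT x|lborel. (h x *\<^sub>R \<Phi> x) \<bullet> grad \<phi> x)"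
    using div_\<Phi>h \<phi> by (simp add: has_weak_divergence_def)
  also have "\<dots> = (LINT x|lborel. h x * (u x \<bullet> grad \<phi> x)) - \<epsilon> * (\<Sum>j\<in>UNIV. LINT x|lborel. d x $ j * partial j \<phi> x)"
    unfolding eq using i1 i2 by (simp add: Bochner_Integration.integral_sum)
  \<comment> \<open>The matrix divergence sums over rows for a fixed column, the opposite order to
    \<open>weak_subinvariant\<close>.\<close>
  also have "\<dots> = (LINT x|lborel. h x * (u x \<bullet> grad \<phi> x)) +
      \<epsilon> * (\<Sum>i\<in>UNIV. \<Sum>j\<in>UNIV. LINT x|lborel. a x $ i $ j * h x * partial i (partial j \<phi>) x)"
    unfolding A sum_negf by (subst sum.swap) simp
  also have "\<dots> \<le> 0"
    using subinv \<phi> nn by (simp add: weak_subinvariant_def)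
  finally show "(LINT x|lborel. \<rho> x * \<phi> x) \<ge> 0" by simp
qed

lemma borel_measurable_matrix_vector_mult:
  fixes A :: "'a \<Rightarrow> real^'n::finite^'m::finite"
  assumes "A \<in> borel_measurable M" "F \<in> borel_measurable M"
  shows "(\<lambda>x. A x *v F x) \<in> borel_measurable M"
  using assms
proof (rule borel_measurable_continuous_Pair)
  show "continuous_on UNIV (\<lambda>x :: (real^'n^'m) \<times> (real^'n). fst x *v snd x)"
    unfolding matrix_vector_mult_def by (intro continuous_intros)
qed

lemma norm_matrix_vector_le:
  fixes A :: "real^'n::finite^'m::finite"
  assumes "\<And>i j. \<bar>A $ i $ j\<bar> \<le> b"
  shows "norm (A *v x) \<le> (real CARD('m) * real CARD('n) * b) * norm x"
proof -
  have "norm (A *v x) \<le> onorm ((*v) A) * norm x"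
    by (rule onorm[OF matrix_vector_mul_bounded_linear])
  also have "\<dots> \<le> (real CARD('m) * real CARD('n) * b) * norm x"
    by (intro mult_right_mono onorm_le_matrix_component assms) simp
  finally show ?thesis .
qed

lemma matrix_entry_le_norm: "\<bar>A $ i $ j\<bar> \<le> norm (A :: real^'n::finite^'m::finite)"
  using component_le_norm_cart[of "A $ i" j] Finite_Cartesian_Product.norm_nth_le[of A i] by linarith

text \<open>Links the energy in \<open>E_sym\<close>, written with the transpose of \<sigma>, to
  that in \<open>E_limit\<close>, written with the diffusion matrix.\<close>

lemma inner_transpose_mult:
  fixes S :: "real^'d::finite^'n::finite"
  shows "(transpose S *v x) \<bullet> (transpose S *v y) = x \<bullet> ((S ** transpose S) *v y)"
  by (metis dot_lmul_matrix matrix_vector_mul_assoc transpose_matrix_vector)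

context continuous_weight
begin

text \<open>Every summand of the energy is nonnegative, so each alone is at most \<open>K\<close>:
  the L2 term contributes \<open>K\<close>, and ellipticity makes the gradient term contribute
  \<open>K / (\<epsilon> * c)\<close>.\<close>

lemma energy_bound:
  fixes \<sigma> :: "real^'n \<Rightarrow> real^'d::finite^'n"
  assumes f: "f \<in> H1 h" and \<epsilon>: "\<epsilon> > 0" and c: "c > 0"
    and ell: "\<And>x \<xi>. \<xi> \<bullet> ((\<sigma> x ** transpose (\<sigma> x)) *v \<xi>) \<ge> c * (norm \<xi>)\<^sup>2"
    and \<sigma>: "\<sigma> \<in> borel_measurable borel" "\<And>x. norm (\<sigma> x) \<le> b"
    and \<rho>: "AE x in lborel. \<rho> x \<ge> 0"
    and le: "E_sym \<epsilon> \<sigma> h \<rho> f f + L2_inner \<mu> f f \<le> K"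
  shows "l2norm \<mu> (\<lambda>x. (f x, wgrad f x)) \<le> sqrt (K + K / (\<epsilon> * c))"
proof (rule real_le_rsqrt)
  have U: "(\<lambda>x. (f x, wgrad f x)) \<in> L2 \<mu>" by (rule graph_L2[OF H1_graph[OF f]])
  have fL: "f \<in> L2 \<mu>" and gL: "wgrad f \<in> L2 \<mu>" using U by (simp_all add: pair_L2_iff)
  let ?S = "LINT x|\<mu>. (transpose (\<sigma> x) *v wgrad f x) \<bullet> (transpose (\<sigma> x) *v wgrad f x)"
  have i1: "integrable \<mu> (\<lambda>x. (f x)\<^sup>2)" and i2: "integrable \<mu> (\<lambda>x. (norm (wgrad f x))\<^sup>2)"
    using L2_integrable[OF fL] L2_integrable[OF gL] by simp_all
  have "continuous_on UNIV (transpose :: real^'d^'n \<Rightarrow> real^'n^'d)"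
    unfolding transpose_def by (intro continuous_intros)
  then have tm: "(\<lambda>x. transpose (\<sigma> x)) \<in> borel_measurable \<mu>"
    using measurable_compose[OF \<sigma>(1) borel_measurable_continuous_onI] by simp
  have "(\<lambda>x. transpose (\<sigma> x) *v wgrad f x) \<in> L2 \<mu>"
  proof (rule L2_dominated[OF gL])
    show "(\<lambda>x. transpose (\<sigma> x) *v wgrad f x) \<in> borel_measurable \<mu>"
      by (rule borel_measurable_matrix_vector_mult[OF tm L2_measurable[OF gL]])
    have "\<bar>transpose (\<sigma> x) $ i $ j\<bar> \<le> b" for x i j
      using matrix_entry_le_norm[of "\<sigma> x" j i] \<sigma>(2)[of x] by (simp add: transpose_def)
    then show "AE x in \<mu>. norm (transpose (\<sigma> x) *v wgrad f x) \<le> (real CARD('d) * real CARD('n) * b) * norm (wgrad f x)"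
      by (intro AE_I2 norm_matrix_vector_le)
  qed
  then have i3: "integrable \<mu> (\<lambda>x. (transpose (\<sigma> x) *v wgrad f x) \<bullet> (transpose (\<sigma> x) *v wgrad f x))"
    by (intro L2_inner_integrable)
  have "c * (LINT x|\<mu>. (norm (wgrad f x))\<^sup>2) = (LINT x|\<mu>. c * (norm (wgrad f x))\<^sup>2)" by simp
  also have "\<dots> \<le> ?S"
    by (rule integral_mono[OF integrable_mult_right[OF i2] i3]) (unfold inner_transpose_mult, rule ell)
  finally have S: "c * (LINT x|\<mu>. (norm (wgrad f x))\<^sup>2) \<le> ?S" .
  have R: "(LINT x|\<mu>. 1 / h x * \<rho> x * f x * f x) \<ge> 0"
  proof (rule integral_nonneg_AE, unfold AE_\<mu>)
    show "AE x in lborel. 0 \<le> 1 / h x * \<rho> x * f x * f x"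
      using \<rho>
    proof eventually_elim
      fix x assume "\<rho> x \<ge> 0"
      then have "0 \<le> (1 / h x * \<rho> x) * (f x * f x)" using h_pos[of x] by simp
      then show "0 \<le> 1 / h x * \<rho> x * f x * f x" by (simp only: mult.assoc)
    qed
  qed
  have I: "L2_inner \<mu> f f = (LINT x|\<mu>. (f x)\<^sup>2)" by (simp add: L2_inner_def power2_eq_square)
  have S0: "\<epsilon> * (c * (LINT x|\<mu>. (norm (wgrad f x))\<^sup>2)) \<le> \<epsilon> * ?S"
    using S \<epsilon> by (intro mult_left_mono) auto
  have nn: "(LINT x|\<mu>. (f x)\<^sup>2) \<ge> 0" "(LINT x|\<mu>. (norm (wgrad f x))\<^sup>2) \<ge> 0" by simp_all
  have nn': "0 \<le> \<epsilon> * (c * (LINT x|\<mu>. (norm (wgrad f x))\<^sup>2))" using nn(2) \<epsilon> c by simp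
  have k1: "(LINT x|\<mu>. (f x)\<^sup>2) \<le> K" and k2: "\<epsilon> * (c * (LINT x|\<mu>. (norm (wgrad f x))\<^sup>2)) \<le> K"
    using le S0 R nn nn' unfolding E_sym_def I by linarith+
  have k3: "(LINT x|\<mu>. (norm (wgrad f x))\<^sup>2) \<le> K / (\<epsilon> * c)"
    using k2 \<epsilon> c by (simp add: pos_le_divide_eq mult_ac)
  have "(l2norm \<mu> (\<lambda>x. (f x, wgrad f x)))\<^sup>2 = (LINT x|\<mu>. (f x)\<^sup>2 + (norm (wgrad f x))\<^sup>2)"
    by (simp add: l2norm_sq norm_Pair)
  also have "\<dots> = (LINT x|\<mu>. (f x)\<^sup>2) + (LINT x|\<mu>. (norm (wgrad f x))\<^sup>2)"
    using i1 i2 by simp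
  finally show "(l2norm \<mu> (\<lambda>x. (f x, wgrad f x)))\<^sup>2 \<le> K + K / (\<epsilon> * c)" using k1 k3 by simp
qed

text \<open>Otherwise convex combinations of the \<open>U k\<close> would converge to \<open>P\<close> in \<open>H\<^sup>1(\<mu>)\<close> while the functional
  stays above \<open>y\<close> on them, against its continuity.\<close>

lemma graph_functional_weak_limit:
  assumes C: "C \<in> borel_measurable borel"
    and C_int: "\<And>U. U \<in> graph \<Longrightarrow> integrable \<mu> (\<lambda>x. C x \<bullet> U x)"
    and U: "\<And>k. U k \<in> graph" and bd: "\<And>k. l2norm \<mu> (U k) \<le> K" and P: "P \<in> graph"
    and lim: "\<And>q. q \<in> L2 \<mu> \<Longrightarrow> (\<lambda>k. LINT x|\<mu>. fst (U k x) * q x) \<longlonglongrightarrow> (LINT x|\<mu>. fst (P x) * q x)"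
    and low: "\<And>k. y \<le> (LINT x|\<mu>. C x \<bullet> U k x)"
  shows "y \<le> (LINT x|\<mu>. C x \<bullet> P x)"
proof (rule ccontr)
  assume "\<not> y \<le> (LINT x|\<mu>. C x \<bullet> P x)"
  then have \<delta>: "y - (LINT x|\<mu>. C x \<bullet> P x) > 0" by simp
  obtain W F where W: "\<And>N. W N \<in> midpoint_hull (U ` {N..})" and F: "(\<lambda>x. (fst (P x), F x)) \<in> graph"
    and WF: "(\<lambda>N. l2norm \<mu> (\<lambda>x. W N x - (fst (P x), F x))) \<longlonglongrightarrow> 0"
    by (rule graph_Mazur[where U = U and p = "\<lambda>x. fst (P x)" and K = K])
       (rule U, rule bd, rule L2_fst[OF graph_L2[OF P]], erule lim, rule that)
  \<comment> \<open>Mazur's lemma provides some weak gradient \<open>F\<close> of the limit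
    function. By uniqueness \<open>Q\<close> and \<open>P\<close> differ on a null set only, so the
    functional takes the same value on both.\<close>
  define Q where "Q x = (fst (P x), F x)" for x
  have Q: "Q \<in> graph" using F by (simp add: Q_def[abs_def])
  have Wlim: "(\<lambda>N. l2norm \<mu> (\<lambda>x. W N x - Q x)) \<longlonglongrightarrow> 0" using WF by (simp add: Q_def)
  have "AE x in lborel. F x = snd (P x)"
    using F P by (intro has_weak_gradient_unique[of "\<lambda>x. fst (P x)"]) (simp_all add: graph_def)
  then have AE: "AE x in \<mu>. Q x = P x"
    unfolding AE_\<mu> Q_def by eventually_elim simp
  have CP: "(LINT x|\<mu>. C x \<bullet> Q x) = (LINT x|\<mu>. C x \<bullet> P x)"
  proof (rule integral_cong_AE)
    show "AE x in \<mu>. C x \<bullet> Q x = C x \<bullet> P x" using AE by eventually_elim simp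
  qed (rule borel_measurable_integrable[OF C_int[OF Q]] borel_measurable_integrable[OF C_int[OF P]])+
  have hull: "y \<le> (LINT x|\<mu>. C x \<bullet> f x)" if "f \<in> midpoint_hull (U ` {N..})" for f N
    using that
  proof induction
    case (base f)
    then show ?case using low by blast
  next
    case (mid f g)
    have "integrable \<mu> (\<lambda>x. C x \<bullet> f x)" "integrable \<mu> (\<lambda>x. C x \<bullet> g x)"
      using graph_hull[OF mid.hyps(1) U] graph_hull[OF mid.hyps(2) U] C_int by blast+
    then have "(LINT x|\<mu>. C x \<bullet> ((1/2) *\<^sub>R f x + (1/2) *\<^sub>R g x)) =
        1/2 * (LINT x|\<mu>. C x \<bullet> f x) + 1/2 * (LINT x|\<mu>. C x \<bullet> g x)"
      by (simp add: inner_add_right)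
    with mid.IH show ?case by linarith
  qed
  \<comment> \<open>These differences are the humps: their norms tend to 0 while the functional
    stays above a fixed gap.\<close>
  define D where "D N x = W N x - Q x" for N x
  have Wg: "W N \<in> graph" for N by (rule graph_hull[OF W U])
  have D: "D N \<in> graph" for N
    using graph_add[OF Wg graph_scaleR[OF Q, of "-1"], of N] by (simp add: D_def[abs_def])
  have Dlim: "(\<lambda>N. l2norm \<mu> (D N)) \<longlonglongrightarrow> 0" using Wlim by (simp add: D_def[abs_def])
  have Dlow: "y - (LINT x|\<mu>. C x \<bullet> P x) \<le> (LINT x|\<mu>. C x \<bullet> D N x)" for N
    using hull[OF W[of N]] C_int[OF Wg[of N]] C_int[OF Q] CP
    by (simp add: D_def inner_diff_right)
  \<comment> \<open>On these sets \<open>C\<close> is bounded with bounded support, so the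
    truncations lie in L2(\<mu>) whatever the growth of \<open>C\<close>; they exhaust the space
    because \<open>C\<close> is finite everywhere.\<close>
  define A where "A R = {x. norm x \<le> real R \<and> norm (C x) \<le> real R}" for R :: nat
  have A_borel: "A R \<in> sets borel" for R
    unfolding A_def using C by measurable
  show False
  proof (rule L2_functional_continuous[of A \<mu> C graph D, OF _ _ _ _ _ graph_L2 graph_add _ C_int D Dlim \<delta> Dlow])
    show "A R \<in> sets \<mu>" for R using A_borel by simp
    show "incseq A" by (auto simp: incseq_def A_def)
    show "(\<Union>R. A R) = space \<mu>"
    proof -
      have "\<exists>R. x \<in> A R" for x
      proof -
        obtain R :: nat where "max (norm x) (norm (C x)) \<le> real R" using real_arch_simple by blast
        then show ?thesis by (auto simp: A_def)
      qed
      then show ?thesis by auto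
    qed
    show "C \<in> borel_measurable \<mu>" using C by simp
    show "(\<lambda>x. indicator (A R) x *\<^sub>R C x) \<in> L2 \<mu>" for R
      by (rule bounded_support_L2[of _ "real R" "real R"])
         (use C A_borel in \<open>auto simp: A_def indicator_def intro!: borel_measurable_scaleR borel_measurable_indicator\<close>)
    show "V \<in> graph" if "\<And>k. U k \<in> graph" "V \<in> L2 \<mu>" "(\<lambda>k. l2norm \<mu> (\<lambda>x. U k x - V x)) \<longlonglongrightarrow> 0" for U V
      by (rule graph_closed[OF that])
  qed
qed

end


theorem proposition5p6:
  fixes \<epsilon> :: real
    and v u :: "real^'n::finite \<Rightarrow> real^'n"
    and \<sigma> :: "real^'n \<Rightarrow> real^'d::finite^'n"
    and a :: "real^'n \<Rightarrow> real^'n^'n"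
    and G :: "real^'n \<Rightarrow> real^'m::finite"
    and h :: "real^'n \<Rightarrow> real"
    and div_ah \<Phi> :: "real^'n \<Rightarrow> real^'n"
    and div_\<Phi>h :: "real^'n \<Rightarrow> real"
    and \<alpha> :: "nat \<Rightarrow> real"
  assumes eps: "\<epsilon> > 0"
    and dims: "CARD('m) < CARD('n)"
    and v: "bounded (range v)" "\<exists>L. L-lipschitz_on UNIV v"
    and u: "bounded (range u)" "\<exists>L. L-lipschitz_on UNIV u"
    and \<sigma>: "bounded (range \<sigma>)" "\<exists>L. L-lipschitz_on UNIV \<sigma>"
    and a: "a = (\<lambda>x. \<sigma> x ** transpose (\<sigma> x))" "uniformly_elliptic a"
    and G_diff: "\<And>x. G differentiable (at x)"
    and G_v: "\<And>x. jacobian G (at x) *v v x = 0"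
    and G_levels: "\<And>y. compact {x. G x = y}"
    and h: "\<And>x. h x > 0" "C_k 1 h"
    and v_inv: "has_weak_divergence (\<lambda>x. h x *\<^sub>R v x) (\<lambda>x. 0)"
    and subinv: "weak_subinvariant \<epsilon> u a h"
    and div_ah: "has_weak_matrix_divergence (\<lambda>x. h x *\<^sub>R a x) div_ah"
    and \<Phi>: "\<Phi> = (\<lambda>x. u x - (\<epsilon> / h x) *\<^sub>R div_ah x)"
    and div_\<Phi>h: "has_weak_divergence (\<lambda>x. h x *\<^sub>R \<Phi> x) div_\<Phi>h"
    \<comment> \<open>the integrals defining the form converge on all of \<open>H\<^sup>1(\<mu>)\<close>, its domain\<close>
    and form_defined:
      "\<And>f g. f \<in> H1 h \<Longrightarrow> g \<in> H1 h \<Longrightarrow>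
         integrable (wmeasure h) (\<lambda>x. 1 / h x * div_\<Phi>h x * f x * g x)"
      "\<And>f g. f \<in> H1 h \<Longrightarrow> g \<in> H1 h \<Longrightarrow>
         integrable (wmeasure h) (\<lambda>x. \<Phi> x \<bullet> (f x *\<^sub>R wgrad g x - g x *\<^sub>R wgrad f x))"
    and \<alpha>: "\<And>n. \<alpha> n > 0" "\<alpha> \<longlonglongrightarrow> 0"
  shows "mosco_converges h G
           (\<lambda>n. E_sym1 \<epsilon> \<sigma> h div_\<Phi>h)
           (\<lambda>n. E_form \<epsilon> v \<sigma> h \<Phi> div_\<Phi>h (\<alpha> n))
           (E_limit \<epsilon> a h G \<Phi> div_\<Phi>h)"
proof -
  have h_cont: "continuous_on UNIV h"
    using C_k_mono[of 0 h] h(2) by simp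
  interpret continuous_weight h
    by standard (use h h_cont in auto)
  obtain B where B: "\<And>x. norm (v x) \<le> B" using v(1) by (auto simp: bounded_iff)
  obtain b where b: "\<And>x. norm (\<sigma> x) \<le> b" using \<sigma>(1) by (auto simp: bounded_iff)
  obtain L where L: "L-lipschitz_on UNIV v" using v(2) by blast
  have L0: "L \<ge> 0" using L by (rule lipschitz_on_nonneg)
  \<comment> \<open>The summand 1 covers \<open>L = 0\<close>; the resulting bound 1/4 on
    \<open>\<tau> * L\<close> is the one that the flow estimates ask for.\<close>
  define \<tau> where "\<tau> = 1 / (4 * (L + 1))"
  have \<tau>: "\<tau> > 0" "\<tau> * L \<le> 1/4" using L0 by (auto simp: \<tau>_def field_simps)
  have "\<forall>x. \<exists>c. c 0 = x \<and> (\<forall>t\<in>{0..\<tau>}. (c has_vector_derivative v (c t)) (at t within {0..\<tau>}))"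
  proof
    fix x
    obtain c where "c 0 = x" "\<And>t. t \<in> {0..\<tau>} \<Longrightarrow> (c has_vector_derivative v (c t)) (at t within {0..\<tau>})"
      by (rule Lipschitz_ODE_exists[OF L B \<tau>]) (rule that)
    then show "\<exists>c. c 0 = x \<and> (\<forall>t\<in>{0..\<tau>}. (c has_vector_derivative v (c t)) (at t within {0..\<tau>}))"
      by blast
  qed
  from choice[OF this] obtain \<phi> where \<phi>: "\<And>x. \<phi> x 0 = x"
    "\<And>x t. t \<in> {0..\<tau>} \<Longrightarrow> (\<phi> x has_vector_derivative v (\<phi> x t)) (at t within {0..\<tau>})"
    by blast
  interpret weighted_flow h v L B \<tau> \<phi>
    by standard (use L B \<tau> \<phi> in auto)
  have vm: "v \<in> borel_measurable borel" by (rule borel_measurable_continuous_onI[OF v_continuous])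
  have u_cont: "continuous_on UNIV u" using u(2) lipschitz_on_continuous_on by blast
  have \<sigma>_cont: "continuous_on UNIV \<sigma>" using \<sigma>(2) lipschitz_on_continuous_on by blast
  have \<sigma>m: "\<sigma> \<in> borel_measurable borel" by (rule borel_measurable_continuous_onI[OF \<sigma>_cont])
  have a_cont: "continuous_on UNIV a"
    unfolding a(1) matrix_matrix_mult_def transpose_def
    by (intro continuous_intros continuous_on_vec_lambda continuous_on_compose2[OF \<sigma>_cont]) auto
  obtain c where c: "c > 0" "\<And>x \<xi>. \<xi> \<bullet> (a x *v \<xi>) \<ge> c * (norm \<xi>)\<^sup>2"
    using a(2) by (auto simp: uniformly_elliptic_def)
  have \<rho>_nonneg: "AE x in lborel. div_\<Phi>h x \<ge> 0"
    by (rule subinvariant_divergence_nonneg[OF h(1) h_cont u_cont a_cont subinv div_ah \<Phi> div_\<Phi>h])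
  have bounded: "\<exists>K. \<forall>k. us k \<in> H1 h \<and> l2norm \<mu> (\<lambda>x. (us k x, wgrad (us k) x)) \<le> K"
    if sup: "(SUP k. E_sym1 \<epsilon> \<sigma> h div_\<Phi>h (us k)) < \<infinity>" for us :: "nat \<Rightarrow> real^'n \<Rightarrow> real"
  proof -
    obtain N :: nat where "(SUP k. E_sym1 \<epsilon> \<sigma> h div_\<Phi>h (us k)) < ereal (real N)"
      using less_PInf_Ex_of_nat[of "SUP k. E_sym1 \<epsilon> \<sigma> h div_\<Phi>h (us k)"] sup by auto
    then have E: "E_sym1 \<epsilon> \<sigma> h div_\<Phi>h (us k) \<le> ereal (real N)" for k
      using SUP_upper[of k UNIV "\<lambda>k. E_sym1 \<epsilon> \<sigma> h div_\<Phi>h (us k)"] by (simp add: order_trans less_imp_le)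
    \<comment> \<open>A finite supremum already places every \<open>us k\<close> in H^1(\<mu>),
      because \<open>E_sym1\<close> is infinite elsewhere.\<close>
    have H: "us k \<in> H1 h" for k using E[of k] by (auto simp: E_sym1_def split: if_splits)
    have "l2norm \<mu> (\<lambda>x. (us k x, wgrad (us k) x)) \<le> sqrt (real N + real N / (\<epsilon> * c))" for k
    proof (rule energy_bound[OF H eps c(1) _ \<sigma>m b \<rho>_nonneg])
      show "c * (norm \<xi>)\<^sup>2 \<le> \<xi> \<bullet> ((\<sigma> x ** transpose (\<sigma> x)) *v \<xi>)" for x \<xi>
        using c(2)[of \<xi> x] by (simp add: a(1))
      show "E_sym \<epsilon> \<sigma> h div_\<Phi>h (us k) (us k) + L2_inner \<mu> (us k) (us k) \<le> real N"
        using E[of k] H[of k] by (simp add: E_sym1_def)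
    qed
    with H show ?thesis by blast
  qed
  have "mosco_1 h G (\<lambda>n. E_sym1 \<epsilon> \<sigma> h div_\<Phi>h)"
    unfolding mosco_1_def
  proof (intro allI ballI impI, elim conjE)
    fix us :: "nat \<Rightarrow> real^'n \<Rightarrow> real" and w
    assume w: "w \<in> L2_Gamma h G" and wk: "weakly_converges h G us w"
      and sup: "(SUP n. E_sym1 \<epsilon> \<sigma> h div_\<Phi>h (us n)) < \<infinity>"
    obtain K where K: "\<And>k. us k \<in> H1 h" "\<And>k. l2norm \<mu> (\<lambda>x. (us k x, wgrad (us k) x)) \<le> K"
      using bounded[OF sup] by blast
    have p: "w \<circ> level_comp G \<in> L2 \<mu>" using w by (simp add: L2_Gamma_def)
    have lim: "(\<lambda>k. LINT x|\<mu>. fst (us k x, wgrad (us k) x) * q x) \<longlonglongrightarrow> (LINT x|\<mu>. (w \<circ> level_comp G) x * q x)"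
      if "q \<in> L2 \<mu>" for q
      using wk that by (simp add: weakly_converges_def L2_inner_def)
    \<comment> \<open>Mazur's lemma supplies a square integrable weak gradient of the weak limit,
      which is what membership in \<open>H1_Gamma\<close> asks for.\<close>
    obtain F where "(\<lambda>x. ((w \<circ> level_comp G) x, F x)) \<in> graph"
      by (rule graph_Mazur[where U = "\<lambda>k x. (us k x, wgrad (us k) x)" and p = "w \<circ> level_comp G" and K = K])
         (rule H1_graph[OF K(1)], rule K(2), rule p, erule lim, rule that)
    from graph_H1(1)[OF this] show "w \<in> H1_Gamma h G"
      by (simp add: H1_Gamma_def o_def)
  qed
  moreover have "mosco_2' h G (\<lambda>n. E_sym1 \<epsilon> \<sigma> h div_\<Phi>h)
      (\<lambda>n. E_form \<epsilon> v \<sigma> h \<Phi> div_\<Phi>h (\<alpha> n)) (E_limit \<epsilon> a h G \<Phi> div_\<Phi>h)"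
    unfolding mosco_2'_def
  proof (intro allI impI ballI, elim conjE)
    fix r :: "nat \<Rightarrow> nat" and us :: "nat \<Rightarrow> real^'n \<Rightarrow> real" and u0 w
    assume u0: "u0 \<in> H1_Gamma h G" and w: "w \<in> H1_Gamma h G" and wk: "weakly_converges h G us u0"
      and sup: "(SUP k. E_sym1 \<epsilon> \<sigma> h div_\<Phi>h (us k)) < \<infinity>"
    define p where "p = w \<circ> level_comp G"
    define q where "q = u0 \<circ> level_comp G"
    have p: "p \<in> H1 h" and q: "q \<in> H1 h" using w u0 by (auto simp: H1_Gamma_def p_def q_def)
    obtain K where K: "\<And>k. us k \<in> H1 h" "\<And>k. l2norm \<mu> (\<lambda>x. (us k x, wgrad (us k) x)) \<le> K"
      using bounded[OF sup] by blast
    note pg = H1_graph[OF p]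
    have p_L2: "p \<in> L2 \<mu>" "wgrad p \<in> L2 \<mu>"
      using graph_L2[OF pg] by (simp_all add: pair_L2_iff)
    \<comment> \<open>Elements of \<open>H1_Gamma\<close> are functions of the component itself, so
      invariance holds at every point and not just almost everywhere.\<close>
    have p_inv: "p (\<phi> x t) = p x" if "t \<in> {0..\<tau>}" for x t
      using level_comp_along_curve[OF G_diff G_v \<phi>(2) that, of x] by (simp add: p_def \<phi>(1))
    have vp: "AE x in \<mu>. v x \<bullet> wgrad p x = 0"
      unfolding AE_\<mu> using invariant_directional_derivative_zero[OF pg] p_inv by simp
    \<comment> \<open>Density of the functional sending \<open>f\<close> to the limit form of
      \<open>f\<close> and \<open>p\<close>, relative to the pair of \<open>f\<close> and its
      gradient: the first component collects the coefficients of \<open>f\<close>, the second those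
      of the gradient. It need not be square integrable, since \<open>\<Phi>\<close> and
      \<open>div_\<Phi>h\<close> over \<open>h\<close> need not be bounded.\<close>
    define C where "C x = (1/2 * (\<Phi> x \<bullet> wgrad p x) + 1/2 * (1 / h x * div_\<Phi>h x * p x),
      \<epsilon> *\<^sub>R (a x *v wgrad p x) - (1/2 * p x) *\<^sub>R \<Phi> x)" for x
    have C_inner: "C x \<bullet> (s, \<xi>) = \<epsilon> * (\<xi> \<bullet> (a x *v wgrad p x)) + 1/2 * (1 / h x * div_\<Phi>h x * s * p x) +
        1/2 * (\<Phi> x \<bullet> (s *\<^sub>R wgrad p x - p x *\<^sub>R \<xi>))" for x s \<xi>
      by (simp add: C_def inner_prod_def inner_diff_left inner_diff_right inner_commute algebra_simps)
    have hm: "(\<lambda>x. h x *\<^sub>R \<Phi> x) \<in> borel_measurable borel" "div_\<Phi>h \<in> borel_measurable borel"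
      using div_\<Phi>h by (auto simp: has_weak_divergence_def intro: locally_integrable_measurable)
    \<comment> \<open>Measurability of \<open>\<Phi>\<close> is recovered by division from that of
      \<open>h \<Phi>\<close>, which comes with local integrability.\<close>
    have "(\<lambda>x. (1 / h x) *\<^sub>R (h x *\<^sub>R \<Phi> x)) \<in> borel_measurable borel"
      by (rule borel_measurable_scaleR[OF _ hm(1)]) simp
    moreover have "(1 / h x) *\<^sub>R (h x *\<^sub>R \<Phi> x) = \<Phi> x" for x using h(1)[of x] by simp
    ultimately have \<Phi>m: "\<Phi> \<in> borel_measurable borel" by (simp only:)
    have am: "a \<in> borel_measurable borel" by (rule borel_measurable_continuous_onI[OF a_cont])
    have pm: "p \<in> borel_measurable borel" "wgrad p \<in> borel_measurable borel"
      using p_L2 by (auto dest: L2_borel)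
    have apm: "(\<lambda>x. a x *v wgrad p x) \<in> borel_measurable borel"
      by (rule borel_measurable_matrix_vector_mult[OF am pm(2)])
    have Cm: "C \<in> borel_measurable borel"
      unfolding C_def[abs_def] using \<Phi>m pm apm hm(2) h_measurable
      by (intro borel_measurable_Pair borel_measurable_add borel_measurable_times borel_measurable_inner
          borel_measurable_diff borel_measurable_scaleR borel_measurable_divide borel_measurable_const)
    have ap_L2: "(\<lambda>x. a x *v wgrad p x) \<in> L2 \<mu>"
    proof (rule L2_dominated[OF p_L2(2)])
      let ?b1 = "real CARD('d) * real CARD('n) * b" and ?b2 = "real CARD('n) * real CARD('d) * b"
      show "(\<lambda>x. a x *v wgrad p x) \<in> borel_measurable \<mu>" using apm by simp
      have "norm (a x *v \<xi>) \<le> (?b2 * ?b1) * norm \<xi>" for x \<xi>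
      proof -
        have e: "\<bar>\<sigma> x $ i $ j\<bar> \<le> b" for i j using matrix_entry_le_norm[of "\<sigma> x" i j] b[of x] by simp
        have "b \<ge> 0" using b[of x] norm_ge_zero order_trans by blast
        have "norm (a x *v \<xi>) = norm (\<sigma> x *v (transpose (\<sigma> x) *v \<xi>))"
          by (simp only: a(1) matrix_vector_mul_assoc)
        also have "\<dots> \<le> ?b2 * norm (transpose (\<sigma> x) *v \<xi>)"
          by (rule norm_matrix_vector_le[OF e])
        also have "\<dots> \<le> ?b2 * (?b1 * norm \<xi>)"
          using \<open>b \<ge> 0\<close> by (intro mult_left_mono norm_matrix_vector_le) (simp_all add: transpose_def e)
        finally show ?thesis by (simp only: mult.assoc)
      qed
      then show "AE x in \<mu>. norm (a x *v wgrad p x) \<le> (?b2 * ?b1) * norm (wgrad p x)" by simp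
    qed
    have C_form: "integrable \<mu> (\<lambda>x. C x \<bullet> (f x, wgrad f x))"
      "(LINT x|\<mu>. C x \<bullet> (f x, wgrad f x)) = \<epsilon> * (LINT x|\<mu>. wgrad f x \<bullet> (a x *v wgrad p x)) +
        1/2 * (LINT x|\<mu>. 1 / h x * div_\<Phi>h x * f x * p x) +
        1/2 * (LINT x|\<mu>. \<Phi> x \<bullet> (f x *\<^sub>R wgrad p x - p x *\<^sub>R wgrad f x))" if f: "f \<in> H1 h" for f
    proof -
      have "wgrad f \<in> L2 \<mu>" using graph_L2[OF H1_graph[OF f]] by (simp add: pair_L2_iff)
      then have i: "integrable \<mu> (\<lambda>x. wgrad f x \<bullet> (a x *v wgrad p x))"
        by (rule L2_inner_integrable[OF _ ap_L2])
      note j = form_defined(1)[OF f p] form_defined(2)[OF f p]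
      show "integrable \<mu> (\<lambda>x. C x \<bullet> (f x, wgrad f x))"
        unfolding C_inner by (intro Bochner_Integration.integrable_add integrable_mult_right i j)
      show "(LINT x|\<mu>. C x \<bullet> (f x, wgrad f x)) = \<epsilon> * (LINT x|\<mu>. wgrad f x \<bullet> (a x *v wgrad p x)) +
        1/2 * (LINT x|\<mu>. 1 / h x * div_\<Phi>h x * f x * p x) +
        1/2 * (LINT x|\<mu>. \<Phi> x \<bullet> (f x *\<^sub>R wgrad p x - p x *\<^sub>R wgrad f x))"
        unfolding C_inner
        by (subst Bochner_Integration.integral_add, (intro Bochner_Integration.integrable_add integrable_mult_right i j)+,
            subst Bochner_Integration.integral_add, (intro integrable_mult_right i j)+, simp only: integral_mult_right_zero)
    qed
    \<comment> \<open>\<open>C_form\<close> speaks of pairs built with \<open>wgrad\<close>; a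
      general element of \<open>graph\<close> agrees with such a pair almost everywhere.\<close>
    have C_int: "integrable \<mu> (\<lambda>x. C x \<bullet> U x)" if U: "U \<in> graph" for U
    proof -
      note f = graph_H1[OF U]
      have "AE x in \<mu>. C x \<bullet> (fst (U x), wgrad (\<lambda>x. fst (U x)) x) = C x \<bullet> U x"
        unfolding AE_\<mu> using f(2) by eventually_elim simp
      moreover have "(\<lambda>x. C x \<bullet> U x) \<in> borel_measurable \<mu>"
        using Cm L2_borel[OF graph_L2[OF U]] by (simp add: borel_measurable_inner)
      ultimately show ?thesis
        using integrable_cong_AE[OF borel_measurable_integrable[OF C_form(1)[OF f(1)]]] C_form(1)[OF f(1)] by blast
    qed
    \<comment> \<open>The factor \<open>1/\<beta>\<close> multiplies an integral that is zero: one
      half vanishes because \<open>v\<close> is orthogonal to the gradient of \<open>p\<close>, and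
      then the other does by \<open>divergence_free_product\<close>. The remaining terms no longer
      contain \<open>\<beta>\<close>.\<close>
    have E_eq: "E_form \<epsilon> v \<sigma> h \<Phi> div_\<Phi>h \<beta> f p = (LINT x|\<mu>. C x \<bullet> (f x, wgrad f x))" if f: "f \<in> H1 h" for f \<beta>
    proof -
      note fg = H1_graph[OF f]
      have f_L2: "f \<in> L2 \<mu>" "wgrad f \<in> L2 \<mu>" using graph_L2[OF fg] by (simp_all add: pair_L2_iff)
      have i: "integrable \<mu> (\<lambda>x. f x \<bullet> (v x \<bullet> wgrad p x))" "integrable \<mu> (\<lambda>x. p x \<bullet> (v x \<bullet> wgrad f x))"
        by (intro L2_inner_integrable L2_inner_bounded[OF _ vm B] f_L2 p_L2)+
      have z1: "(LINT x|\<mu>. f x \<bullet> (v x \<bullet> wgrad p x)) = 0"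
        by (rule integral_eq_zero_AE) (use vp in eventually_elim, simp)
      have "(LINT x|\<mu>. f x * (v x \<bullet> wgrad p x)) + (LINT x|\<mu>. p x * (v x \<bullet> wgrad f x)) = 0"
        using divergence_free_product[OF v_inv v_continuous B fg pg] by simp
      with z1 have z2: "(LINT x|\<mu>. p x \<bullet> (v x \<bullet> wgrad f x)) = 0" by simp
      have vv: "v x \<bullet> (f x *\<^sub>R wgrad p x - p x *\<^sub>R wgrad f x) = f x \<bullet> (v x \<bullet> wgrad p x) - p x \<bullet> (v x \<bullet> wgrad f x)" for x
        by (simp add: inner_diff_right)
      have iv: "integrable \<mu> (\<lambda>x. v x \<bullet> (f x *\<^sub>R wgrad p x - p x *\<^sub>R wgrad f x))"
        "(LINT x|\<mu>. v x \<bullet> (f x *\<^sub>R wgrad p x - p x *\<^sub>R wgrad f x)) = 0"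
        unfolding vv using i z1 z2 by simp_all
      have "E_anti v h \<Phi> \<beta> f p = 1/2 * (LINT x|\<mu>. (1/\<beta>) * (v x \<bullet> (f x *\<^sub>R wgrad p x - p x *\<^sub>R wgrad f x)) +
          \<Phi> x \<bullet> (f x *\<^sub>R wgrad p x - p x *\<^sub>R wgrad f x))"
        unfolding E_anti_def by (simp only: inner_add_left inner_scaleR_left)
      also have "\<dots> = 1/2 * (LINT x|\<mu>. \<Phi> x \<bullet> (f x *\<^sub>R wgrad p x - p x *\<^sub>R wgrad f x))"
        by (subst Bochner_Integration.integral_add, rule integrable_mult_right, rule iv(1), rule form_defined(2)[OF f p],
            simp only: integral_mult_right_zero iv(2), simp)
      finally show ?thesis
        unfolding C_form(2)[OF f] E_form_def E_sym_def inner_transpose_mult a(1) by simp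
    qed
    have Elim: "E_limit \<epsilon> a h G \<Phi> div_\<Phi>h u0 w = (LINT x|\<mu>. C x \<bullet> (q x, wgrad q x))"
      unfolding C_form(2)[OF q] E_limit_def Let_def p_def[symmetric] q_def[symmetric] by simp
    have "liminf (\<lambda>k. ereal (E_form \<epsilon> v \<sigma> h \<Phi> div_\<Phi>h (\<alpha> (r k)) (us k) p)) \<le> ereal (E_limit \<epsilon> a h G \<Phi> div_\<Phi>h u0 w)"
    proof (rule ccontr)
      assume "\<not> ?thesis"
      then have "ereal (E_limit \<epsilon> a h G \<Phi> div_\<Phi>h u0 w) <
          liminf (\<lambda>k. ereal (E_form \<epsilon> v \<sigma> h \<Phi> div_\<Phi>h (\<alpha> (r k)) (us k) p))"
        by (simp only: not_le)
      \<comment> \<open>A real \<open>y\<close> strictly between the two sides is a lower bound from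
        some index \<open>N\<close> on; the terms before \<open>N\<close> are dropped because
        \<open>graph_functional_weak_limit\<close> wants the bound along the whole sequence.\<close>
      from ereal_dense2[OF this] obtain y where y: "ereal (E_limit \<epsilon> a h G \<Phi> div_\<Phi>h u0 w) < ereal y"
        "ereal y < liminf (\<lambda>k. ereal (E_form \<epsilon> v \<sigma> h \<Phi> div_\<Phi>h (\<alpha> (r k)) (us k) p))"
        by blast
      from less_LiminfD[OF y(2)] obtain N where
        N: "\<And>k. k \<ge> N \<Longrightarrow> y < E_form \<epsilon> v \<sigma> h \<Phi> div_\<Phi>h (\<alpha> (r k)) (us k) p"
        by (auto simp: eventually_sequentially)
      have "y \<le> (LINT x|\<mu>. C x \<bullet> (q x, wgrad q x))"
      proof (rule graph_functional_weak_limit[where U = "\<lambda>k x. (us (k + N) x, wgrad (us (k + N)) x)" and K = K, OF Cm C_int _ _ H1_graph[OF q]])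
        show "(\<lambda>x. (us (k + N) x, wgrad (us (k + N)) x)) \<in> graph" for k by (rule H1_graph[OF K(1)])
        show "l2norm \<mu> (\<lambda>x. (us (k + N) x, wgrad (us (k + N)) x)) \<le> K" for k by (rule K(2))
        show "(\<lambda>k. LINT x|\<mu>. fst (us (k + N) x, wgrad (us (k + N)) x) * g x) \<longlonglongrightarrow> (LINT x|\<mu>. fst (q x, wgrad q x) * g x)"
          if "g \<in> L2 \<mu>" for g
        proof -
          have "(\<lambda>k. LINT x|\<mu>. us k x * g x) \<longlonglongrightarrow> (LINT x|\<mu>. q x * g x)"
            using wk that by (simp add: weakly_converges_def L2_inner_def q_def)
          from LIMSEQ_ignore_initial_segment[OF this, of N] show ?thesis by simp
        qed
        show "y \<le> (LINT x|\<mu>. C x \<bullet> (us (k + N) x, wgrad (us (k + N)) x))" for k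
          using N[of "k + N"] by (simp add: E_eq[OF K(1)])
      qed
      with y(1) show False by (simp add: Elim)
    qed
    moreover have "strongly_converges h G (\<lambda>_. p) w"
      by (simp add: strongly_converges_def p_def L2_norm_def L2_inner_def)
    ultimately show "\<exists>ws. (\<forall>k. ws k \<in> H1 h) \<and> strongly_converges h G ws w \<and>
        liminf (\<lambda>k. ereal (E_form \<epsilon> v \<sigma> h \<Phi> div_\<Phi>h (\<alpha> (r k)) (us k) (ws k))) \<le> ereal (E_limit \<epsilon> a h G \<Phi> div_\<Phi>h u0 w)"
      using p by (intro exI[of _ "\<lambda>_. p"]) simp
  qed
  ultimately show ?thesis by (simp add: mosco_converges_def)
qed

end
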